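(* Let $p$ be an odd prime. (i) If $p\equiv 3\pmod 4$, then $$A'_{\frac{p-1}{2}}\equiv \frac{p^2}{3}\binom{\frac{p-3}{2}}{\frac{p-3}{4}}^{-2}\pmod{p^3}.$$ (ii) If $p\equiv 1\pmod 4$ and so $p=x^2+4y^2$ with $x,y\in\mathbb{Z}$, then $$A'_{\frac{p-1}{2}}\equiv 4x^2-2p-\frac{p^2}{4x^2}+3p^2x^2E_{p-3}+\frac{p^2}{2}\sum_{k=1}^{(p-1)/2}\frac{\binom{2k}{k}^3}{64^k}\Big(\sum_{i=1}^k\frac{1}{2i-1}\Big)^2\pmod{p^3}.$$
   Context: The Apéry numbers $A'_n$ are defined for integers $n\ge 0$ by $A'_n=\sum_{k=0}^n\binom{n}{k}^2\binom{n+k}{k}$. The Euler numbers $E_n$ are defined by $E_{2n-1}=0$ for $n\ge 1$, $E_0=1$, and $E_{2n}=-\sum_{k=1}^{n}\binom{2n}{2k}E_{2n-2k}$ for $n\ge 1$. Congruences modulo a power of $p$ are between rational numbers whose reduced denominators are not divisible by $p$ (that is, $a\equiv b\pmod{p^r}$ means $a-b\in p^r\mathbb{Z}_{(p)}$). (For $p=3$ the right-hand side in (i) is the integer $3$.) *)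

theory Defs
  imports Complex_Main "HOL-Number_Theory.Number_Theory"
begin

definition apery' :: "nat \<Rightarrow> nat" where
  "apery' n = (\<Sum>k=0..n. (n choose k)\<^sup>2 * ((n + k) choose k))"

text \<open>The recursion is on the index itself; the lemmas below give it in the usual form,
  split into even and odd index.\<close>

fun euler_number :: "nat \<Rightarrow> int" where
  "euler_number n =
     (if n = 0 then 1
      else if odd n then 0
      else - (\<Sum>k=1..n div 2. int (n choose (2 * k)) * euler_number (n - 2 * k)))"

declare euler_number.simps [simp del]

lemma euler_number_0: "euler_number 0 = 1"
  by (simp add: euler_number.simps)

lemma euler_number_odd: "n \<ge> 1 \<Longrightarrow> euler_number (2 * n - 1) = 0"
  by (subst euler_number.simps) simp

lemma euler_number_even:
  "n \<ge> 1 \<Longrightarrow>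
    euler_number (2 * n) =
      - (\<Sum>k=1..n. int ((2 * n) choose (2 * k)) * euler_number (2 * n - 2 * k))"
  by (subst euler_number.simps) simp

text \<open>The localization of the integers at \<open>p\<close>, as a set of rationals;
  \<^term>\<open>quotient_of\<close> returns numerator and denominator in lowest terms.\<close>

definition localized_ints :: "nat \<Rightarrow> rat set" where
  "localized_ints p = {c. \<not> int p dvd snd (quotient_of c)}"

definition rat_cong :: "rat \<Rightarrow> rat \<Rightarrow> nat \<Rightarrow> nat \<Rightarrow> bool" where
  "rat_cong a b p r \<longleftrightarrow> (\<exists>c \<in> localized_ints p. a - b = of_nat p ^ r * c)"

end

theory Submission
  imports Defs "HOL-Computational_Algebra.Formal_Power_Series"
begin

text \<open>
  Put \<open>n = (p - 1) / 2\<close> and \<open>\<beta> k = binom(2k, k)^3 / 64^k = ((1/2)_k / k!)^3\<close>.  The summand of the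
  Apery number with index \<open>k\<close> is \<open>\<beta> k\<close> times a product of factors \<open>1 \<plusminus> p / (2j + 1)\<close> with \<open>j < k\<close>,
  so modulo \<open>p^3\<close> it is \<open>\<beta> k\<close> times a quadratic polynomial in \<open>p\<close> whose coefficients are harmonic
  sums over odd denominators.  Hence the Apery number is congruent to
  \<open>S0 - p S1 + p^2 (S11 - 3 S2) / 2\<close>, where the four sums are weighted with the values of
  \<open>\<beta>\<close>, and \<open>S11\<close> is the double sum in the theorem (\<open>apery_expand\<close>).  A terminating series
  \<open>3F2(-n, n + 1 + s, c; d, e; 1)\<close> expands in these sums and \<open>T2\<close>, the one weighted with
  \<open>1 + 1/2^2 + \<dots> + 1/k^2\<close>, when \<open>s\<close>, \<open>c - 1/2\<close> and \<open>d - 1 = 1 - e\<close> are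
  multiples of \<open>p\<close> (\<open>hyp_sum_expand\<close>).  The summation theorems of Watson and of Whipple evaluate four
  such series, which gives four linear congruences between the unknown sums; reversing the order of
  summation gives a fifth.  If \<open>n\<close> is odd, three of the four series vanish, and what is left
  expresses the Apery number by a single series of Whipple type with an explicit value of
  order \<open>p^2\<close>: this is the case \<open>p \<equiv> 3 (mod 4)\<close>.  If \<open>n = 2m\<close>, the congruences eliminate everything but
  \<open>S11\<close>, the number \<open>W = (binom(2m, m) / 4^m)^2\<close> and \<open>K = 1 + 1/2^2 + \<dots> + 1/m^2\<close>
  (\<open>apery_eq_binomial_even\<close>).

  It remains to find \<open>W\<close> modulo \<open>p^3\<close> in terms of \<open>p = X^2 + Y^2\<close> with \<open>X\<close> odd, a refinement of the
  classical fact that \<open>binom(2m, m)\<close> is \<open>\<plusminus>2X\<close> modulo \<open>p\<close>.  Let \<open>\<gamma>\<close> be a primitive root of unity of order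
  \<open>p - 1\<close> modulo \<open>p^3\<close> and \<open>\<iota> = \<gamma>^m\<close>, so that \<open>\<iota>^2 \<equiv> -1\<close>.  The Jacobi sum of a quartic and the
  quadratic character is \<open>J = X - \<iota> Y\<close>, as all character values are fourth roots of unity.  On the other
  hand, in the residue class of \<open>2m\<close> modulo \<open>p - 1\<close> the power \<open>(1 - \<gamma>^i)^N\<close> depends on \<open>N\<close> modulo \<open>p^3\<close>
  like a polynomial of degree two, and the quadratic character of \<open>1 - \<gamma>^i\<close> is its value at \<open>N = 0\<close>;
  Lagrange interpolation from \<open>N = 2m, 6m, 10m\<close> and the orthogonality of the powers of \<open>\<gamma>\<close> turn \<open>J\<close> into
  a combination of four binomial coefficients (\<open>jacobi_sum\<close>).  All four are \<open>binom(2m, m)\<close> times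
  products of factors close to one, which gives \<open>J^2 \<equiv> W (1 - p^2 K / 8)\<close>.  The conjugate sum
  \<open>J' = X + \<iota> Y\<close> is divisible by \<open>p\<close>, and the same method yields \<open>J J' \<equiv> p (mod p^2)\<close>; as
  \<open>J J' \<equiv> X^2 + Y^2\<close> is small, \<open>X^2 + Y^2 = p\<close>.  From \<open>J + J' = 2X\<close> and \<open>J J' \<equiv> p\<close> one gets
  \<open>J^2 \<equiv> 4X^2 - 2p - p^2 / (4X^2)\<close> (\<open>quartic_representation\<close>).

  Finally \<open>K \<equiv> 4 E_(p-3) (mod p)\<close>: the polynomials \<open>f(x) = \<Sum>i. binom(r, i) E_i x^(r-i)\<close> satisfy
  \<open>f(x + 1) + f(x - 1) = 2 x^r\<close>, and for \<open>r = p - 3\<close> this telescopes to alternating sums of inverse squares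
  (\<open>euler_number_pcong\<close>).
\<close>

section \<open>Binomial coefficients and factorials as products\<close>

lemma central_binomial_prod:
  "of_nat ((2 * k) choose k) / 4 ^ k
    = (\<Prod>j<k. (2 * of_nat j + 1) / (2 * (of_nat j + 1)) :: 'a::field_char_0)"
proof (induction k)
  case (Suc k)
  have nz: "of_nat k + 1 \<noteq> (0 :: 'a)" by (metis of_nat_Suc of_nat_neq_0 add.commute)
  have "(of_nat ((2 * Suc k) choose Suc k) :: 'a) = fact (2 * k + 2) / (fact (k + 1))\<^sup>2"
    by (subst binomial_fact) (auto simp: power2_eq_square)
  also have "\<dots> = (2 * of_nat k + 2) * (2 * of_nat k + 1) / (of_nat k + 1)\<^sup>2 * (fact (2 * k) / (fact k)\<^sup>2)"
  proof -
    have "fact (2 * k + 2) = (2 * of_nat k + 2) * (2 * of_nat k + 1) * (fact (2 * k) :: 'a)"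
      by (simp add: algebra_simps)
    moreover have "fact (k + 1) = (of_nat k + 1) * (fact k :: 'a)"
      by (simp add: algebra_simps)
    ultimately show ?thesis by (simp only: power_mult_distrib times_divide_times_eq)
  qed
  also have "fact (2 * k) / (fact k)\<^sup>2 = (of_nat ((2 * k) choose k) :: 'a)"
    by (subst binomial_fact) (auto simp: power2_eq_square)
  also have "(2 * of_nat k + 2) * (2 * of_nat k + 1) / (of_nat k + 1)\<^sup>2
      = (4 :: 'a) * ((2 * of_nat k + 1) / (2 * (of_nat k + 1)))"
    using nz by (simp add: divide_simps power2_eq_square) (simp add: algebra_simps)
  finally have *: "(of_nat ((2 * Suc k) choose Suc k) :: 'a)
      = 4 * ((2 * of_nat k + 1) / (2 * (of_nat k + 1))) * of_nat ((2 * k) choose k)" .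
  have "4 * r * c / (4 * d) = c / d * r" for r c d :: 'a by simp
  then show ?case by (simp only: * power_Suc prod.lessThan_Suc Suc.IH[symmetric])
qed simp

lemma binomial_prod:
  "of_nat (n choose k) = (\<Prod>j<k. (of_nat n - of_nat j) / (of_nat j + 1) :: 'a::field_char_0)"
proof (induction k)
  case (Suc k)
  have nz: "of_nat k + 1 \<noteq> (0 :: 'a)" by (metis of_nat_Suc of_nat_neq_0 add.commute)
  have "(n choose Suc k) * Suc k = (n choose k) * (n - k)"
    by (metis binomial_absorb_comp binomial_absorption mult.commute)
  then have "(of_nat (n choose Suc k) :: 'a) * (of_nat k + 1) = of_nat (n choose k) * of_nat (n - k)"
    by (metis of_nat_Suc of_nat_mult add.commute)
  moreover have "(of_nat (n choose k) :: 'a) * of_nat (n - k) = of_nat (n choose k) * (of_nat n - of_nat k)"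
    by (cases "k \<le> n") (auto simp: of_nat_diff)
  ultimately have "(of_nat (n choose Suc k) :: 'a)
      = of_nat (n choose k) * ((of_nat n - of_nat k) / (of_nat k + 1))"
    using nz by (simp add: eq_divide_eq)
  then show ?case unfolding Suc.IH by simp
qed simp

text \<open>Every binomial coefficient below is compared with a smaller one through this quotient: with \<open>a\<close> a
  multiple of \<open>p\<close> the factors on the right are congruent to one.\<close>

lemma fact_add_prod:
  "fact (a + b) = (fact a * fact b * (\<Prod>j<b. 1 + of_nat a / (of_nat j + 1)) :: rat)"
proof (induction b)
  case (Suc b)
  have "of_nat b + 1 \<noteq> (0 :: rat)" by (metis of_nat_Suc of_nat_neq_0 add.commute)
  then have "(of_nat a + of_nat b + 1 :: rat) = (of_nat b + 1) * (1 + of_nat a / (of_nat b + 1))"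
    by (simp add: field_simps)
  moreover have "fact (a + Suc b) = (of_nat a + of_nat b + 1) * (fact (a + b) :: rat)"
    by (simp add: algebra_simps)
  moreover have "fact (Suc b) = (of_nat b + 1) * (fact b :: rat)" by (simp add: algebra_simps)
  ultimately show ?case by (simp only: Suc.IH prod.lessThan_Suc ac_simps)
qed simp

lemma prod_lessThan_add: "(\<Prod>j<a+b. f j) = (\<Prod>j<a. f j) * (\<Prod>i<b. f (a + i) :: 'a::comm_monoid_mult)" for a b :: nat
  by (induction b) (simp_all add: mult.assoc)

section \<open>The terminating summation theorems of Watson and Whipple\<close>

text \<open>The summand of \<open>3F2(-n, n + 1 + s, c; d, e; 1)\<close>.  Keeping the offset \<open>s\<close> instead of the second
  parameter makes both Watson's and Whipple's series a family in \<open>n\<close> with \<open>s\<close>, \<open>c\<close>, \<open>d\<close>, \<open>e\<close> fixed, which is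
  what the recurrence in \<open>n\<close> needs.\<close>

definition hyp_term :: "nat \<Rightarrow> 'a::field_char_0 \<Rightarrow> 'a \<Rightarrow> 'a \<Rightarrow> 'a \<Rightarrow> nat \<Rightarrow> 'a" where
  "hyp_term n s c d e k =
     (\<Prod>j<k. (of_nat j - of_nat n) * (of_nat n + 1 + s + of_nat j) * (c + of_nat j) /
       ((of_nat j + 1) * (d + of_nat j) * (e + of_nat j)))"

definition hyp_sum :: "nat \<Rightarrow> 'a::field_char_0 \<Rightarrow> 'a \<Rightarrow> 'a \<Rightarrow> 'a \<Rightarrow> 'a" where
  "hyp_sum n s c d e = (\<Sum>k\<le>n. hyp_term n s c d e k)"

lemma hyp_term_eq_0: "k > n \<Longrightarrow> hyp_term n s c d e k = 0"
  unfolding hyp_term_def by (rule prod_zero) auto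

lemma hyp_sum_extend: "N \<ge> n \<Longrightarrow> hyp_sum n s c d e = (\<Sum>k\<le>N. hyp_term n s c d e k)"
  unfolding hyp_sum_def by (rule sum.mono_neutral_left) (auto simp: hyp_term_eq_0)

text \<open>Zeilberger's method with a certificate that is as simple as possible.  The terms for \<open>n\<close> and
  for \<open>n + 2\<close> are polynomial multiples of the common term \<open>B k\<close>, whose numerator parameters are
  \<open>-n - 2\<close> and \<open>n + 1 + s\<close>.  In the two applications the combination on the left of the assumption \<open>cert\<close>
  is a constant \<open>\<gamma>\<close> times the polynomial that \<open>B (k + 1) / B k\<close> turns into a difference, so the sum over
  \<open>k\<close> telescopes.  Dividing by nothing but \<open>d + j\<close> and \<open>e + j\<close> avoids the poles of the quotient of the two
  terms at \<open>k = n + 1\<close> and \<open>k = n + 2\<close>.\<close>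

lemma hyp_sum_recurrence:
  fixes s c d e \<alpha> \<beta> \<gamma> :: "'a::field_char_0"
  assumes d: "\<And>j. d + of_nat j \<noteq> 0" and e: "\<And>j. e + of_nat j \<noteq> 0"
    and cert: "\<And>k. \<alpha> * (of_nat n + 1 + s + k) * (of_nat n + 2 + s + k)
        - \<beta> * (k - of_nat n - 2) * (k - of_nat n - 1)
      = \<gamma> * ((k - of_nat n - 2) * (of_nat n + 1 + s + k) * (c + k)
        - k * (d - 1 + k) * (e - 1 + k))"
  shows "\<alpha> * (of_nat n + 1 + s) * (of_nat n + 2 + s) * hyp_sum (n + 2) s c d e
       = \<beta> * (of_nat n + 1) * (of_nat n + 2) * hyp_sum n s c d e"
proof -
  define B where "B k = (\<Prod>j<k. (of_nat j - of_nat n - 2) * (of_nat n + 1 + s + of_nat j) *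
    (c + of_nat j) / ((of_nat j + 1) * (d + of_nat j) * (e + of_nat j)))" for k
  have low: "(of_nat n + 1) * (of_nat n + 2) * hyp_term n s c d e k
      = B k * ((of_nat k - of_nat n - 2) * (of_nat k - of_nat n - 1))" for k
  proof (induction k)
    case (Suc k)
    define u where "u = (of_nat n + 1 + s + of_nat k) * (c + of_nat k) /
      ((of_nat k + 1) * (d + of_nat k) * (e + of_nat k))"
    have 1: "hyp_term n s c d e (Suc k) = hyp_term n s c d e k * ((of_nat k - of_nat n) * u)"
      by (simp add: hyp_term_def u_def)
    have 2: "B (Suc k) = B k * ((of_nat k - of_nat n - 2) * u)"
      by (simp add: B_def u_def)
    have "(of_nat n + 1) * (of_nat n + 2) * hyp_term n s c d e (Suc k)
        = ((of_nat n + 1) * (of_nat n + 2) * hyp_term n s c d e k) * ((of_nat k - of_nat n) * u)"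
      by (simp only: 1 mult.assoc)
    also have "\<dots> = B (Suc k) * ((of_nat (Suc k) - of_nat n - 2) * (of_nat (Suc k) - of_nat n - 1))"
      unfolding Suc.IH 2 by (simp add: algebra_simps)
    finally show ?case .
  qed (simp add: hyp_term_def B_def algebra_simps)
  have high: "(of_nat n + 1 + s) * (of_nat n + 2 + s) * hyp_term (n + 2) s c d e k
      = B k * ((of_nat n + 1 + s + of_nat k) * (of_nat n + 2 + s + of_nat k))" for k
  proof (induction k)
    case (Suc k)
    define u where "u = (of_nat k - of_nat n - 2) * (c + of_nat k) /
      ((of_nat k + 1) * (d + of_nat k) * (e + of_nat k))"
    have 1: "hyp_term (n + 2) s c d e (Suc k) =
        hyp_term (n + 2) s c d e k * ((of_nat n + 3 + s + of_nat k) * u)"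
      by (simp add: hyp_term_def u_def algebra_simps)
    have 2: "B (Suc k) = B k * ((of_nat n + 1 + s + of_nat k) * u)"
      by (simp add: B_def u_def)
    have "(of_nat n + 1 + s) * (of_nat n + 2 + s) * hyp_term (n + 2) s c d e (Suc k)
        = ((of_nat n + 1 + s) * (of_nat n + 2 + s) * hyp_term (n + 2) s c d e k) *
          ((of_nat n + 3 + s + of_nat k) * u)"
      by (simp only: 1 mult.assoc)
    also have "\<dots> = B (Suc k) * ((of_nat n + 1 + s + of_nat (Suc k)) * (of_nat n + 2 + s + of_nat (Suc k)))"
      unfolding Suc.IH 2 by (simp add: algebra_simps)
    finally show ?case .
  qed (simp add: hyp_term_def B_def algebra_simps)
  define G where "G k = B k * (\<gamma> * (of_nat k * (d - 1 + of_nat k) * (e - 1 + of_nat k)))" for k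
  have G_Suc: "G (Suc k) = B k * (\<gamma> * ((of_nat k - of_nat n - 2) *
      (of_nat n + 1 + s + of_nat k) * (c + of_nat k)))" for k
  proof -
    have "of_nat k + 1 \<noteq> (0::'a)" by (metis of_nat_Suc of_nat_neq_0 add.commute)
    moreover have "B (Suc k) = B k * ((of_nat k - of_nat n - 2) * (of_nat n + 1 + s + of_nat k) *
      (c + of_nat k) / ((of_nat k + 1) * (d + of_nat k) * (e + of_nat k)))"
      by (simp add: B_def)
    ultimately show ?thesis using d[of k] e[of k] by (simp add: G_def add.commute)
  qed
  have "(\<Sum>k<K. \<alpha> * ((of_nat n + 1 + s) * (of_nat n + 2 + s) * hyp_term (n + 2) s c d e k)
      - \<beta> * ((of_nat n + 1) * (of_nat n + 2) * hyp_term n s c d e k)) = G K" for K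
  proof (induction K)
    case (Suc K)
    have "\<alpha> * ((of_nat n + 1 + s) * (of_nat n + 2 + s) * hyp_term (n + 2) s c d e K)
        - \<beta> * ((of_nat n + 1) * (of_nat n + 2) * hyp_term n s c d e K)
        = B K * (\<alpha> * (of_nat n + 1 + s + of_nat K) * (of_nat n + 2 + s + of_nat K)
        - \<beta> * (of_nat K - of_nat n - 2) * (of_nat K - of_nat n - 1))"
      unfolding low high by (simp add: algebra_simps)
    also have "\<dots> = G (Suc K) - G K"
      unfolding cert G_Suc by (simp add: G_def algebra_simps)
    finally show ?case using Suc.IH by simp
  qed (simp add: G_def)
  from this[of "n + 3"]
  have "(\<Sum>k\<le>n+2. \<alpha> * ((of_nat n + 1 + s) * (of_nat n + 2 + s) * hyp_term (n + 2) s c d e k)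
      - \<beta> * ((of_nat n + 1) * (of_nat n + 2) * hyp_term n s c d e k)) = G (n + 3)"
    by (simp add: lessThan_Suc_atMost[symmetric] numeral_3_eq_3)
  moreover have "B (n + 3) = 0"
    unfolding B_def by (rule prod_zero[OF _ bexI[of _ "n + 2"]]) auto
  ultimately have "(\<Sum>k\<le>n+2. \<alpha> * ((of_nat n + 1 + s) * (of_nat n + 2 + s) * hyp_term (n + 2) s c d e k))
      = (\<Sum>k\<le>n+2. \<beta> * ((of_nat n + 1) * (of_nat n + 2) * hyp_term n s c d e k))"
    by (simp only: sum_subtractf G_def mult_zero_left eq_iff_diff_eq_0[symmetric])
  then have "\<alpha> * ((of_nat n + 1 + s) * (of_nat n + 2 + s) * (\<Sum>k\<le>n+2. hyp_term (n + 2) s c d e k))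
      = \<beta> * ((of_nat n + 1) * (of_nat n + 2) * (\<Sum>k\<le>n+2. hyp_term n s c d e k))"
    by (simp only: sum_distrib_left)
  then show ?thesis
    by (simp only: hyp_sum_extend[of n "n + 2", OF le_add1] hyp_sum_def[of "n + 2"] mult.assoc)
qed

text \<open>In terms of \<open>b = n + 1 + 2z\<close> and \<open>c = 1/2 + w\<close> this is the series
  \<open>3F2(-n, b, c; (1 - n + b)/2, 2c; 1)\<close> of Watson's theorem; keeping \<open>z\<close> and \<open>w\<close> fixed removes \<open>n\<close> from the
  denominator parameters.\<close>

lemma watson_recurrence:
  fixes w z :: "'a::field_char_0"
  assumes w: "\<And>i. 2 * w + of_nat (Suc i) \<noteq> 0" and z: "\<And>i. 2 * z + of_nat (Suc i) \<noteq> 0"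
  shows "(of_nat n + 2 + 2 * w) * (of_nat n + 2 + 2 * z) *
      hyp_sum (n + 2) (2 * z) (1 / 2 + w) (1 + z) (1 + 2 * w)
    = (of_nat n + 1) * (of_nat n + 1 + 2 * z - 2 * w) *
      hyp_sum n (2 * z) (1 / 2 + w) (1 + z) (1 + 2 * w)"
proof -
  define N :: 'a where "N = of_nat n"
  have d: "1 + z + of_nat j \<noteq> 0" for j
  proof
    assume "1 + z + of_nat j = 0"
    then have "2 * (1 + z + of_nat j) = 0" by simp
    then have "2 * z + of_nat (Suc (2 * j + 1)) = 0" by (simp add: algebra_simps)
    with z show False by blast
  qed
  have e: "1 + 2 * w + of_nat j \<noteq> 0" for j
    using w[of j] by (simp add: algebra_simps)
  \<comment> \<open>The constant \<open>\<gamma>\<close> of the certificate is found by comparing both sides at \<open>k = 0\<close>.\<close>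
  have "((N + 2 + 2 * w) * (N + 2)) * (N + 1 + 2 * z) * (N + 2 + 2 * z) *
      hyp_sum (n + 2) (2 * z) (1 / 2 + w) (1 + z) (1 + 2 * w)
    = ((N + 1 + 2 * z - 2 * w) * (N + 1 + 2 * z)) * (N + 1) * (N + 2) *
      hyp_sum n (2 * z) (1 / 2 + w) (1 + z) (1 + 2 * w)"
    unfolding N_def
    by (rule hyp_sum_recurrence[OF d e, where \<gamma> = "- 2 * (2 * of_nat n + 3 + 2 * z)"])
      (simp add: field_simps)
  moreover have "N + 2 \<noteq> 0" "N + 1 + 2 * z \<noteq> 0"
    using z[of n] of_nat_neq_0[of "Suc n", where 'a = 'a]
    by (simp_all add: N_def algebra_simps)
  ultimately have "((N + 2) * (N + 1 + 2 * z)) * ((N + 2 + 2 * w) * (N + 2 + 2 * z) *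
      hyp_sum (n + 2) (2 * z) (1 / 2 + w) (1 + z) (1 + 2 * w))
    = ((N + 2) * (N + 1 + 2 * z)) * ((N + 1) * (N + 1 + 2 * z - 2 * w) *
      hyp_sum n (2 * z) (1 / 2 + w) (1 + z) (1 + 2 * w))"
    by (simp only: ac_simps)
  with \<open>N + 2 \<noteq> 0\<close> \<open>N + 1 + 2 * z \<noteq> 0\<close> show ?thesis
    by (simp only: mult_cancel_left mult_eq_0_iff simp_thms N_def)
qed

lemma watson_even:
  fixes w z :: "'a::field_char_0"
  assumes w: "\<And>i. 2 * w + of_nat (Suc i) \<noteq> 0" and z: "\<And>i. 2 * z + of_nat (Suc i) \<noteq> 0"
  shows "hyp_sum (2 * m) (2 * z) (1 / 2 + w) (1 + z) (1 + 2 * w) =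
    (\<Prod>j<m. (2 * of_nat j + 1) * (2 * of_nat j + 1 + 2 * z - 2 * w) /
      ((2 * of_nat j + 2 + 2 * w) * (2 * of_nat j + 2 + 2 * z)))"
proof (induction m)
  case 0
  show ?case by (simp add: hyp_sum_def hyp_term_def)
next
  case (Suc m)
  have nz: "2 * of_nat m + 2 + 2 * w \<noteq> 0" "2 * of_nat m + 2 + 2 * z \<noteq> 0"
    using w[of "2 * m + 1"] z[of "2 * m + 1"] by (simp_all add: algebra_simps)
  have "hyp_sum (2 * Suc m) (2 * z) (1 / 2 + w) (1 + z) (1 + 2 * w) =
    ((2 * of_nat m + 1) * (2 * of_nat m + 1 + 2 * z - 2 * w) *
      hyp_sum (2 * m) (2 * z) (1 / 2 + w) (1 + z) (1 + 2 * w)) /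
      ((2 * of_nat m + 2 + 2 * w) * (2 * of_nat m + 2 + 2 * z))"
    using watson_recurrence[OF w z, of "2 * m"] nz
    by (intro eq_divide_imp) (simp_all add: mult.commute mult.left_commute)
  then show ?case unfolding Suc.IH by simp
qed

lemma watson_odd:
  fixes w z :: "'a::field_char_0"
  assumes w: "\<And>i. 2 * w + of_nat (Suc i) \<noteq> 0" and z: "\<And>i. 2 * z + of_nat (Suc i) \<noteq> 0"
  shows "hyp_sum (2 * m + 1) (2 * z) (1 / 2 + w) (1 + z) (1 + 2 * w) = 0"
proof (induction m)
  case 0
  have "1 + z \<noteq> 0" "1 + 2 * w \<noteq> 0"
    using w[of 0] z[of 1] by (auto simp: algebra_simps add_eq_0_iff)
  moreover have "hyp_sum 1 (2 * z) (1 / 2 + w) (1 + z) (1 + 2 * w) =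
      1 + (- 2 - 2 * z) * (1 / 2 + w) / ((1 + z) * (1 + 2 * w))"
    by (simp add: hyp_sum_def hyp_term_def)
  moreover have "(- 2 - 2 * z) * (1 / 2 + w) = - ((1 + z) * (1 + 2 * w))"
    by (simp add: algebra_simps)
  ultimately show ?case by simp
next
  case (Suc m)
  have nz: "of_nat (2 * m + 1) + 2 + 2 * w \<noteq> 0" "of_nat (2 * m + 1) + 2 + 2 * z \<noteq> 0"
    using w[of "2 * m + 2"] z[of "2 * m + 2"] by (simp_all add: algebra_simps)
  have "(of_nat (2 * m + 1) + 2 + 2 * w) * (of_nat (2 * m + 1) + 2 + 2 * z) *
      hyp_sum (2 * m + 1 + 2) (2 * z) (1 / 2 + w) (1 + z) (1 + 2 * w) = 0"
    unfolding watson_recurrence[OF w z, of "2 * m + 1"] Suc.IH by simp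
  with nz show ?case by (simp only: mult_eq_0_iff simp_thms) (simp add: eval_nat_numeral)
qed

text \<open>The case \<open>c = 1/2\<close> of Whipple's theorem on \<open>3F2(a, 1 - a, c; e, 1 + 2c - e; 1)\<close>, at \<open>a = -n\<close>.\<close>

lemma whipple_recurrence:
  fixes z :: "'a::field_char_0"
  assumes z: "\<And>i. (of_nat (Suc i))\<^sup>2 \<noteq> z\<^sup>2"
  shows "((of_nat n + 2)\<^sup>2 - z\<^sup>2) * hyp_sum (n + 2) 0 (1 / 2) (1 + z) (1 - z)
    = ((of_nat n + 1)\<^sup>2 - z\<^sup>2) * hyp_sum n 0 (1 / 2) (1 + z) (1 - z)"
proof -
  define N :: 'a where "N = of_nat n"
  have d: "1 + z + of_nat j \<noteq> 0" for j
  proof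
    assume "1 + z + of_nat j = 0"
    then have "z = - of_nat (Suc j)" by (simp add: algebra_simps add_eq_0_iff)
    then have "z\<^sup>2 = (of_nat (Suc j))\<^sup>2" by (simp only: power2_minus)
    with z[of j] show False by simp
  qed
  have e: "1 - z + of_nat j \<noteq> 0" for j
  proof
    assume "1 - z + of_nat j = 0"
    then have "z = of_nat (Suc j)" by (simp add: algebra_simps)
    with z[of j] show False by simp
  qed
  have "((N + 2)\<^sup>2 - z\<^sup>2) * (N + 1 + 0) * (N + 2 + 0) * hyp_sum (n + 2) 0 (1 / 2) (1 + z) (1 - z)
    = ((N + 1)\<^sup>2 - z\<^sup>2) * (N + 1) * (N + 2) * hyp_sum n 0 (1 / 2) (1 + z) (1 - z)"
    unfolding N_def
    by (rule hyp_sum_recurrence[OF d e, where \<gamma> = "- 2 * (2 * of_nat n + 3)"])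
      (simp add: field_simps power2_eq_square)
  then have "((N + 1) * (N + 2)) * (((N + 2)\<^sup>2 - z\<^sup>2) * hyp_sum (n + 2) 0 (1 / 2) (1 + z) (1 - z))
    = ((N + 1) * (N + 2)) * (((N + 1)\<^sup>2 - z\<^sup>2) * hyp_sum n 0 (1 / 2) (1 + z) (1 - z))"
    by (simp only: ac_simps add_0_left)
  moreover have "N + 2 \<noteq> 0" "N + 1 \<noteq> 0"
    using of_nat_neq_0[of "Suc n", where 'a = 'a] of_nat_neq_0[of n, where 'a = 'a]
    by (simp_all add: N_def algebra_simps)
  ultimately show ?thesis
    by (simp only: mult_cancel_left mult_eq_0_iff simp_thms N_def)
qed

lemma whipple_even:
  fixes z :: "'a::field_char_0"
  assumes z: "\<And>i. (of_nat (Suc i))\<^sup>2 \<noteq> z\<^sup>2"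
  shows "hyp_sum (2 * m) 0 (1 / 2) (1 + z) (1 - z) =
    (\<Prod>j<m. ((2 * of_nat j + 1)\<^sup>2 - z\<^sup>2) / ((2 * of_nat j + 2)\<^sup>2 - z\<^sup>2))"
proof (induction m)
  case 0
  show ?case by (simp add: hyp_sum_def hyp_term_def)
next
  case (Suc m)
  have "(2 * of_nat m + 2)\<^sup>2 - z\<^sup>2 \<noteq> 0"
    using z[of "2 * m + 1"] by (simp add: algebra_simps)
  then have "hyp_sum (2 * Suc m) 0 (1 / 2) (1 + z) (1 - z) =
    (((2 * of_nat m + 1)\<^sup>2 - z\<^sup>2) * hyp_sum (2 * m) 0 (1 / 2) (1 + z) (1 - z)) /
      ((2 * of_nat m + 2)\<^sup>2 - z\<^sup>2)"
    using whipple_recurrence[OF z, of "2 * m"]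
    by (intro eq_divide_imp) (simp_all add: mult.commute mult.left_commute)
  then show ?case unfolding Suc.IH by simp
qed

text \<open>The factor \<open>z^2\<close> in front is what makes the Apery number divisible by \<open>p^2\<close> in the case of odd \<open>n\<close>.\<close>

lemma whipple_odd:
  fixes z :: "'a::field_char_0"
  assumes z: "\<And>i. (of_nat (Suc i))\<^sup>2 \<noteq> z\<^sup>2"
  shows "hyp_sum (2 * m + 1) 0 (1 / 2) (1 + z) (1 - z) =
    - z\<^sup>2 / (1 - z\<^sup>2) * (\<Prod>j<m. ((2 * of_nat j + 2)\<^sup>2 - z\<^sup>2) / ((2 * of_nat j + 3)\<^sup>2 - z\<^sup>2))"
proof (induction m)
  case 0
  have eq: "(1 + z) * (1 - z) = 1 - z\<^sup>2" by (simp add: algebra_simps power2_eq_square)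
  have "1 - z\<^sup>2 \<noteq> 0" using z[of 0] by simp
  then have "hyp_sum 1 0 (1 / 2) (1 + z) (1 - z) = - z\<^sup>2 / (1 - z\<^sup>2)"
    unfolding hyp_sum_def hyp_term_def by (simp add: eq field_simps power2_eq_square)
  then show ?case by simp
next
  case (Suc m)
  have "(2 * of_nat m + 3)\<^sup>2 - z\<^sup>2 \<noteq> 0"
    using z[of "2 * m + 2"] by (simp add: algebra_simps)
  moreover have "((2 * of_nat m + 3)\<^sup>2 - z\<^sup>2) * hyp_sum (2 * Suc m + 1) 0 (1 / 2) (1 + z) (1 - z) =
    ((2 * of_nat m + 2)\<^sup>2 - z\<^sup>2) * hyp_sum (2 * m + 1) 0 (1 / 2) (1 + z) (1 - z)"
    using whipple_recurrence[OF z, of "2 * m + 1"] by (simp add: algebra_simps eval_nat_numeral)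
  ultimately have "hyp_sum (2 * Suc m + 1) 0 (1 / 2) (1 + z) (1 - z) =
    (((2 * of_nat m + 2)\<^sup>2 - z\<^sup>2) * hyp_sum (2 * m + 1) 0 (1 / 2) (1 + z) (1 - z)) /
      ((2 * of_nat m + 3)\<^sup>2 - z\<^sup>2)"
    by (intro eq_divide_imp) (simp_all add: mult.commute)
  then show ?case unfolding Suc.IH by simp
qed

section \<open>Congruences between rationals integral at a prime\<close>

locale odd_prime =
  fixes p :: nat
  assumes prime: "prime p" and odd: "odd p"
begin

abbreviation pp :: rat where "pp \<equiv> of_nat p"

abbreviation Zp :: "rat set" where "Zp \<equiv> localized_ints p"

text \<open>The units of the localization at \<open>p\<close>; division by them preserves integrality and congruences.\<close>

definition Zunits :: "rat set" where
  "Zunits = {x \<in> Zp. x \<noteq> 0 \<and> inverse x \<in> Zp}"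

text \<open>The argument order of the relation differs from that of \<open>rat_cong\<close> so that the right-hand side
  comes last, as chains of congruences require.\<close>

definition pcong :: "rat \<Rightarrow> nat \<Rightarrow> rat \<Rightarrow> bool" ("(_/ \<approx>[_] _)" [51, 0, 51] 50) where
  "x \<approx>[k] y \<longleftrightarrow> rat_cong x y p k"

lemma p_gt_2: "p > 2"
  using prime odd prime_ge_2_nat[of p] by (cases "p = 2") auto

lemma p_nonzero [simp]: "p \<noteq> 0" "0 < p"
  using p_gt_2 by simp_all

lemma Zp_iff: "c \<in> Zp \<longleftrightarrow> (\<exists>a b. \<not> int p dvd b \<and> c = of_int a / of_int b)"
proof
  assume "c \<in> Zp"
  then have "\<not> int p dvd snd (quotient_of c)" by (simp add: localized_ints_def)
  moreover have "c = of_int (fst (quotient_of c)) / of_int (snd (quotient_of c))"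
    by (metis prod.collapse quotient_of_div)
  ultimately show "\<exists>a b. \<not> int p dvd b \<and> c = of_int a / of_int b" by blast
next
  assume "\<exists>a b. \<not> int p dvd b \<and> c = of_int a / of_int b"
  then obtain a b where b: "\<not> int p dvd b" and c: "c = of_int a / of_int b" by blast
  obtain a' b' where q: "quotient_of c = (a', b')" by (metis surj_pair)
  have c': "c = of_int a' / of_int b'" and "b' > 0" and cop: "coprime a' b'"
    using q quotient_of_div quotient_of_denom_pos quotient_of_coprime by blast+
  have "b \<noteq> 0" using b by auto
  with c c' \<open>b' > 0\<close> have "(of_int (a' * b) :: rat) = of_int (a * b')"
    by (simp add: field_simps)
  then have eq: "a' * b = a * b'" by (simp only: of_int_eq_iff)
  have "\<not> int p dvd b'"
  proof
    assume d: "int p dvd b'"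
    then have "int p dvd a' * b" using eq by simp
    then have "int p dvd a'" using prime b prime_dvd_mult_iff[of "int p"] by auto
    with d cop have "is_unit (int p)" by (meson coprime_common_divisor)
    then show False using p_gt_2 by simp
  qed
  then show "c \<in> Zp" using q by (simp add: localized_ints_def)
qed

lemma Zp_of_int [simp, intro]: "of_int a \<in> Zp"
  unfolding Zp_iff using p_gt_2 by (intro exI[of _ a] exI[of _ 1]) auto

lemma Zp_of_nat [simp, intro]: "of_nat a \<in> Zp"
  using Zp_of_int[of "int a"] by simp

lemma Zp_numeral [simp, intro]: "numeral a \<in> Zp" "0 \<in> Zp" "1 \<in> Zp"
  using Zp_of_nat[of "numeral a"] Zp_of_nat[of 0] Zp_of_nat[of 1] by simp_all

lemma Zp_add [simp, intro]: assumes "x \<in> Zp" "y \<in> Zp" shows "x + y \<in> Zp"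
proof -
  obtain a b c d where "\<not> int p dvd b" "x = of_int a / of_int b"
    "\<not> int p dvd d" "y = of_int c / of_int d" using assms unfolding Zp_iff by metis
  moreover from this have "b \<noteq> 0" "d \<noteq> 0" by auto
  ultimately have "\<not> int p dvd b * d" "x + y = of_int (a * d + c * b) / of_int (b * d)"
    using prime by (auto simp: prime_dvd_mult_iff field_simps)
  then show ?thesis unfolding Zp_iff by blast
qed

lemma Zp_mult [simp, intro]: assumes "x \<in> Zp" "y \<in> Zp" shows "x * y \<in> Zp"
proof -
  obtain a b c d where "\<not> int p dvd b" "x = of_int a / of_int b"
    "\<not> int p dvd d" "y = of_int c / of_int d" using assms unfolding Zp_iff by metis
  then have "\<not> int p dvd b * d" "x * y = of_int (a * c) / of_int (b * d)"
    using prime by (auto simp: prime_dvd_mult_iff)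
  then show ?thesis unfolding Zp_iff by blast
qed

lemma Zp_uminus [simp, intro]: "x \<in> Zp \<Longrightarrow> - x \<in> Zp"
  using Zp_mult[of "- 1" x] Zp_of_int[of "- 1"] by simp

lemma Zp_diff [simp, intro]: "x \<in> Zp \<Longrightarrow> y \<in> Zp \<Longrightarrow> x - y \<in> Zp"
  using Zp_add[of x "- y"] Zp_uminus[of y] by simp

lemma Zp_power [simp, intro]: "x \<in> Zp \<Longrightarrow> x ^ k \<in> Zp"
  by (induction k) auto

lemma Zp_sum [simp, intro]: "(\<And>i. i \<in> A \<Longrightarrow> f i \<in> Zp) \<Longrightarrow> sum f A \<in> Zp"
  by (induction A rule: infinite_finite_induct) auto

lemma Zp_prod [simp, intro]: "(\<And>i. i \<in> A \<Longrightarrow> f i \<in> Zp) \<Longrightarrow> prod f A \<in> Zp"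
  by (induction A rule: infinite_finite_induct) auto

lemma Zunits_Zp [simp, intro]: "x \<in> Zunits \<Longrightarrow> x \<in> Zp"
  and Zunits_nonzero [dest]: "x \<in> Zunits \<Longrightarrow> x \<noteq> 0"
  and Zunits_inverse [simp, intro]: "x \<in> Zunits \<Longrightarrow> inverse x \<in> Zunits"
  by (auto simp: Zunits_def)

lemma Zunits_mult [simp, intro]: "x \<in> Zunits \<Longrightarrow> y \<in> Zunits \<Longrightarrow> x * y \<in> Zunits"
  by (simp del: Zunits_Zp add: Zunits_def Zp_mult)

lemma Zunits_uminus [simp, intro]: "x \<in> Zunits \<Longrightarrow> - x \<in> Zunits"
  by (simp del: Zunits_Zp add: Zunits_def Zp_uminus)

lemma Zp_divide [simp, intro]: "x \<in> Zp \<Longrightarrow> y \<in> Zunits \<Longrightarrow> x / y \<in> Zp"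
  by (simp del: Zunits_Zp add: Zunits_def divide_inverse Zp_mult)

lemma Zunits_divide [simp, intro]: "x \<in> Zunits \<Longrightarrow> y \<in> Zunits \<Longrightarrow> x / y \<in> Zunits"
  by (simp add: divide_inverse Zunits_mult Zunits_inverse)

lemma Zunits_power [simp, intro]: "x \<in> Zunits \<Longrightarrow> x ^ k \<in> Zunits"
  by (induction k) (simp_all, simp del: Zunits_Zp add: Zunits_def)

lemma Zunits_prod [simp, intro]: "(\<And>i. i \<in> A \<Longrightarrow> f i \<in> Zunits) \<Longrightarrow> prod f A \<in> Zunits"
  by (induction A rule: infinite_finite_induct) (simp_all, simp_all del: Zunits_Zp add: Zunits_def)

lemma Zunits_of_int: "\<not> int p dvd a \<Longrightarrow> of_int a \<in> Zunits"
proof -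
  assume a: "\<not> int p dvd a"
  then have "inverse (of_int a) \<in> Zp"
    unfolding Zp_iff by (intro exI[of _ 1] exI[of _ a]) (simp add: divide_inverse)
  moreover have "a \<noteq> 0" using a by auto
  ultimately show ?thesis by (simp del: Zunits_Zp add: Zunits_def)
qed

lemma Zunits_of_nat: "\<not> p dvd a \<Longrightarrow> of_nat a \<in> Zunits"
  using Zunits_of_int[of "int a"] by simp

lemma Zunits_small: "0 < a \<Longrightarrow> a < p \<Longrightarrow> of_nat a \<in> Zunits"
  by (auto intro!: Zunits_of_nat dest: dvd_imp_le)

lemma not_dvd_power_2: "\<not> p dvd 2 ^ k"
  using prime odd by (metis even_numeral prime_dvd_power primes_dvd_imp_eq two_is_prime_nat)

lemma Zunits_num [simp, intro]:
  "1 \<in> Zunits" "2 \<in> Zunits" "4 \<in> Zunits" "8 \<in> Zunits" "16 \<in> Zunits" "64 \<in> Zunits"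
  using Zunits_of_nat[OF not_dvd_power_2[of 0]] Zunits_of_nat[OF not_dvd_power_2[of 1]]
    Zunits_of_nat[OF not_dvd_power_2[of 2]] Zunits_of_nat[OF not_dvd_power_2[of 3]]
    Zunits_of_nat[OF not_dvd_power_2[of 4]] Zunits_of_nat[OF not_dvd_power_2[of 6]] by simp_all

lemma three_unit: "p \<noteq> 3 \<Longrightarrow> 3 \<in> Zunits"
  using Zunits_of_nat[of 3] prime primes_dvd_imp_eq[of p 3] by auto

lemma not_unit_p: "inverse pp \<notin> Zp"
proof
  assume "inverse pp \<in> Zp"
  then obtain a b where b: "\<not> int p dvd b" "inverse pp = of_int a / of_int b"
    unfolding Zp_iff by blast
  then have "b \<noteq> 0" by auto
  with b have "(of_int b :: rat) = of_int (int p * a)" by (simp add: field_simps)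
  then have "b = int p * a" by (simp only: of_int_eq_iff)
  with b show False by simp
qed

lemma pcong_refl [simp, intro]: "x \<approx>[k] x"
  unfolding pcong_def rat_cong_def by (intro bexI[of _ 0]) auto

lemma pcong_iff: "x \<approx>[k] y \<longleftrightarrow> (\<exists>c\<in>Zp. x = y + pp ^ k * c)"
  unfolding pcong_def rat_cong_def by (intro bex_cong) (auto simp: algebra_simps)

lemma pcongE: assumes "x \<approx>[k] y" obtains c where "c \<in> Zp" "x = y + pp ^ k * c"
  using assms unfolding pcong_iff by blast

lemma pcongI: "c \<in> Zp \<Longrightarrow> x = y + pp ^ k * c \<Longrightarrow> x \<approx>[k] y"
  unfolding pcong_iff by blast

lemma pcong_add: assumes "x \<approx>[k] y" "x' \<approx>[k] y'" shows "x + x' \<approx>[k] y + y'"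
proof -
  obtain c c' where "c \<in> Zp" "c' \<in> Zp" "x = y + pp ^ k * c" "x' = y' + pp ^ k * c'"
    using assms by (meson pcongE)
  then show ?thesis by (intro pcongI[of "c + c'"]) (auto simp: algebra_simps)
qed

lemma pcong_uminus: "x \<approx>[k] y \<Longrightarrow> - x \<approx>[k] - y"
  by (metis pcong_iff Zp_uminus minus_add_distrib mult_minus_right)

lemma pcong_diff: "x \<approx>[k] y \<Longrightarrow> x' \<approx>[k] y' \<Longrightarrow> x - x' \<approx>[k] y - y'"
  using pcong_add[of x k y "- x'" "- y'"] pcong_uminus by simp

lemma pcong_sym: "x \<approx>[k] y \<Longrightarrow> y \<approx>[k] x"
  by (metis pcong_iff Zp_uminus add_minus_cancel minus_add_cancel mult_minus_right add.commute)

lemma pcong_trans [trans]: assumes "x \<approx>[k] y" "y \<approx>[k] z" shows "x \<approx>[k] z"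
proof -
  obtain c d where "c \<in> Zp" "d \<in> Zp" "x = y + pp ^ k * c" "y = z + pp ^ k * d"
    using assms by (meson pcongE)
  then show ?thesis by (intro pcongI[of "c + d"]) (auto simp: algebra_simps)
qed

lemma eq_pcong_trans [trans]: "x = y \<Longrightarrow> y \<approx>[k] z \<Longrightarrow> x \<approx>[k] z"
  and pcong_eq_trans [trans]: "x \<approx>[k] y \<Longrightarrow> y = z \<Longrightarrow> x \<approx>[k] z"
  by simp_all

lemma pcong_Zp: "x \<approx>[k] y \<Longrightarrow> y \<in> Zp \<Longrightarrow> x \<in> Zp"
  by (elim pcongE) auto

lemma pcong_mult:
  assumes "x \<approx>[k] y" "x' \<approx>[k] y'" "y \<in> Zp" "y' \<in> Zp"
  shows "x * x' \<approx>[k] y * y'"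
proof -
  obtain c c' where "c \<in> Zp" "c' \<in> Zp" "x = y + pp ^ k * c" "x' = y' + pp ^ k * c'"
    using assms by (meson pcongE)
  with assms(3,4) show ?thesis
    by (intro pcongI[of "y * c' + y' * c + pp ^ k * c * c'"]) (auto simp: algebra_simps)
qed

lemma pcong_scale: "a \<in> Zp \<Longrightarrow> x \<approx>[k] y \<Longrightarrow> a * x \<approx>[k] a * y"
  by (metis pcong_iff Zp_mult distrib_left mult.left_commute)

lemma pcong_power: "x \<approx>[k] y \<Longrightarrow> y \<in> Zp \<Longrightarrow> x ^ i \<approx>[k] y ^ i"
  by (induction i) (auto intro: pcong_mult)

lemma pcong_sum: "(\<And>i. i \<in> A \<Longrightarrow> f i \<approx>[k] g i) \<Longrightarrow> sum f A \<approx>[k] sum g A"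
  by (induction A rule: infinite_finite_induct) (auto intro: pcong_add)

lemma pcong_prod:
  "(\<And>i. i \<in> A \<Longrightarrow> f i \<approx>[k] g i) \<Longrightarrow> (\<And>i. i \<in> A \<Longrightarrow> g i \<in> Zp) \<Longrightarrow> prod f A \<approx>[k] prod g A"
  by (induction A rule: infinite_finite_induct) (auto intro!: pcong_mult)

lemma pcong_weaken: assumes "x \<approx>[k] y" "l \<le> k" shows "x \<approx>[l] y"
proof -
  obtain c where "c \<in> Zp" "x = y + pp ^ k * c" using assms by (meson pcongE)
  moreover have "pp ^ k = pp ^ l * pp ^ (k - l)" using assms(2) by (simp flip: power_add)
  ultimately show ?thesis by (intro pcongI[of "pp ^ (k - l) * c"]) auto
qed

lemma pcong_mult_p: "x \<approx>[k] y \<Longrightarrow> pp ^ i * x \<approx>[k + i] pp ^ i * y"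
  by (elim pcongE) (auto simp: algebra_simps power_add intro!: pcongI)

lemma pcong_mult_p1: "x \<approx>[1] y \<Longrightarrow> pp * x \<approx>[2] pp * y"
  using pcong_mult_p[of x 1 y 1] by (simp only: one_add_one power_one_right)

lemma pcong_mult_p2: "x \<approx>[1] y \<Longrightarrow> pp\<^sup>2 * x \<approx>[3] pp\<^sup>2 * y"
  using pcong_mult_p[of x 1 y 2] by (simp only: one_plus_numeral semiring_norm)

lemma pcong_cancel_unit:
  assumes "u * x \<approx>[k] u * y" "u \<in> Zunits" shows "x \<approx>[k] y"
  using pcong_scale[OF _ assms(1), of "inverse u"] assms(2)
  by (simp del: Zunits_Zp add: Zunits_def flip: mult.assoc)

lemma pcong_divide:
  assumes "x \<approx>[k] y" "u \<approx>[k] v" "y \<in> Zp" "u \<in> Zunits" "v \<in> Zunits"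
  shows "x / u \<approx>[k] y / v"
proof -
  have "u \<noteq> 0" "v \<noteq> 0" using assms(4,5) by auto
  then have eq: "(u * v) * (x / u) = x * v" "(u * v) * (y / v) = y * u" by simp_all
  have "(u * v) * (x / u) \<approx>[k] (u * v) * (y / v)"
    unfolding eq by (rule pcong_mult[OF assms(1) pcong_sym[OF assms(2)] assms(3)]) (simp add: assms(4))
  then show ?thesis by (rule pcong_cancel_unit) (simp add: assms(4,5))
qed

text \<open>Units are recognized modulo \<open>p\<close>; this is how all denominators below are shown to be invertible.\<close>

lemma Zunits_pcong: assumes "x \<approx>[l] u" "u \<in> Zunits" "0 < l" shows "x \<in> Zunits"
proof -
  obtain k where k: "l = Suc k" using assms(3) gr0_implies_Suc by blast
  obtain c where c: "c \<in> Zp" "x = u + pp ^ Suc k * c" using assms(1) k by (meson pcongE)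
  obtain a b where u: "\<not> int p dvd b" "u = of_int a / of_int b"
    using assms(2) unfolding Zunits_def Zp_iff by blast
  have a: "\<not> int p dvd a"
  proof
    assume "int p dvd a"
    then obtain a' where "a = int p * a'" by blast
    then have "inverse pp = inverse u * of_int a' / of_int b" "of_int b \<in> Zunits"
      using u assms(2) Zunits_of_int by (auto simp: field_simps dest!: Zunits_nonzero)
    then have "inverse pp \<in> Zp" using assms(2) by (simp del: Zunits_Zp add: Zunits_def)
    then show False using not_unit_p by simp
  qed
  obtain d e where de: "\<not> int p dvd e" "pp ^ k * c = of_int d / of_int e"
    using c(1) Zp_mult[OF Zp_power[OF Zp_of_nat[of p]], of c k] unfolding Zp_iff by metis
  have "b \<noteq> 0" "e \<noteq> 0" using u de by auto
  have "x = of_int a / of_int b + pp * (of_int d / of_int e)"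
    unfolding c(2) u(2) power_Suc mult.assoc de(2) ..
  also have "\<dots> = of_int (a * e + int p * d * b) / of_int (b * e)"
    using \<open>b \<noteq> 0\<close> \<open>e \<noteq> 0\<close> by (simp add: field_simps)
  finally have x: "x = of_int (a * e + int p * d * b) / of_int (b * e)" .
  have "\<not> int p dvd a * e + int p * d * b" "\<not> int p dvd b * e"
    using a u(1) de(1) prime by (auto simp: prime_dvd_mult_iff dvd_add_left_iff)
  then show ?thesis unfolding x using Zunits_of_int by blast
qed

lemma pcong_of_int_iff: "of_int a \<approx>[k] of_int b \<longleftrightarrow> [a = b] (mod int p ^ k)"
proof
  assume "of_int a \<approx>[k] of_int b"
  then obtain c where c: "c \<in> Zp" "(of_int a :: rat) = of_int b + pp ^ k * c" by (meson pcongE)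
  then obtain d e where de: "\<not> int p dvd e" "c = of_int d / of_int e" unfolding Zp_iff by blast
  then have "e \<noteq> 0" by auto
  have "(of_int (a * e) :: rat) = of_int (b * e + int p ^ k * d)"
    using c de \<open>e \<noteq> 0\<close> by (simp add: field_simps)
  then have "a * e = b * e + int p ^ k * d" by (simp only: of_int_eq_iff)
  then have "int p ^ k dvd (a - b) * e" by (simp add: algebra_simps)
  moreover have "coprime (int p ^ k) e"
    using de(1) prime by (simp add: prime_imp_coprime)
  ultimately show "[a = b] (mod int p ^ k)"
    by (simp add: coprime_dvd_mult_left_iff cong_iff_dvd_diff)
next
  assume "[a = b] (mod int p ^ k)"
  then obtain c where "a = b + int p ^ k * c" by (metis cong_iff_lin cong_sym)
  then show "of_int a \<approx>[k] of_int b" by (intro pcongI[of "of_int c"]) auto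
qed

lemma pcong_of_nat: "[a = b] (mod p ^ k) \<Longrightarrow> of_nat a \<approx>[k] of_nat b"
  using pcong_of_int_iff[of "int a" k "int b"] by (simp flip: cong_int_iff)

lemma fermat_pcong: "\<not> p dvd a \<Longrightarrow> of_nat a ^ (p - 1) \<approx>[1] 1"
  using pcong_of_nat[of "a ^ (p - 1)" 1 1] fermat_theorem[OF prime, of a] by simp

text \<open>To expand a quotient to order \<open>p^3\<close> it suffices to exhibit the remainder \<open>r\<close> of the division of
  the numerator by the denominator, ordered by increasing powers of \<open>p\<close>.\<close>

lemma pcong_truncI:
  assumes "d \<in> Zunits" "r \<in> Zp" "n = a * d + pp ^ 3 * r"
  shows "n / d \<approx>[3] a"
proof (rule pcongI)
  show "r / d \<in> Zp" using assms by simp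
  show "n / d = a + pp ^ 3 * (r / d)"
    unfolding assms(3) using Zunits_nonzero[OF assms(1)] by (simp add: add_divide_distrib)
qed

section \<open>Products of factors close to one\<close>

text \<open>The expansion of \<open>exp (p s - p^2 t / 2)\<close> to second order.  If \<open>s\<close> and \<open>t\<close> are the sums of the \<open>c j\<close> and of
  their squares, it is the product of the factors \<open>1 + p c j\<close> modulo \<open>p^3\<close>; products and quotients
  of such expressions then amount to adding and subtracting \<open>s\<close> and \<open>t\<close>.\<close>

definition texp :: "rat \<Rightarrow> rat \<Rightarrow> rat" where
  "texp s t = 1 + pp * s + pp\<^sup>2 * ((s\<^sup>2 - t) / 2)"

lemma texp_Zp [simp]: "s \<in> Zp \<Longrightarrow> t \<in> Zp \<Longrightarrow> texp s t \<in> Zp"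
  by (simp add: texp_def)

lemma texp_cong1: "s \<in> Zp \<Longrightarrow> t \<in> Zp \<Longrightarrow> texp s t \<approx>[1] 1"
  unfolding texp_def
  by (rule pcongI[of "s + pp * ((s\<^sup>2 - t) / 2)"]) (simp_all add: algebra_simps power2_eq_square)

lemma texp_unit [simp]: "s \<in> Zp \<Longrightarrow> t \<in> Zp \<Longrightarrow> texp s t \<in> Zunits"
  using Zunits_pcong[OF texp_cong1[of s t]] by simp

lemma texp_mult:
  assumes "s \<in> Zp" "t \<in> Zp" "s' \<in> Zp" "t' \<in> Zp"
  shows "texp s t * texp s' t' \<approx>[3] texp (s + s') (t + t')"
proof -
  define a where "a = (s\<^sup>2 - t) / 2"
  define b where "b = (s'\<^sup>2 - t') / 2"
  have ab: "a \<in> Zp" "b \<in> Zp" using assms by (simp_all add: a_def b_def)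
  have "((s + s')\<^sup>2 - (t + t')) / 2 = a + b + s * s'"
    by (simp add: a_def b_def power2_eq_square field_simps)
  then have "texp (s + s') (t + t') = 1 + pp * (s + s') + pp\<^sup>2 * (a + b + s * s')"
    by (simp only: texp_def)
  then have "texp s t * texp s' t' = texp (s + s') (t + t') + pp ^ 3 * (s * b + a * s' + pp * a * b)"
    by (simp add: texp_def[of s t] texp_def[of s' t'] flip: a_def b_def)
      (simp add: algebra_simps power2_eq_square power3_eq_cube)
  then show ?thesis using assms ab by (intro pcongI[of "s * b + a * s' + pp * a * b"]) simp_all
qed

text \<open>Because of the powers of \<open>p\<close> in front, \<open>s\<close> matters only modulo \<open>p^2\<close> and \<open>t\<close> only modulo \<open>p\<close>.\<close>

lemma texp_cong:
  assumes "s \<approx>[2] s'" "t \<approx>[1] t'" "s' \<in> Zp" "t' \<in> Zp"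
  shows "texp s t \<approx>[3] texp s' t'"
proof -
  obtain c d where c: "c \<in> Zp" "s = s' + pp ^ 2 * c" and d: "d \<in> Zp" "t = t' + pp ^ 1 * d"
    using assms(1,2) by (meson pcongE)
  have "texp s t = texp s' t' + pp ^ 3 * (c + pp * s' * c + pp ^ 3 * c\<^sup>2 / 2 - d / 2)"
    unfolding texp_def c(2) d(2) by (simp add: field_simps power2_eq_square power3_eq_cube)
  then show ?thesis using assms c d
    by (intro pcongI[of "c + pp * s' * c + pp ^ 3 * c\<^sup>2 / 2 - d / 2"]) simp_all
qed

text \<open>A term divisible by \<open>p\<close> in \<open>s\<close> has the same effect as a correction of \<open>t\<close>.\<close>

lemma texp_shift:
  assumes "s \<in> Zp" "t \<in> Zp" "u \<in> Zp"
  shows "texp (s + pp * u) t \<approx>[3] texp s (t - 2 * u)"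
proof -
  have "texp (s + pp * u) t = texp s (t - 2 * u) + pp ^ 3 * (s * u + pp * u\<^sup>2 / 2)"
    unfolding texp_def by (simp add: field_simps power2_eq_square power3_eq_cube)
  then show ?thesis using assms by (intro pcongI[of "s * u + pp * u\<^sup>2 / 2"]) simp_all
qed

lemma texp_divide:
  assumes "s \<in> Zp" "t \<in> Zp" "s' \<in> Zp" "t' \<in> Zp"
  shows "texp s t / texp s' t' \<approx>[3] texp (s - s') (t - t')"
proof -
  have u: "texp s' t' \<in> Zunits" using assms by simp
  have "texp s' t' * (texp s t / texp s' t') \<approx>[3] texp s' t' * texp (s - s') (t - t')"
    using pcong_sym[OF texp_mult[of s' t' "s - s'" "t - t'"]] assms Zunits_nonzero[OF u] by simp
  then show ?thesis using u by (rule pcong_cancel_unit)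
qed

lemma prod_texp:
  assumes "finite A" "\<And>j. j \<in> A \<Longrightarrow> c j \<in> Zp"
  shows "(\<Prod>j\<in>A. 1 + pp * c j) \<approx>[3] texp (\<Sum>j\<in>A. c j) (\<Sum>j\<in>A. (c j)\<^sup>2)"
  using assms
proof (induction A)
  case empty
  show ?case by (simp add: texp_def)
next
  case (insert a A)
  have eq: "1 + pp * c a = texp (c a) ((c a)\<^sup>2)" by (simp add: texp_def)
  have "(\<Prod>j\<in>insert a A. 1 + pp * c j) = texp (c a) ((c a)\<^sup>2) * (\<Prod>j\<in>A. 1 + pp * c j)"
    using insert by (simp add: eq)
  also have "\<dots> \<approx>[3] texp (c a) ((c a)\<^sup>2) * texp (\<Sum>j\<in>A. c j) (\<Sum>j\<in>A. (c j)\<^sup>2)"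
    using insert by (intro pcong_scale) auto
  also have "\<dots> \<approx>[3] texp (c a + (\<Sum>j\<in>A. c j)) ((c a)\<^sup>2 + (\<Sum>j\<in>A. (c j)\<^sup>2))"
    using insert.prems by (intro texp_mult) auto
  finally show ?case using insert by simp
qed

lemma prod_one_minus_sq:
  assumes "finite A" "\<And>j. j \<in> A \<Longrightarrow> c j \<in> Zp"
  shows "(\<Prod>j\<in>A. 1 - pp\<^sup>2 * c j) \<approx>[3] texp 0 (2 * (\<Sum>j\<in>A. c j))"
proof -
  have "(\<Prod>j\<in>A. 1 - pp\<^sup>2 * c j) = (\<Prod>j\<in>A. 1 + pp * (- (pp * c j)))"
    by (simp add: power2_eq_square mult.assoc)
  also have "\<dots> \<approx>[3] texp (\<Sum>j\<in>A. - (pp * c j)) (\<Sum>j\<in>A. (- (pp * c j))\<^sup>2)"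
    using assms by (intro prod_texp) auto
  also have "\<dots> = texp (0 + pp * (- (\<Sum>j\<in>A. c j))) (pp ^ 1 * (pp * (\<Sum>j\<in>A. (c j)\<^sup>2)))"
    by (simp add: sum_negf sum_distrib_left power_mult_distrib power2_eq_square mult.assoc mult.left_commute)
  also have "\<dots> \<approx>[3] texp 0 (pp ^ 1 * (pp * (\<Sum>j\<in>A. (c j)\<^sup>2)) - 2 * (- (\<Sum>j\<in>A. c j)))"
    using assms by (intro texp_shift) auto
  also have "\<dots> \<approx>[3] texp 0 (2 * (\<Sum>j\<in>A. c j))"
    using assms by (intro texp_cong[OF pcong_refl] pcongI[of "pp * (\<Sum>j\<in>A. (c j)\<^sup>2)"]) auto
  finally show ?thesis .
qed

text \<open>Second-order expansions with an arbitrary constant term, needed where sums of several products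
  occur and the exponential form is lost.\<close>

definition trunc :: "rat \<Rightarrow> rat \<Rightarrow> rat \<Rightarrow> rat" where
  "trunc a b c = a + pp * b + pp\<^sup>2 * c"

lemma trunc_Zp [simp]: "a \<in> Zp \<Longrightarrow> b \<in> Zp \<Longrightarrow> c \<in> Zp \<Longrightarrow> trunc a b c \<in> Zp"
  by (simp add: trunc_def)

lemma trunc_eqI: "a = a' \<Longrightarrow> b = b' \<Longrightarrow> c = c' \<Longrightarrow> trunc a b c = trunc a' b' c'"
  by simp

lemma trunc_mult:
  assumes "a \<in> Zp" "b \<in> Zp" "c \<in> Zp" "a' \<in> Zp" "b' \<in> Zp" "c' \<in> Zp"
  shows "trunc a b c * trunc a' b' c' \<approx>[3] trunc (a * a') (a * b' + b * a') (a * c' + b * b' + c * a')"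
proof (rule pcongI)
  show "b * c' + c * b' + pp * (c * c') \<in> Zp" using assms by simp
  show "trunc a b c * trunc a' b' c' = trunc (a * a') (a * b' + b * a') (a * c' + b * b' + c * a')
      + pp ^ 3 * (b * c' + c * b' + pp * (c * c'))"
    by (simp add: trunc_def algebra_simps power2_eq_square power3_eq_cube)
qed

lemma texp_trunc: "texp s t = trunc 1 s ((s\<^sup>2 - t) / 2)"
  by (simp add: texp_def trunc_def)

lemma trunc_texp:
  assumes "x \<approx>[3] trunc a b c" "a \<in> Zp" "b \<in> Zp" "c \<in> Zp" "s \<in> Zp" "t \<in> Zp"
  shows "x * texp s t \<approx>[3] trunc a (a * s + b) (a * ((s\<^sup>2 - t) / 2) + b * s + c)"
proof -
  have "x * texp s t \<approx>[3] trunc a b c * trunc 1 s ((s\<^sup>2 - t) / 2)"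
    unfolding texp_trunc using assms by (intro pcong_mult) simp_all
  also have "\<dots> \<approx>[3] trunc (a * 1) (a * s + b * 1) (a * ((s\<^sup>2 - t) / 2) + b * s + c * 1)"
    using assms by (intro trunc_mult) simp_all
  finally show ?thesis by simp
qed

section \<open>Harmonic sums\<close>

definition half :: nat where "half = (p - 1) div 2"

lemma p_half: "p = 2 * half + 1"
  using odd p_gt_2 unfolding half_def by (auto elim: oddE)

lemma pp_half: "pp = 2 * of_nat half + 1"
  by (subst p_half) simp

lemma of_nat_half: "of_nat half = (pp - 1) / 2"
  using pp_half by simp

lemma odd_unit [simp]: "j < half \<Longrightarrow> 2 * of_nat j + 1 \<in> Zunits"
  using Zunits_small[of "2 * j + 1"] p_half by (simp add: add.commute)

lemma Suc_unit [simp]: "Suc j < p \<Longrightarrow> of_nat j + 1 \<in> Zunits"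
  using Zunits_small[of "Suc j"] by (simp add: add.commute)

definition oddH :: "nat \<Rightarrow> nat \<Rightarrow> rat" where
  "oddH r k = (\<Sum>j<k. 1 / (2 * of_nat j + 1) ^ r)"

definition harm :: "nat \<Rightarrow> nat \<Rightarrow> rat" where
  "harm r k = (\<Sum>j<k. 1 / (of_nat j + 1) ^ r)"

lemma oddH_Zp [simp]: "k \<le> half \<Longrightarrow> oddH r k \<in> Zp"
  unfolding oddH_def by (intro Zp_sum Zp_divide Zunits_power) auto

lemma harm_Zp [simp]: "k < p \<Longrightarrow> harm r k \<in> Zp"
  unfolding harm_def by (intro Zp_sum Zp_divide Zunits_power) auto

lemma half_le [simp]: "k \<le> half \<Longrightarrow> k < p"
  using p_half by simp

lemma prod_odd_texp:
  assumes "k \<le> half" "a \<in> Zp"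
  shows "(\<Prod>j<k. 1 + a * pp / (2 * of_nat j + 1)) \<approx>[3] texp (a * oddH 1 k) (a\<^sup>2 * oddH 2 k)"
proof -
  have "(\<Prod>j<k. 1 + a * pp / (2 * of_nat j + 1)) = (\<Prod>j<k. 1 + pp * (a / (2 * of_nat j + 1)))"
    by (simp add: mult.commute)
  also have "\<dots> \<approx>[3] texp (\<Sum>j<k. a / (2 * of_nat j + 1)) (\<Sum>j<k. (a / (2 * of_nat j + 1))\<^sup>2)"
    using assms by (intro prod_texp) auto
  also have "\<dots> = texp (a * oddH 1 k) (a\<^sup>2 * oddH 2 k)"
    by (simp add: oddH_def sum_distrib_left power_divide)
  finally show ?thesis .
qed

lemma prod_Suc_texp:
  assumes "k < p" "a \<in> Zp"
  shows "(\<Prod>j<k. 1 + a * pp / (of_nat j + 1)) \<approx>[3] texp (a * harm 1 k) (a\<^sup>2 * harm 2 k)"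
proof -
  have "(\<Prod>j<k. 1 + a * pp / (of_nat j + 1)) = (\<Prod>j<k. 1 + pp * (a / (of_nat j + 1)))"
    by (simp add: mult.commute)
  also have "\<dots> \<approx>[3] texp (\<Sum>j<k. a / (of_nat j + 1)) (\<Sum>j<k. (a / (of_nat j + 1))\<^sup>2)"
    using assms by (intro prod_texp) auto
  also have "\<dots> = texp (a * harm 1 k) (a\<^sup>2 * harm 2 k)"
    by (simp add: harm_def sum_distrib_left power_divide)
  finally show ?thesis .
qed

lemma prod_Suc_sq_texp:
  assumes "k < p" "r \<in> Zp"
  shows "(\<Prod>j<k. 1 - r * pp\<^sup>2 / (of_nat j + 1)\<^sup>2) \<approx>[3] texp 0 (2 * (r * harm 2 k))"
proof -
  have "(\<Prod>j<k. 1 - r * pp\<^sup>2 / (of_nat j + 1)\<^sup>2) = (\<Prod>j<k. 1 - pp\<^sup>2 * (r / (of_nat j + 1)\<^sup>2))"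
    by (simp add: mult.commute)
  also have "\<dots> \<approx>[3] texp 0 (2 * (\<Sum>j<k. r / (of_nat j + 1)\<^sup>2))"
    using assms by (intro prod_one_minus_sq) auto
  finally show ?thesis by (simp add: harm_def sum_distrib_left)
qed

lemma prod_Suc_sq_unit:
  assumes "k < p" "r \<in> Zp"
  shows "(\<Prod>j<k. 1 - r * pp\<^sup>2 / (of_nat j + 1)\<^sup>2) \<in> Zunits"
  using Zunits_pcong[OF prod_Suc_sq_texp[OF assms]] assms by simp

lemma oddH_split: "oddH r m + harm r m / 2 ^ r = harm r (2 * m)"
proof (induction m)
  case (Suc m)
  have "(2 * of_nat m + 1 + 1 :: rat) ^ r = 2 ^ r * (of_nat m + 1) ^ r"
    by (simp add: algebra_simps flip: power_mult_distrib)
  then show ?case using Suc.IH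
    by (simp add: oddH_def harm_def add_divide_distrib algebra_simps)
qed (simp add: oddH_def harm_def)

lemma harm_diff: "k \<le> n \<Longrightarrow> harm r n - harm r k = (\<Sum>i=k..<n. 1 / (of_nat i + 1) ^ r)"
  unfolding harm_def by (subst sum_diff[symmetric]) (auto intro!: sum.cong)

text \<open>As \<open>p = 2 half + 1\<close>, the odd numbers below \<open>p\<close> are the differences \<open>p - 2 i\<close> with \<open>1 \<le> i \<le> half\<close>.
  Reading a sum over odd denominators backwards in this way turns it into a sum over all denominators
  up to \<open>half\<close>, first exactly and then modulo \<open>p\<close> or \<open>p^2\<close>.\<close>

lemma reflect_unit:
  assumes "i < half"
  shows "pp - 2 * (of_nat i + 1) \<in> Zunits"
proof (rule Zunits_pcong)
  show "pp - 2 * (of_nat i + 1) \<approx>[1] - (2 * (of_nat i + 1))"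
    by (rule pcongI[of 1]) simp_all
  show "- (2 * (of_nat i + 1)) \<in> Zunits"
    using assms p_half by (intro Zunits_uminus Zunits_mult Suc_unit) simp_all
qed simp

lemma oddH_reflect:
  assumes "k \<le> half"
  shows "oddH r (half - k) = (\<Sum>i=k..<half. 1 / (pp - 2 * (of_nat i + 1)) ^ r)"
  unfolding oddH_def
proof (rule sum.reindex_bij_witness[of _ "\<lambda>i. half - 1 - i" "\<lambda>i. half - 1 - i"])
  fix j assume "j \<in> {..<half - k}"
  then have "of_nat (half - 1 - j) = of_nat half - 1 - (of_nat j :: rat)"
    using assms by (simp add: of_nat_diff)
  then show "1 / (pp - 2 * (of_nat (half - 1 - j) + 1)) ^ r = 1 / (2 * of_nat j + 1) ^ r"
    unfolding pp_half by (simp add: algebra_simps)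
qed (use assms in auto)

lemma oddH2_reflect:
  assumes "k \<le> half"
  shows "oddH 2 (half - k) \<approx>[1] (harm 2 half - harm 2 k) / 4"
proof -
  have "1 / (pp - 2 * (of_nat i + 1))\<^sup>2 \<approx>[1] 1 / (- (2 * (of_nat i + 1)))\<^sup>2" if "i < half" for i
  proof (rule pcong_divide)
    show "(pp - 2 * (of_nat i + 1))\<^sup>2 \<approx>[1] (- (2 * (of_nat i + 1)))\<^sup>2"
      by (rule pcong_power[OF pcongI[of 1]]) simp_all
    show "(- (2 * (of_nat i + 1)))\<^sup>2 \<in> Zunits"
      using that p_half by (intro Zunits_power Zunits_uminus Zunits_mult Suc_unit) simp_all
  qed (use that reflect_unit in simp_all)
  then have "oddH 2 (half - k) \<approx>[1] (\<Sum>i=k..<half. 1 / (- (2 * (of_nat i + 1)))\<^sup>2)"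
    unfolding oddH_reflect[OF assms] by (intro pcong_sum) auto
  also have "(\<Sum>i=k..<half. 1 / (- (2 * (of_nat i + 1)))\<^sup>2) = (\<Sum>i=k..<half. 1 / (of_nat i + 1)\<^sup>2) / (4 :: rat)"
    unfolding sum_divide_distrib by (intro sum.cong refl) (simp only: power2_minus power_mult_distrib, simp)
  finally show ?thesis unfolding harm_diff[OF assms] .
qed

text \<open>Here \<open>1 / (p - 2i)\<close> is expanded to first order in \<open>p\<close>.\<close>

lemma oddH1_reflect:
  assumes "k \<le> half"
  shows "oddH 1 (half - k) \<approx>[2] - ((harm 1 half - harm 1 k) / 2 + pp * ((harm 2 half - harm 2 k) / 4))"
proof -
  have "1 / (pp - 2 * (of_nat i + 1)) ^ 1 \<approx>[2]
      - (1 / (of_nat i + 1) ^ 1 / 2 + pp * (1 / (of_nat i + 1)\<^sup>2 / 4))" if "i < half" for i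
  proof -
    define a :: rat where "a = of_nat i + 1"
    have u: "a \<in> Zunits" "pp - 2 * a \<in> Zunits"
      using that p_half reflect_unit by (simp_all add: a_def)
    then have nz: "a \<noteq> 0" "pp - 2 * a \<noteq> 0" by auto
    have "1 / (pp - 2 * a) = - (1 / a / 2 + pp * (1 / a\<^sup>2 / 4)) + pp\<^sup>2 * (1 / (4 * a\<^sup>2 * (pp - 2 * a)))"
      using nz by (simp add: divide_simps) (simp add: algebra_simps power2_eq_square)
    then show ?thesis unfolding a_def[symmetric]
      using u by (intro pcongI[of "1 / (4 * a\<^sup>2 * (pp - 2 * a))"] Zp_divide Zunits_mult) simp_all
  qed
  then have "oddH 1 (half - k) \<approx>[2] (\<Sum>i=k..<half. - (1 / (of_nat i + 1) ^ 1 / 2 + pp * (1 / (of_nat i + 1)\<^sup>2 / 4)))"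
    unfolding oddH_reflect[OF assms] by (intro pcong_sum) auto
  also have "\<dots> = - ((harm 1 half - harm 1 k) / 2 + pp * ((harm 2 half - harm 2 k) / 4))"
    unfolding harm_diff[OF assms] by (simp only: sum_negf sum.distrib sum_divide_distrib sum_distrib_left)
  finally show ?thesis .
qed

text \<open>Both \<open>i \<mapsto> p - i\<close> and the separation of even from odd denominators express the sum
  of \<open>1 / i^2\<close> over all \<open>i < p\<close> by the sum over \<open>i \<le> half\<close>, with the factors \<open>2\<close> and \<open>1/2\<close>.  Hence \<open>3/2\<close>
  times the latter vanishes.\<close>

lemma harm2_half:
  assumes "p \<noteq> 3"
  shows "harm 2 half \<approx>[1] 0"
proof -
  have "(\<Sum>i=half..<2*half. 1 / (of_nat i + 1)\<^sup>2) = (\<Sum>i<half. 1 / (pp - (of_nat i + 1))\<^sup>2)"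
  proof (rule sum.reindex_bij_witness[of _ "\<lambda>i. 2 * half - 1 - i" "\<lambda>i. 2 * half - 1 - i"])
    fix j assume "j \<in> {half..<2 * half}"
    then have "of_nat (2 * half - 1 - j) = 2 * of_nat half - 1 - (of_nat j :: rat)"
      by (simp add: of_nat_diff)
    then show "1 / (pp - (of_nat (2 * half - 1 - j) + 1))\<^sup>2 = 1 / (of_nat j + 1)\<^sup>2"
      unfolding pp_half by (simp add: algebra_simps)
  qed auto
  also have "\<dots> \<approx>[1] (\<Sum>i<half. 1 / (- (of_nat i + 1))\<^sup>2)"
  proof (intro pcong_sum pcong_divide)
    fix i assume i: "i \<in> {..<half}"
    then have u: "- (of_nat i + 1) \<in> Zunits" using p_half by (intro Zunits_uminus Suc_unit) auto
    have c: "pp - (of_nat i + 1) \<approx>[1] - (of_nat i + 1)" by (rule pcongI[of 1]) simp_all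
    show "(pp - (of_nat i + 1))\<^sup>2 \<approx>[1] (- (of_nat i + 1))\<^sup>2"
      by (rule pcong_power[OF c]) simp
    show "(- (of_nat i + 1))\<^sup>2 \<in> Zunits" "(pp - (of_nat i + 1))\<^sup>2 \<in> Zunits"
      using Zunits_power[OF u] Zunits_power[OF Zunits_pcong[OF c u zero_less_one]] by blast+
  qed simp_all
  also have "\<dots> = harm 2 half" unfolding harm_def power2_minus ..
  finally have "harm 2 (2 * half) - harm 2 half \<approx>[1] harm 2 half"
    using harm_diff[of half "2 * half" 2] by simp
  moreover have "oddH 2 half \<approx>[1] harm 2 half / 4"
    using oddH2_reflect[of 0] by (simp add: harm_def)
  ultimately have "oddH 2 half - (harm 2 (2 * half) - harm 2 half) \<approx>[1] harm 2 half / 4 - harm 2 half"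
    by (intro pcong_diff)
  then have "3 / 4 * harm 2 half \<approx>[1] - (3 / 4 * harm 2 half)"
  proof -
    have "oddH 2 half - (harm 2 (2 * half) - harm 2 half) = 3 / 4 * harm 2 half"
      using oddH_split[of 2 half] by simp
    moreover have "harm 2 half / 4 - harm 2 half = - (3 / 4 * harm 2 half)" by simp
    ultimately show ?thesis
      using \<open>oddH 2 half - (harm 2 (2 * half) - harm 2 half) \<approx>[1] harm 2 half / 4 - harm 2 half\<close>
      by (simp only:)
  qed
  then have "3 / 4 * harm 2 half + 3 / 4 * harm 2 half \<approx>[1] - (3 / 4 * harm 2 half) + 3 / 4 * harm 2 half"
    by (intro pcong_add) auto
  then have "3 / 2 * harm 2 half \<approx>[1] 3 / 2 * 0"
    by simp
  then show ?thesis by (rule pcong_cancel_unit) (use three_unit[OF assms] in simp)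
qed

text \<open>Wolstenholme's congruences, which follow from the reflection of the odd denominators.\<close>

lemma harm_full: assumes "p \<noteq> 3" shows "harm 1 (2 * half) \<approx>[2] 0" "harm 2 (2 * half) \<approx>[1] 0"
proof -
  have h2: "harm 2 half \<approx>[1] 0" by (rule harm2_half[OF assms])
  have "harm 2 (2 * half) = oddH 2 half + harm 2 half / 4" using oddH_split[of 2 half] by simp
  also have "\<dots> \<approx>[1] (harm 2 half - harm 2 0) / 4 + harm 2 half / 4"
    using oddH2_reflect[of 0] by (intro pcong_add) simp_all
  also have "\<dots> = harm 2 half / 2" by (simp add: harm_def)
  also have "\<dots> \<approx>[1] 0 / 2" by (intro pcong_divide h2) simp_all
  finally show "harm 2 (2 * half) \<approx>[1] 0" by simp
  \<comment> \<open>For exponent one, the terms of order zero cancel and those of order one contain \<open>harm 2 half\<close>.\<close>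
  obtain r where r: "r \<in> Zp" "harm 2 half = 0 + pp ^ 1 * r" using h2 by (rule pcongE)
  have "harm 1 (2 * half) = oddH 1 half + harm 1 half / 2" using oddH_split[of 1 half] by simp
  also have "\<dots> \<approx>[2] - ((harm 1 half - harm 1 0) / 2 + pp * ((harm 2 half - harm 2 0) / 4)) + harm 1 half / 2"
    using oddH1_reflect[of 0] by (intro pcong_add) simp_all
  also have "\<dots> = 0 + pp\<^sup>2 * (- r / 4)" using r by (simp add: harm_def power2_eq_square)
  also have "\<dots> \<approx>[2] 0" using r by (intro pcongI[of "- r / 4"]) simp_all
  finally show "harm 1 (2 * half) \<approx>[2] 0" .
qed

text \<open>The three numerators and the denominator are the general form of the term quotients in the Apery
  number and in the hypergeometric series, once \<open>\<beta>\<close> is split off.\<close>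

lemma term_expand:
  assumes k: "k \<le> half" and abc: "a \<in> Zp" "b \<in> Zp" "c \<in> Zp" "r \<in> Zp"
  shows "(\<Prod>j<k. (1 + a * pp / (2 * of_nat j + 1)) * (1 + b * pp / (2 * of_nat j + 1)) *
      (1 + c * pp / (2 * of_nat j + 1)) / (1 - r * pp\<^sup>2 / (of_nat j + 1)\<^sup>2))
    \<approx>[3] texp ((a + b + c) * oddH 1 k) ((a\<^sup>2 + b\<^sup>2 + c\<^sup>2) * oddH 2 k - 2 * (r * harm 2 k))"
proof -
  let ?P = "\<lambda>a. \<Prod>j<k. 1 + a * pp / (2 * of_nat j + 1)"
  let ?Q = "\<Prod>j<k. 1 - r * pp\<^sup>2 / (of_nat j + 1)\<^sup>2"
  let ?E = "\<lambda>a. texp (a * oddH 1 k) (a\<^sup>2 * oddH 2 k)"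
  have "?P a * ?P b \<approx>[3] ?E a * ?E b"
    using assms by (intro pcong_mult prod_odd_texp) simp_all
  also have "\<dots> \<approx>[3] texp (a * oddH 1 k + b * oddH 1 k) (a\<^sup>2 * oddH 2 k + b\<^sup>2 * oddH 2 k)"
    using assms by (intro texp_mult) simp_all
  finally have "?P a * ?P b * ?P c \<approx>[3] texp (a * oddH 1 k + b * oddH 1 k) (a\<^sup>2 * oddH 2 k + b\<^sup>2 * oddH 2 k) * ?E c"
    using assms by (intro pcong_mult prod_odd_texp) simp_all
  also have "\<dots> \<approx>[3] texp (a * oddH 1 k + b * oddH 1 k + c * oddH 1 k)
      (a\<^sup>2 * oddH 2 k + b\<^sup>2 * oddH 2 k + c\<^sup>2 * oddH 2 k)"
    using assms by (intro texp_mult) simp_all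
  finally have "?P a * ?P b * ?P c / ?Q \<approx>[3] texp (a * oddH 1 k + b * oddH 1 k + c * oddH 1 k)
      (a\<^sup>2 * oddH 2 k + b\<^sup>2 * oddH 2 k + c\<^sup>2 * oddH 2 k) / texp 0 (2 * (r * harm 2 k))"
    using assms by (intro pcong_divide prod_Suc_sq_texp prod_Suc_sq_unit) simp_all
  also have "\<dots> \<approx>[3] texp (a * oddH 1 k + b * oddH 1 k + c * oddH 1 k - 0)
      (a\<^sup>2 * oddH 2 k + b\<^sup>2 * oddH 2 k + c\<^sup>2 * oddH 2 k - 2 * (r * harm 2 k))"
    using assms by (intro texp_divide) simp_all
  finally show ?thesis
    by (simp only: prod.distrib prod_dividef distrib_right[of _ _ "oddH 1 k"]
        distrib_right[of _ _ "oddH 2 k"] diff_0_right)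
qed

section \<open>The Apery number and the hypergeometric sums modulo the cube of the prime\<close>

text \<open>The value \<open>((1/2)_k / k!)^3\<close> of the summands at the unperturbed parameters
  \<open>1/2, 1/2, 1/2; 1, 1\<close>.\<close>

definition \<beta> :: "nat \<Rightarrow> rat" where
  "\<beta> k = of_nat ((2 * k) choose k) ^ 3 / 64 ^ k"

lemma \<beta>_prod: "\<beta> k = (\<Prod>j<k. ((2 * of_nat j + 1) / (2 * (of_nat j + 1))) ^ 3)"
proof -
  have "\<beta> k = (of_nat ((2 * k) choose k) / 4 ^ k) ^ 3"
    by (simp add: \<beta>_def power_divide flip: power_mult power_mult_distrib)
       (simp add: power_mult mult.commute[of k])
  then show ?thesis by (simp only: central_binomial_prod prod_power_distrib)
qed

lemma \<beta>_Zp [simp]: "\<beta> k \<in> Zp"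
  by (simp add: \<beta>_def)

text \<open>The indices refer to the weights: \<open>1\<close> and \<open>2\<close> to sums over odd denominators and their squares,
  \<open>11\<close> to the square of the former, and \<open>T2\<close> to the sum of the inverse squares of \<open>1, \<dots>, k\<close>.\<close>

definition "S0 = (\<Sum>k\<le>half. \<beta> k)"

definition "S1 = (\<Sum>k\<le>half. \<beta> k * oddH 1 k)"

definition "S2 = (\<Sum>k\<le>half. \<beta> k * oddH 2 k)"

definition "S11 = (\<Sum>k\<le>half. \<beta> k * (oddH 1 k)\<^sup>2)"

definition "T2 = (\<Sum>k\<le>half. \<beta> k * harm 2 k)"

lemma S_Zp [simp]: "S0 \<in> Zp" "S1 \<in> Zp" "S2 \<in> Zp" "S11 \<in> Zp" "T2 \<in> Zp"
  unfolding S0_def S1_def S2_def S11_def T2_def by (auto intro!: Zp_sum)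

lemma weighted_sum_expand:
  assumes abc: "a \<in> Zp" "b \<in> Zp" "c \<in> Zp" "r \<in> Zp"
  shows "(\<Sum>k\<le>half. \<beta> k * (\<Prod>j<k. (1 + a * pp / (2 * of_nat j + 1)) * (1 + b * pp / (2 * of_nat j + 1)) *
      (1 + c * pp / (2 * of_nat j + 1)) / (1 - r * pp\<^sup>2 / (of_nat j + 1)\<^sup>2)))
    \<approx>[3] S0 + pp * ((a + b + c) * S1)
      + pp\<^sup>2 * (((a + b + c)\<^sup>2 * S11 - (a\<^sup>2 + b\<^sup>2 + c\<^sup>2) * S2) / 2 + r * T2)"
proof -
  have "(\<Sum>k\<le>half. \<beta> k * (\<Prod>j<k. (1 + a * pp / (2 * of_nat j + 1)) * (1 + b * pp / (2 * of_nat j + 1)) *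
      (1 + c * pp / (2 * of_nat j + 1)) / (1 - r * pp\<^sup>2 / (of_nat j + 1)\<^sup>2)))
    \<approx>[3] (\<Sum>k\<le>half. \<beta> k * texp ((a + b + c) * oddH 1 k) ((a\<^sup>2 + b\<^sup>2 + c\<^sup>2) * oddH 2 k - 2 * (r * harm 2 k)))"
    using assms by (intro pcong_sum pcong_scale term_expand) simp_all
  also have "\<dots> = (\<Sum>k\<le>half. \<beta> k + pp * (a + b + c) * (\<beta> k * oddH 1 k)
      + pp\<^sup>2 * (a + b + c)\<^sup>2 / 2 * (\<beta> k * (oddH 1 k)\<^sup>2)
      - pp\<^sup>2 * (a\<^sup>2 + b\<^sup>2 + c\<^sup>2) / 2 * (\<beta> k * oddH 2 k) + pp\<^sup>2 * r * (\<beta> k * harm 2 k))"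
    by (intro sum.cong refl) (simp add: texp_def power_mult_distrib, simp add: field_simps)
  also have "\<dots> = S0 + pp * (a + b + c) * S1 + pp\<^sup>2 * (a + b + c)\<^sup>2 / 2 * S11
      - pp\<^sup>2 * (a\<^sup>2 + b\<^sup>2 + c\<^sup>2) / 2 * S2 + pp\<^sup>2 * r * T2"
    by (simp only: sum.distrib sum_subtractf sum_distrib_left[symmetric]
        S0_def S1_def S2_def S11_def T2_def)
  also have "\<dots> = S0 + pp * ((a + b + c) * S1)
      + pp\<^sup>2 * (((a + b + c)\<^sup>2 * S11 - (a\<^sup>2 + b\<^sup>2 + c\<^sup>2) * S2) / 2 + r * T2)"
    by (simp add: field_simps)
  finally show ?thesis .
qed

lemma odd_nonzero: "2 * of_nat j + 1 \<noteq> (0 :: rat)" "of_nat j + 1 \<noteq> (0 :: rat)"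
  using of_nat_neq_0[of "2 * j", where 'a = rat] of_nat_neq_0[of j, where 'a = rat]
  by (simp_all add: add.commute)

text \<open>At \<open>n = (p - 1) / 2\<close> the parameters \<open>-n\<close> and \<open>n + 1 + x p\<close> are \<open>1/2 - p/2\<close> and \<open>1/2 + p/2 + x p\<close>,
  so all parameters are perturbations of \<open>1/2\<close> and \<open>1\<close> by multiples of \<open>p\<close>.\<close>

lemma hyp_term_\<beta>:
  "hyp_term half (x * pp) (1 / 2 + y * pp) (1 + \<tau> * pp) (1 - \<tau> * pp) k =
   \<beta> k * (\<Prod>j<k. (1 + (- 1) * pp / (2 * of_nat j + 1)) * (1 + (1 + 2 * x) * pp / (2 * of_nat j + 1)) *
      (1 + 2 * y * pp / (2 * of_nat j + 1)) / (1 - \<tau>\<^sup>2 * pp\<^sup>2 / (of_nat j + 1)\<^sup>2))"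
proof -
  have *: "(of_nat j - of_nat half) * (of_nat half + 1 + x * pp + of_nat j) * (1 / 2 + y * pp + of_nat j) /
       ((of_nat j + 1) * (1 + \<tau> * pp + of_nat j) * (1 - \<tau> * pp + of_nat j))
     = ((2 * of_nat j + 1) / (2 * (of_nat j + 1))) ^ 3 *
      ((1 + (- 1) * pp / (2 * of_nat j + 1)) * (1 + (1 + 2 * x) * pp / (2 * of_nat j + 1)) *
      (1 + 2 * y * pp / (2 * of_nat j + 1)) / (1 - \<tau>\<^sup>2 * pp\<^sup>2 / (of_nat j + 1)\<^sup>2))" for j
  proof -
    define v :: rat where "v = 2 * of_nat j + 1"
    define i :: rat where "i = of_nat j + 1"
    have nz: "v \<noteq> 0" "i \<noteq> 0" using odd_nonzero by (auto simp: v_def i_def)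
    have 1: "of_nat j - of_nat half = v * (1 + (- 1) * pp / v) / 2"
      "of_nat half + 1 + x * pp + of_nat j = v * (1 + (1 + 2 * x) * pp / v) / 2"
      "1 / 2 + y * pp + of_nat j = v * (1 + 2 * y * pp / v) / 2"
      using nz unfolding of_nat_half by (simp_all add: field_simps) (simp_all add: v_def algebra_simps)
    have "(1 + \<tau> * pp + of_nat j) * (1 - \<tau> * pp + of_nat j) = i\<^sup>2 - \<tau>\<^sup>2 * pp\<^sup>2"
      by (simp add: i_def algebra_simps power2_eq_square)
    also have "\<dots> = i\<^sup>2 * (1 - \<tau>\<^sup>2 * pp\<^sup>2 / i\<^sup>2)"
      using nz by (simp add: right_diff_distrib)
    finally have 2: "(of_nat j + 1) * (1 + \<tau> * pp + of_nat j) * (1 - \<tau> * pp + of_nat j)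
        = i ^ 3 * (1 - \<tau>\<^sup>2 * pp\<^sup>2 / i\<^sup>2)"
      by (simp add: mult.assoc flip: i_def) (simp add: power2_eq_square power3_eq_cube)
    have "v * A / 2 * (v * B / 2) * (v * C / 2) / (i ^ 3 * Q) = (v / (2 * i)) ^ 3 * (A * B * C / Q)"
      for A B C Q :: rat
      by (simp add: power3_eq_cube ac_simps)
    then show ?thesis
      unfolding 1 2 unfolding v_def[symmetric] i_def[symmetric] by blast
  qed
  show ?thesis unfolding hyp_term_def * \<beta>_prod prod.distrib[symmetric] ..
qed

lemma hyp_sum_expand:
  assumes "x \<in> Zp" "y \<in> Zp" "\<tau> \<in> Zp"
  shows "hyp_sum half (x * pp) (1 / 2 + y * pp) (1 + \<tau> * pp) (1 - \<tau> * pp) \<approx>[3]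
    S0 + pp * ((2 * x + 2 * y) * S1)
      + pp\<^sup>2 * (((2 * x + 2 * y)\<^sup>2 * S11 - (1 + (1 + 2 * x)\<^sup>2 + (2 * y)\<^sup>2) * S2) / 2 + \<tau>\<^sup>2 * T2)"
  using weighted_sum_expand[of "- 1" "1 + 2 * x" "2 * y" "\<tau>\<^sup>2"] assms
  unfolding hyp_sum_def hyp_term_\<beta> by (simp add: algebra_simps)

lemma apery_expand:
  "of_nat (apery' half) \<approx>[3] S0 - pp * S1 + pp\<^sup>2 * ((S11 - 3 * S2) / 2)"
proof -
  have "(of_nat ((half choose k)\<^sup>2 * ((half + k) choose k)) :: rat) = \<beta> k *
    (\<Prod>j<k. (1 + (- 1) * pp / (2 * of_nat j + 1)) * (1 + (- 1) * pp / (2 * of_nat j + 1)) *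
      (1 + 1 * pp / (2 * of_nat j + 1)) / (1 - 0 * pp\<^sup>2 / (of_nat j + 1)\<^sup>2))" for k
  proof -
    have b: "of_nat ((half + k) choose k) = (\<Prod>j<k. (of_nat half + 1 + of_nat j) / (of_nat j + 1) :: rat)"
    proof -
      have "of_nat ((half + k) choose k) = (\<Prod>j<k. (of_nat (half + k) - of_nat j) :: rat) / (\<Prod>j<k. of_nat j + 1)"
        unfolding binomial_prod prod_dividef ..
      also have "(\<Prod>j<k. (of_nat (half + k) - of_nat j) :: rat) = (\<Prod>j<k. of_nat half + 1 + of_nat j)"
        by (subst prod.nat_diff_reindex[symmetric]) (auto intro!: prod.cong simp: of_nat_diff)
      finally show ?thesis by (simp only: prod_dividef)
    qed
    have *: "((of_nat half - of_nat j) / (of_nat j + 1))\<^sup>2 * ((of_nat half + 1 + of_nat j) / (of_nat j + 1))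
      = ((2 * of_nat j + 1) / (2 * (of_nat j + 1))) ^ 3 *
      ((1 + (- 1) * pp / (2 * of_nat j + 1)) * (1 + (- 1) * pp / (2 * of_nat j + 1)) *
      (1 + 1 * pp / (2 * of_nat j + 1)) / (1 - 0 * pp\<^sup>2 / (of_nat j + 1)\<^sup>2))" for j
    proof -
      define v :: rat where "v = 2 * of_nat j + 1"
      define i :: rat where "i = of_nat j + 1"
      have nz: "v \<noteq> 0" "i \<noteq> 0" using odd_nonzero by (auto simp: v_def i_def)
      have 1: "of_nat half - of_nat j = - (v * (1 + (- 1) * pp / v) / 2)"
        "of_nat half + 1 + of_nat j = v * (1 + 1 * pp / v) / 2"
        using nz unfolding of_nat_half by (simp_all add: field_simps) (simp_all add: v_def algebra_simps)
      have "(- (v * A / 2) / i)\<^sup>2 * (v * B / 2 / i) = (v / (2 * i)) ^ 3 * (A * A * B / (1 - 0 * pp\<^sup>2 / i\<^sup>2))"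
        for A B :: rat
        by (simp add: power3_eq_cube power2_eq_square ac_simps)
      then show ?thesis
        unfolding 1 unfolding v_def[symmetric] i_def[symmetric] by blast
    qed
    show ?thesis
      by (simp only: of_nat_mult of_nat_power b binomial_prod[of half] prod_power_distrib
          prod.distrib[symmetric] * \<beta>_prod)
  qed
  then have "(of_nat (apery' half) :: rat) = (\<Sum>k\<le>half. \<beta> k *
    (\<Prod>j<k. (1 + (- 1) * pp / (2 * of_nat j + 1)) * (1 + (- 1) * pp / (2 * of_nat j + 1)) *
      (1 + 1 * pp / (2 * of_nat j + 1)) / (1 - 0 * pp\<^sup>2 / (of_nat j + 1)\<^sup>2)))"
    unfolding apery'_def of_nat_sum atMost_atLeast0 by (intro sum.cong refl)
  also have "\<dots> \<approx>[3] S0 + pp * ((- 1 + - 1 + 1) * S1)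
      + pp\<^sup>2 * (((- 1 + - 1 + 1)\<^sup>2 * S11 - ((- 1)\<^sup>2 + (- 1)\<^sup>2 + 1\<^sup>2) * S2) / 2 + 0 * T2)"
    by (intro weighted_sum_expand) auto
  finally show ?thesis by simp
qed

text \<open>Since \<open>-n \<equiv> 1/2 (mod p)\<close>, the summand is a cube of binomial coefficients of \<open>n\<close> up to sign, and so inherits
  their symmetry.\<close>

lemma \<beta>_binomial: "k \<le> half \<Longrightarrow> \<beta> k \<approx>[1] (- 1) ^ k * of_nat (half choose k) ^ 3"
proof -
  assume k: "k \<le> half"
  let ?P = "\<Prod>j<k. 1 + (- 1) * pp / (2 * of_nat j + 1)"
  have *: "(of_nat half - of_nat j) / (of_nat j + 1) =
      (- 1) * ((2 * of_nat j + 1) / (2 * (of_nat j + 1))) * (1 + (- 1) * pp / (2 * of_nat j + 1))" for j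
  proof -
    define v :: rat where "v = 2 * of_nat j + 1"
    have v: "v \<noteq> 0" using odd_nonzero by (auto simp: v_def)
    have "of_nat half - of_nat j = - (v * (1 + (- 1) * pp / v) / 2)"
      using v unfolding of_nat_half by (simp add: field_simps) (simp add: v_def algebra_simps)
    then show ?thesis unfolding v_def[symmetric] by simp
  qed
  have "(of_nat (half choose k) :: rat) = (- 1) ^ k * (\<Prod>j<k. (2 * of_nat j + 1) / (2 * (of_nat j + 1))) * ?P"
    unfolding binomial_prod * prod.distrib by simp
  then have "(of_nat (half choose k) :: rat) ^ 3 = ((- 1) ^ k) ^ 3 * \<beta> k * ?P ^ 3"
    by (simp only: \<beta>_prod prod_power_distrib power_mult_distrib)
  moreover have "((- 1 :: rat) ^ k) * (- 1) ^ k = 1" by (simp flip: power_mult_distrib)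
  ultimately have "(- 1) ^ k * (of_nat (half choose k) :: rat) ^ 3 = \<beta> k * ?P ^ 3"
    by (simp add: power3_eq_cube mult.assoc)
  also have "\<dots> \<approx>[1] \<beta> k * 1 ^ 3"
  proof (intro pcong_scale pcong_power)
    show "?P \<approx>[1] 1"
      using pcong_trans[OF pcong_weaken[OF prod_odd_texp[OF k, of "- 1"], of 1] texp_cong1] k by simp
  qed simp_all
  finally show ?thesis by (simp add: pcong_sym)
qed

lemma \<beta>_reflect:
  assumes "k \<le> half"
  shows "\<beta> (half - k) \<approx>[1] (- 1) ^ half * \<beta> k"
proof -
  have "\<beta> (half - k) \<approx>[1] (- 1) ^ (half - k) * of_nat (half choose (half - k)) ^ 3"
    by (rule \<beta>_binomial) simp
  also have "\<dots> = (- 1) ^ half * ((- 1) ^ k * of_nat (half choose k) ^ 3)"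
  proof -
    have "(- 1 :: rat) ^ (half - k) = (- 1) ^ half * (- 1) ^ k"
      using assms by (simp add: minus_one_power_iff)
    then show ?thesis using binomial_symmetric[OF assms] by simp
  qed
  also have "\<dots> \<approx>[1] (- 1) ^ half * \<beta> k"
    using assms by (intro pcong_scale pcong_sym[OF \<beta>_binomial]) simp_all
  finally show ?thesis .
qed

text \<open>Summing in the order \<open>n - k\<close> turns odd denominators into all denominators; the constant
  \<open>harm 2 half\<close> that appears is divisible by \<open>p\<close>.\<close>

lemma S2_reflect:
  assumes "p \<noteq> 3"
  shows "S2 \<approx>[1] - ((- 1) ^ half * T2 / 4)"
proof -
  have "S2 = (\<Sum>k\<le>half. \<beta> (half - k) * oddH 2 (half - k))"
    unfolding S2_def by (rule sum.reindex_bij_witness[of _ "\<lambda>k. half - k" "\<lambda>k. half - k"]) auto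
  also have "\<dots> \<approx>[1] (\<Sum>k\<le>half. ((- 1) ^ half * \<beta> k) * ((0 - harm 2 k) / 4))"
  proof (intro pcong_sum pcong_mult \<beta>_reflect)
    fix k assume "k \<in> {..half}"
    then have k: "k \<le> half" by simp
    have "oddH 2 (half - k) \<approx>[1] (harm 2 half - harm 2 k) / 4" by (rule oddH2_reflect[OF k])
    also have "\<dots> \<approx>[1] (0 - harm 2 k) / 4"
      using k by (intro pcong_divide pcong_diff harm2_half[OF assms]) simp_all
    finally show "oddH 2 (half - k) \<approx>[1] (0 - harm 2 k) / 4" .
  qed simp_all
  also have "\<dots> = - ((- 1) ^ half * T2 / 4)"
    by (simp add: T2_def sum_negf sum_divide_distrib sum_distrib_left mult.assoc)
  finally show ?thesis .
qed

text \<open>The perturbed parameters are never integers, so no factor in the summation theorems vanishes;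
  this is the reason for choosing fractions such as \<open>p/8\<close> as perturbations.\<close>

lemma no_quarter: "a * pp + of_nat (Suc i) \<noteq> 0" if "a \<in> {1 / 2, - 1 / 2, 1 / 4, - 1 / 4}"
proof
  assume eq: "a * pp + of_nat (Suc i) = 0"
  have "of_nat (Suc i) > (0 :: rat)" by (simp only: of_nat_0_less_iff)
  then have "a * pp < 0" using eq by linarith
  then have "a < 0" by (simp add: mult_less_0_iff)
  then have "a = - 1 / 2 \<or> a = - 1 / 4" using that by auto
  then have "pp = of_nat (2 * Suc i) \<or> pp = of_nat (4 * Suc i)"
  proof
    assume a: "a = - 1 / 2"
    show ?thesis using eq unfolding a by simp
  next
    assume a: "a = - 1 / 4"
    show ?thesis using eq unfolding a by simp
  qed
  then have "p = 2 * Suc i \<or> p = 4 * Suc i" by (simp only: of_nat_eq_iff)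
  then show False using odd by auto
qed

lemma no_half_square: "(of_nat (Suc i))\<^sup>2 \<noteq> (1 / 2 * pp)\<^sup>2"
proof
  assume "(of_nat (Suc i))\<^sup>2 = (1 / 2 * pp)\<^sup>2"
  then have "of_nat (Suc i) = 1 / 2 * pp \<or> of_nat (Suc i) = - (1 / 2 * pp)"
    by (simp only: power2_eq_iff)
  then show False using no_quarter[of "1 / 2" i] no_quarter[of "- 1 / 2" i] by auto
qed

abbreviation watson_p :: rat where
  "watson_p \<equiv>
    hyp_sum half (- 1 / 2 * pp) (1 / 2 + 1 / 8 * pp) (1 + - 1 / 4 * pp) (1 - - 1 / 4 * pp)"

abbreviation watson_m :: rat where
  "watson_m \<equiv>
    hyp_sum half (1 / 2 * pp) (1 / 2 + - 1 / 8 * pp) (1 + 1 / 4 * pp) (1 - 1 / 4 * pp)"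

abbreviation whipple_p :: rat where
  "whipple_p \<equiv>
    hyp_sum half 0 (1 / 2) (1 + 1 / 2 * pp) (1 - 1 / 2 * pp)"

text \<open>Watson's series with \<open>w = p/8\<close> and \<open>z = -2w\<close>.  The relation \<open>z = -2w\<close> makes the two denominator
  parameters \<open>1 - 2w\<close> and \<open>1 + 2w\<close> opposite, so that the weight of first order is \<open>oddH 1\<close> alone.  Changing
  the sign of \<open>w\<close> changes the sign of the term of first order, and \<open>S1\<close> is obtained from the difference.\<close>

lemma watson_plus:
  "watson_p \<approx>[3]
    S0 - 3 / 4 * (pp * S1) + pp\<^sup>2 * (9 / 32 * S11 - 17 / 32 * S2 + T2 / 16)"
proof -
  have "watson_p \<approx>[3]
      S0 + pp * ((2 * (- 1 / 2) + 2 * (1 / 8)) * S1)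
      + pp\<^sup>2 * (((2 * (- 1 / 2) + 2 * (1 / 8))\<^sup>2 * S11 -
        (1 + (1 + 2 * (- 1 / 2))\<^sup>2 + (2 * (1 / 8))\<^sup>2) * S2) / 2 + (- 1 / 4)\<^sup>2 * T2)"
    by (rule hyp_sum_expand) (auto intro!: Zp_divide Zp_uminus)
  also have "\<dots> = S0 - 3 / 4 * (pp * S1)
      + pp\<^sup>2 * (9 / 32 * S11 - 17 / 32 * S2 + T2 / 16)"
    by (simp add: power2_eq_square diff_divide_distrib)
  finally show ?thesis .
qed

lemma watson_minus:
  "watson_m \<approx>[3]
    S0 + 3 / 4 * (pp * S1) + pp\<^sup>2 * (9 / 32 * S11 - 81 / 32 * S2 + T2 / 16)"
proof -
  have "watson_m \<approx>[3]
      S0 + pp * ((2 * (1 / 2) + 2 * (- 1 / 8)) * S1)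
      + pp\<^sup>2 * (((2 * (1 / 2) + 2 * (- 1 / 8))\<^sup>2 * S11 -
        (1 + (1 + 2 * (1 / 2))\<^sup>2 + (2 * (- 1 / 8))\<^sup>2) * S2) / 2 + (1 / 4)\<^sup>2 * T2)"
    by (rule hyp_sum_expand) (auto intro!: Zp_divide Zp_uminus)
  also have "\<dots> = S0 + 3 / 4 * (pp * S1)
      + pp\<^sup>2 * (9 / 32 * S11 - 81 / 32 * S2 + T2 / 16)"
    by (simp add: power2_eq_square diff_divide_distrib)
  finally show ?thesis .
qed

lemma whipple_half:
  "whipple_p \<approx>[3] S0 - pp\<^sup>2 * S2 + pp\<^sup>2 * T2 / 4"
proof -
  have "hyp_sum half (0 * pp) (1 / 2 + 0 * pp) (1 + 1 / 2 * pp) (1 - 1 / 2 * pp) \<approx>[3]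
    S0 + pp * ((2 * 0 + 2 * 0) * S1) + pp\<^sup>2 * (((2 * 0 + 2 * 0)\<^sup>2 * S11 -
        (1 + (1 + 2 * 0)\<^sup>2 + (2 * 0)\<^sup>2) * S2) / 2 + (1 / 2)\<^sup>2 * T2)"
    by (rule hyp_sum_expand) auto
  then show ?thesis by (simp add: power2_eq_square algebra_simps)
qed

lemma whipple_zero:
  "hyp_sum half 0 (1 / 2) 1 1 \<approx>[3] S0 - pp\<^sup>2 * S2"
proof -
  have "hyp_sum half (0 * pp) (1 / 2 + 0 * pp) (1 + 0 * pp) (1 - 0 * pp) \<approx>[3]
    S0 + pp * ((2 * 0 + 2 * 0) * S1) + pp\<^sup>2 * (((2 * 0 + 2 * 0)\<^sup>2 * S11 -
        (1 + (1 + 2 * 0)\<^sup>2 + (2 * 0)\<^sup>2) * S2) / 2 + 0\<^sup>2 * T2)"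
    by (rule hyp_sum_expand) auto
  then show ?thesis by (simp add: power2_eq_square algebra_simps)
qed

text \<open>The same parameters in the form in which Watson's theorem takes them.\<close>

lemma watson_plus_params:
  "watson_p
   = hyp_sum half (2 * (- 1 / 4 * pp)) (1 / 2 + 1 / 8 * pp) (1 + - 1 / 4 * pp) (1 + 2 * (1 / 8 * pp))"
  by simp

lemma watson_minus_params:
  "watson_m
   = hyp_sum half (2 * (1 / 4 * pp)) (1 / 2 + - 1 / 8 * pp) (1 + 1 / 4 * pp) (1 + 2 * (- 1 / 8 * pp))"
  by simp

section \<open>Primes congruent to 3 modulo 4\<close>

text \<open>The two Watson series and Whipple's series with \<open>z = 0\<close> vanish for odd \<open>n\<close>; together with the
  reflection, Whipple's series with \<open>z = p/2\<close> and the expansion of the Apery number these are six linear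
  relations between five sums.\<close>

lemma apery_eq_whipple_odd:
  assumes half: "half = 2 * m + 1" and "p \<noteq> 3"
  shows "of_nat (apery' half) \<approx>[3] - 4 / 3 * whipple_p"
proof -
  define V where "V = whipple_p"
  define A where "A = (of_nat (apery' half) :: rat)"
  have cond: "2 * (a * pp) + of_nat (Suc i) \<noteq> 0" if "a \<in> {1 / 4, - 1 / 4, 1 / 8, - 1 / 8}" for a i
    using that no_quarter[of "2 * a" i] by auto
  have "watson_p = 0"
    unfolding watson_plus_params unfolding half by (intro watson_odd cond) auto
  then have "0 \<approx>[3] S0 - 3 / 4 * (pp * S1) + pp\<^sup>2 * (9 / 32 * S11 - 17 / 32 * S2 + T2 / 16)"
    using watson_plus by (simp only:)
  then obtain r1 where r1: "r1 \<in> Zp" "0 = S0 - 3 / 4 * (pp * S1) +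
      pp\<^sup>2 * (9 / 32 * S11 - 17 / 32 * S2 + T2 / 16) + pp ^ 3 * r1"
    by (rule pcongE)
  have "watson_m = 0"
    unfolding watson_minus_params unfolding half by (intro watson_odd cond) auto
  then have "0 \<approx>[3] S0 + 3 / 4 * (pp * S1) + pp\<^sup>2 * (9 / 32 * S11 - 81 / 32 * S2 + T2 / 16)"
    using watson_minus by (simp only:)
  then obtain r2 where r2: "r2 \<in> Zp" "0 = S0 + 3 / 4 * (pp * S1) +
      pp\<^sup>2 * (9 / 32 * S11 - 81 / 32 * S2 + T2 / 16) + pp ^ 3 * r2"
    by (rule pcongE)
  have "hyp_sum (2 * m + 1) 0 (1 / 2) (1 + 0) (1 - 0) = (0 :: rat)"
    by (subst whipple_odd) (simp_all del: of_nat_Suc)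
  then have "0 \<approx>[3] S0 - pp\<^sup>2 * S2" using whipple_zero half by simp
  then obtain r0 where r0: "r0 \<in> Zp" "0 = S0 - pp\<^sup>2 * S2 + pp ^ 3 * r0" by (rule pcongE)
  have "S2 \<approx>[1] T2 / 4" using S2_reflect[OF assms(2)] half by simp
  then obtain r3 where r3: "r3 \<in> Zp" "S2 = T2 / 4 + pp ^ 1 * r3" by (rule pcongE)
  obtain r4 where r4: "r4 \<in> Zp" "V = S0 - pp\<^sup>2 * S2 + pp\<^sup>2 * T2 / 4 + pp ^ 3 * r4"
    unfolding V_def by (rule pcongE[OF whipple_half])
  obtain r5 where r5: "r5 \<in> Zp" "A = S0 - pp * S1 + pp\<^sup>2 * ((S11 - 3 * S2) / 2) + pp ^ 3 * r5"
    unfolding A_def by (rule pcongE[OF apery_expand])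
  \<comment> \<open>The multipliers solve the linear system that eliminates \<open>S0\<close>, \<open>S1\<close>, \<open>S2\<close>, \<open>S11\<close> and \<open>T2\<close>.\<close>
  define R where "R = r5 - 5 / 9 * r0 - 14 / 9 * r1 - 2 / 9 * r2 - 8 / 9 * r3 + 4 / 3 * r4"
  have u: "9 \<in> Zunits" "3 \<in> Zunits"
    using three_unit[OF assms(2)] Zunits_mult[of 3 3] by simp_all
  have "R \<in> Zp" unfolding R_def using r0 r1 r2 r3 r4 r5 u by simp
  have "A + 4 / 3 * V - pp ^ 3 * R = (S0 - pp * S1 + pp\<^sup>2 * ((S11 - 3 * S2) / 2))
      + 4 / 3 * (S0 - pp\<^sup>2 * S2 + pp\<^sup>2 * T2 / 4) + pp ^ 3 * (5 / 9 * r0 + 14 / 9 * r1 + 2 / 9 * r2 + 8 / 9 * r3)"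
    unfolding r4(2) r5(2) R_def by (simp add: field_simps)
  also have "\<dots> = (S0 - pp * S1 + pp\<^sup>2 * ((S11 - 3 * S2) / 2))
      + 4 / 3 * (S0 - pp\<^sup>2 * S2 + pp\<^sup>2 * T2 / 4)
      + 5 / 9 * (pp ^ 3 * r0) + 14 / 9 * (pp ^ 3 * r1) + 2 / 9 * (pp ^ 3 * r2) + 8 / 9 * (pp\<^sup>2 * (pp ^ 1 * r3))"
    by (simp add: algebra_simps power2_eq_square power3_eq_cube)
  also have "\<dots> = 0"
  proof -
    have "pp ^ 3 * r0 = - (S0 - pp\<^sup>2 * S2)" "pp ^ 1 * r3 = S2 - T2 / 4"
      "pp ^ 3 * r1 = - (S0 - 3 / 4 * (pp * S1) + pp\<^sup>2 * (9 / 32 * S11 - 17 / 32 * S2 + T2 / 16))"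
      "pp ^ 3 * r2 = - (S0 + 3 / 4 * (pp * S1) + pp\<^sup>2 * (9 / 32 * S11 - 81 / 32 * S2 + T2 / 16))"
      using r0(2) r1(2) r2(2) r3(2) by linarith+
    then show ?thesis by (simp only:) (simp add: field_simps)
  qed
  finally have "A = - 4 / 3 * V + pp ^ 3 * R" by (simp add: field_simps)
  then show ?thesis unfolding A_def V_def using \<open>R \<in> Zp\<close> by (intro pcongI)
qed

text \<open>The product in Whipple's theorem is \<open>(4^m / ((2m + 1) binom(2m, m)))^2\<close> modulo \<open>p\<close>, and the
  numerator simplifies by \<open>2m + 1 \<equiv> -1/2\<close> and \<open>4 * 16^m = 2^(p-1) \<equiv> 1\<close>.\<close>

lemma whipple_odd_value:
  assumes half: "half = 2 * m + 1"
  shows "whipple_p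
    \<approx>[3] pp\<^sup>2 * (- 1 / 4 / (of_nat ((2 * m) choose m))\<^sup>2)"
proof -
  define C where "C = (of_nat ((2 * m) choose m) :: rat)"
  define P where "P = (\<Prod>j<m. (2 * of_nat j + 1) / (2 * (of_nat j + 1)) :: rat)"
  define N where "N = (\<Prod>j<m. (2 * of_nat j + 2)\<^sup>2 - (1 / 2 * pp)\<^sup>2 :: rat)"
  define D where "D = (1 - (1 / 2 * pp)\<^sup>2) * (\<Prod>j<m. (2 * of_nat j + 3)\<^sup>2 - (1 / 2 * pp)\<^sup>2 :: rat)"
  have "m < half" "m < p" using half p_half by auto
  have u: "2 * of_nat j + 2 \<in> Zunits" "2 * of_nat j + 3 \<in> Zunits" if "j < m" for j
    using that half p_half Zunits_small[of "2 * j + 2"] Zunits_small[of "2 * j + 3"]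
    by (simp_all add: add.commute)
  have c: "a - (1 / 2 * pp)\<^sup>2 \<approx>[1] a" for a
    by (rule pcongI[of "- (pp / 4)"]) (simp_all add: power2_eq_square)
  have hu: "2 * of_nat m + 1 \<in> Zunits" using odd_unit[of m] half by simp
  have CP: "C = 4 ^ m * P"
    using central_binomial_prod[of m, where 'a = rat] by (simp add: C_def P_def field_simps)
  have Pu: "P \<in> Zunits"
    unfolding P_def using \<open>m < half\<close> \<open>m < p\<close>
    by (intro Zunits_prod Zunits_divide Zunits_mult odd_unit Suc_unit Zunits_num) auto
  have Cu: "C \<in> Zunits" unfolding CP using Pu by simp
  have Nc: "N \<approx>[1] (\<Prod>j<m. (2 * of_nat j + 2)\<^sup>2)"
    unfolding N_def by (intro pcong_prod c) simp_all
  have Dc: "D \<approx>[1] 1 * (\<Prod>j<m. (2 * of_nat j + 3)\<^sup>2)"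
    unfolding D_def by (intro pcong_mult pcong_prod c) (auto intro!: Zp_prod Zp_power Zp_add Zp_mult)
  have Du: "1 * (\<Prod>j<m. (2 * of_nat j + 3)\<^sup>2) \<in> Zunits"
    using u by (intro Zunits_mult Zunits_prod Zunits_power) auto
  have "N / D \<approx>[1] (\<Prod>j<m. (2 * of_nat j + 2)\<^sup>2) / (1 * (\<Prod>j<m. (2 * of_nat j + 3)\<^sup>2))"
    using Nc Dc Du Zunits_pcong[OF Dc Du] by (intro pcong_divide) (auto intro!: Zp_prod Zp_power Zp_add Zp_mult)
  also have "\<dots> = (1 / ((2 * of_nat m + 1) * P))\<^sup>2"
  proof -
    have "(\<Prod>j<m. 2 * of_nat j + 3 :: rat) = (2 * of_nat m + 1) * (\<Prod>j<m. 2 * of_nat j + 1)"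
      by (induction m) (simp_all add: algebra_simps)
    moreover have "P = (\<Prod>j<m. 2 * of_nat j + 1) / (\<Prod>j<m. 2 * of_nat j + 2)"
      by (simp add: P_def prod_dividef distrib_left)
    ultimately show ?thesis
      by (simp add: prod_power_distrib[symmetric] power_divide power_mult_distrib)
  qed
  also have "\<dots> = (4 ^ m / (2 * of_nat m + 1))\<^sup>2 / C\<^sup>2"
    unfolding CP by (simp add: power_divide power_mult_distrib)
  also have "\<dots> \<approx>[1] 1 / C\<^sup>2"
  proof (rule pcong_divide)
    have h: "2 * of_nat m + 1 = (pp - 1) / 2" using of_nat_half half by simp
    have "(2 * of_nat m + 1)\<^sup>2 \<approx>[1] (1 / 4 :: rat)"
      unfolding h by (rule pcongI[of "(pp - 2) / 4"]) (simp_all add: power2_eq_square field_simps)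
    moreover have "4 * (4 ^ m)\<^sup>2 \<approx>[1] (1 :: rat)"
    proof -
      have "(2::nat) ^ (p - 1) = 4 * (4 ^ m)\<^sup>2"
        using p_half half by (simp add: power_add power_mult power2_eq_square flip: power_mult_distrib)
      moreover have "\<not> p dvd 2" using not_dvd_power_2[of 1] by simp
      ultimately show ?thesis using fermat_pcong[of 2] by (metis of_nat_mult of_nat_numeral of_nat_power)
    qed
    ultimately have "(4 * (4 ^ m)\<^sup>2) / (4 * (2 * of_nat m + 1)\<^sup>2) \<approx>[1] 1 / (4 * (1 / 4))"
      using hu by (intro pcong_divide pcong_scale) auto
    then show "(4 ^ m / (2 * of_nat m + 1))\<^sup>2 \<approx>[1] (1 :: rat)"
      by (simp add: power_divide)
  qed (use Cu in auto)
  finally have "N / D \<approx>[1] 1 / C\<^sup>2" .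
  then have "- 1 / 4 * (N / D) \<approx>[1] - 1 / 4 * (1 / C\<^sup>2)"
    by (intro pcong_scale) (auto intro!: Zp_divide Zp_uminus)
  then have "pp\<^sup>2 * (- 1 / 4 * (N / D)) \<approx>[3] pp\<^sup>2 * (- 1 / 4 * (1 / C\<^sup>2))"
    by (rule pcong_mult_p2)
  moreover have "whipple_p = pp\<^sup>2 * (- 1 / 4 * (N / D))"
    unfolding half whipple_odd[OF no_half_square] N_def D_def prod_dividef
    by (simp add: power2_eq_square)
  ultimately show ?thesis unfolding C_def by simp
qed

lemma apery_3_mod_4:
  assumes half: "half = 2 * m + 1" and "p \<noteq> 3"
  shows "of_nat (apery' half) \<approx>[3] pp\<^sup>2 / 3 / (of_nat ((2 * m) choose m))\<^sup>2"
proof -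
  note apery_eq_whipple_odd[OF assms]
  also have "- 4 / 3 * whipple_p \<approx>[3]
      - 4 / 3 * (pp\<^sup>2 * (- 1 / 4 / (of_nat ((2 * m) choose m))\<^sup>2))"
    using three_unit[OF assms(2)] by (intro pcong_scale whipple_odd_value[OF half]) (auto intro!: Zp_divide Zp_uminus)
  finally show ?thesis by simp
qed

section \<open>Primes congruent to 1 modulo 4: reduction to a central binomial coefficient\<close>

text \<open>The sum over the odd denominators below \<open>2m\<close> is computed in two ways, by removing the even ones and
  by reflection, and the results are compared.\<close>

lemma harm_relation_1:
  assumes half: "half = 2 * m" and "p \<noteq> 3"
  shows "3 * harm 1 half - 2 * harm 1 m \<approx>[2] pp * (harm 2 m / 2)"
proof -
  define H h k' k where "H = harm 1 half" and "h = harm 1 m" and "k' = harm 2 half" and "k = harm 2 m"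
  have "oddH 1 m = H - h / 2" using oddH_split[of 1 m] half by (simp add: H_def h_def)
  moreover have "oddH 1 m \<approx>[2] - ((H - h) / 2 + pp * ((k' - k) / 4))"
    using oddH1_reflect[of m] half by (simp add: H_def h_def k'_def k_def)
  ultimately obtain r where r: "r \<in> Zp" "H - h / 2 = - ((H - h) / 2 + pp * ((k' - k) / 4)) + pp\<^sup>2 * r"
    by (metis pcongE)
  obtain r' where r': "r' \<in> Zp" "k' = 0 + pp ^ 1 * r'"
    using harm2_half[OF assms(2)] unfolding k'_def by (rule pcongE)
  have "3 * H - 2 * h = 2 * (H - h / 2 - (- ((H - h) / 2 + pp * ((k' - k) / 4)))) - pp * (k' - k) / 2"
    by (simp add: field_simps)
  also have "\<dots> = 2 * (pp\<^sup>2 * r) - pp * (k' - k) / 2" unfolding r(2) by simp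
  also have "\<dots> = pp * (k / 2) + pp\<^sup>2 * (2 * r - r' / 2)"
    unfolding r'(2) by (simp add: field_simps power2_eq_square)
  finally show ?thesis using r(1) r'(1)
    unfolding H_def h_def k_def by (intro pcongI[of "2 * r - r' / 2"]) auto
qed

lemma harm_relation_2:
  assumes half: "half = 2 * m" and "p \<noteq> 3"
  shows "oddH 2 m \<approx>[1] - (harm 2 m / 4)"
proof -
  have "oddH 2 m = harm 2 half - harm 2 m / 4" using oddH_split[of 2 m] half by simp
  also have "\<dots> \<approx>[1] 0 - harm 2 m / 4"
    by (intro pcong_diff harm2_half[OF assms(2)] pcong_refl)
  finally show ?thesis by simp
qed

text \<open>Every factor of Watson's product is the one for \<open>w = z = 0\<close> times factors \<open>1 + a p / (2j + 1)\<close> and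
  \<open>1 + a p / (j + 1)\<close>, and the product for \<open>w = z = 0\<close> is the square of \<open>binom(2m, m) / 4^m\<close>.\<close>

lemma watson_even_value:
  assumes half: "half = 2 * m" and u: "u \<in> Zp"
    and cond: "\<And>i. 2 * (u * pp) + of_nat (Suc i) \<noteq> 0" "\<And>i. 2 * (- 2 * u * pp) + of_nat (Suc i) \<noteq> 0"
  shows "hyp_sum half (2 * (- 2 * u * pp)) (1 / 2 + u * pp) (1 + - 2 * u * pp) (1 + 2 * (u * pp))
    \<approx>[3] (of_nat ((2 * m) choose m) / 4 ^ m)\<^sup>2 *
      texp (u * (harm 1 m - 6 * oddH 1 m)) (u\<^sup>2 * (36 * oddH 2 m - 5 * harm 2 m))"
proof -
  let ?N = "\<Prod>j<m. 1 + (- 6 * u) * pp / (2 * of_nat j + 1)"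
  let ?D = "\<lambda>a. \<Prod>j<m. 1 + a * pp / (of_nat j + 1)"
  have m: "m \<le> half" "m < p" using half p_half by auto
  have *: "(2 * of_nat j + 1) * (2 * of_nat j + 1 + 2 * (- 2 * u * pp) - 2 * (u * pp)) /
      ((2 * of_nat j + 2 + 2 * (u * pp)) * (2 * of_nat j + 2 + 2 * (- 2 * u * pp)))
    = ((2 * of_nat j + 1) / (2 * (of_nat j + 1)))\<^sup>2 * ((1 + (- 6 * u) * pp / (2 * of_nat j + 1)) /
        ((1 + u * pp / (of_nat j + 1)) * (1 + (- 2 * u) * pp / (of_nat j + 1))))" for j
  proof -
    define v :: rat where "v = 2 * of_nat j + 1"
    define i :: rat where "i = of_nat j + 1"
    have nz: "v \<noteq> 0" "i \<noteq> 0" using odd_nonzero by (auto simp: v_def i_def)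
    have 1: "2 * of_nat j + 1 + 2 * (- 2 * u * pp) - 2 * (u * pp) = v * (1 + (- 6 * u) * pp / v)"
      "2 * of_nat j + 2 + 2 * (u * pp) = 2 * i * (1 + u * pp / i)"
      "2 * of_nat j + 2 + 2 * (- 2 * u * pp) = 2 * i * (1 + (- 2 * u) * pp / i)"
      using nz by (simp_all add: field_simps) (simp_all add: v_def i_def algebra_simps)
    have "v * (v * A) / (2 * i * B * (2 * i * C)) = (v / (2 * i))\<^sup>2 * (A / (B * C))" for A B C :: rat
      by (simp add: power2_eq_square ac_simps)
    then show ?thesis unfolding 1 unfolding v_def[symmetric] i_def[symmetric] by blast
  qed
  have "hyp_sum half (2 * (- 2 * u * pp)) (1 / 2 + u * pp) (1 + - 2 * u * pp) (1 + 2 * (u * pp))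
      = (of_nat ((2 * m) choose m) / 4 ^ m)\<^sup>2 * (?N / (?D u * ?D (- 2 * u)))"
    unfolding half watson_even[OF cond] * central_binomial_prod prod_power_distrib
      prod_dividef[symmetric] prod.distrib[symmetric] ..
  also have "\<dots> \<approx>[3] (of_nat ((2 * m) choose m) / 4 ^ m)\<^sup>2 *
      (texp (- 6 * u * oddH 1 m) ((- 6 * u)\<^sup>2 * oddH 2 m) /
        (texp (u * harm 1 m + - 2 * u * harm 1 m) (u\<^sup>2 * harm 2 m + (- 2 * u)\<^sup>2 * harm 2 m)))"
  proof (rule pcong_scale)
    show "(of_nat ((2 * m) choose m) / 4 ^ m)\<^sup>2 \<in> Zp" by simp
    have D: "?D u * ?D (- 2 * u) \<approx>[3] texp (u * harm 1 m + - 2 * u * harm 1 m) (u\<^sup>2 * harm 2 m + (- 2 * u)\<^sup>2 * harm 2 m)"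
    proof (rule pcong_trans[OF pcong_mult texp_mult])
      show "?D u \<approx>[3] texp (u * harm 1 m) (u\<^sup>2 * harm 2 m)"
        "?D (- 2 * u) \<approx>[3] texp (- 2 * u * harm 1 m) ((- 2 * u)\<^sup>2 * harm 2 m)"
        by (rule prod_Suc_texp[OF m(2)], use u in simp)+
    qed (use m u in simp_all)
    have eu: "texp (u * harm 1 m + - 2 * u * harm 1 m) (u\<^sup>2 * harm 2 m + (- 2 * u)\<^sup>2 * harm 2 m) \<in> Zunits"
      using m u by simp
    show "?N / (?D u * ?D (- 2 * u)) \<approx>[3] texp (- 6 * u * oddH 1 m) ((- 6 * u)\<^sup>2 * oddH 2 m) /
        (texp (u * harm 1 m + - 2 * u * harm 1 m) (u\<^sup>2 * harm 2 m + (- 2 * u)\<^sup>2 * harm 2 m))"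
    proof (rule pcong_divide[OF _ D _ _ eu])
      show "?N \<approx>[3] texp (- 6 * u * oddH 1 m) ((- 6 * u)\<^sup>2 * oddH 2 m)"
        using m u by (intro prod_odd_texp) simp_all
      show "?D u * ?D (- 2 * u) \<in> Zunits" by (rule Zunits_pcong[OF D eu]) simp
    qed (use m u in simp_all)
  qed
  also have "\<dots> \<approx>[3] (of_nat ((2 * m) choose m) / 4 ^ m)\<^sup>2 *
      texp (- 6 * u * oddH 1 m - (u * harm 1 m + - 2 * u * harm 1 m))
        ((- 6 * u)\<^sup>2 * oddH 2 m - (u\<^sup>2 * harm 2 m + (- 2 * u)\<^sup>2 * harm 2 m))"
    using m u by (intro pcong_scale texp_divide) simp_all
  also have "- 6 * u * oddH 1 m - (u * harm 1 m + - 2 * u * harm 1 m) = u * (harm 1 m - 6 * oddH 1 m)"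
    by (simp add: algebra_simps)
  also have "(- 6 * u)\<^sup>2 * oddH 2 m - (u\<^sup>2 * harm 2 m + (- 2 * u)\<^sup>2 * harm 2 m)
      = u\<^sup>2 * (36 * oddH 2 m - 5 * harm 2 m)"
    by (simp add: algebra_simps power2_eq_square)
  finally show ?thesis .
qed

lemma whipple_even_value:
  assumes half: "half = 2 * m"
  shows "whipple_p
    \<approx>[3] (of_nat ((2 * m) choose m) / 4 ^ m)\<^sup>2 * texp 0 (oddH 2 m / 2 - harm 2 m / 8)"
proof -
  have m: "m \<le> half" using half by simp
  have *: "((2 * of_nat j + 1)\<^sup>2 - (1 / 2 * pp)\<^sup>2) / ((2 * of_nat j + 2)\<^sup>2 - (1 / 2 * pp)\<^sup>2)
    = ((2 * of_nat j + 1) / (2 * (of_nat j + 1)))\<^sup>2 * ((1 + 1 / 2 * pp / (2 * of_nat j + 1)) *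
        (1 + (- 1 / 2) * pp / (2 * of_nat j + 1)) * (1 + 0 * pp / (2 * of_nat j + 1)) /
        (1 - 1 / 16 * pp\<^sup>2 / (of_nat j + 1)\<^sup>2))" for j
  proof -
    define v :: rat where "v = 2 * of_nat j + 1"
    define i :: rat where "i = of_nat j + 1"
    have nz: "v \<noteq> 0" "i \<noteq> 0" using odd_nonzero by (auto simp: v_def i_def)
    have 0: "2 * of_nat j + 2 = 2 * i" by (simp add: i_def)
    have 1: "v\<^sup>2 - (1 / 2 * pp)\<^sup>2 = v\<^sup>2 * ((1 + 1 / 2 * pp / v) * (1 + (- 1 / 2) * pp / v) * (1 + 0 * pp / v))"
      "(2 * i)\<^sup>2 - (1 / 2 * pp)\<^sup>2 = (2 * i)\<^sup>2 * (1 - 1 / 16 * pp\<^sup>2 / i\<^sup>2)"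
      using nz by (simp_all add: divide_simps power2_eq_square) (simp_all add: algebra_simps)
    show ?thesis unfolding 0 unfolding v_def[symmetric] i_def[symmetric] 1
      by (simp only: power_divide times_divide_times_eq)
  qed
  have eq: "whipple_p =
      (of_nat ((2 * m) choose m) / 4 ^ m)\<^sup>2 * (\<Prod>j<m. (1 + 1 / 2 * pp / (2 * of_nat j + 1)) *
        (1 + (- 1 / 2) * pp / (2 * of_nat j + 1)) * (1 + 0 * pp / (2 * of_nat j + 1)) /
        (1 - 1 / 16 * pp\<^sup>2 / (of_nat j + 1)\<^sup>2))"
    unfolding half whipple_even[OF no_half_square] * central_binomial_prod prod_power_distrib
      prod.distrib[symmetric] ..
  have s: "(1 / 2 + - 1 / 2 + 0) * oddH 1 m = 0"
    "((1 / 2)\<^sup>2 + (- 1 / 2)\<^sup>2 + 0\<^sup>2) * oddH 2 m - 2 * (1 / 16 * harm 2 m)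
      = oddH 2 m / 2 - harm 2 m / 8" by (simp_all add: power2_eq_square)
  show ?thesis
    unfolding eq by (rule pcong_scale[OF _ term_expand[OF m, of "1 / 2" "- 1 / 2" 0 "1 / 16", unfolded s]])
      simp_all
qed

text \<open>For even \<open>n\<close> the four series have nonzero values.  Whipple's two series and the reflection give \<open>S0\<close>
  and \<open>S2\<close>, the difference of the two Watson series gives \<open>S1\<close>.\<close>

lemma apery_eq_binomial_even:
  assumes half: "half = 2 * m" and p3: "p \<noteq> 3" and W: "W = (of_nat ((2 * m) choose m) / 4 ^ m)\<^sup>2"
  shows "of_nat (apery' half) \<approx>[3] W * (1 + pp\<^sup>2 * harm 2 m / 16) + pp\<^sup>2 * S11 / 2"
proof -
  define k where "k = harm 2 m"
  define L where "L = harm 1 m - 6 * oddH 1 m"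
  define M where "M = 36 * oddH 2 m - 5 * harm 2 m"
  define o2 where "o2 = oddH 2 m"
  have m: "m \<le> half" using half by simp
  have WZ: "W \<in> Zp" and kZ: "k \<in> Zp" and LZ: "L \<in> Zp" and MZ: "M \<in> Zp" and o2Z: "o2 \<in> Zp"
    using m unfolding W k_def L_def M_def o2_def by simp_all
  have u3: "3 \<in> Zunits" by (rule three_unit[OF p3])
  have cond: "2 * (a * pp) + of_nat (Suc i) \<noteq> 0" if "a \<in> {1 / 4, - 1 / 4, 1 / 8, - 1 / 8}" for a i
    using that no_quarter[of "2 * a" i] by auto
  have "watson_p
      = hyp_sum half (2 * (- 2 * (1 / 8) * pp)) (1 / 2 + 1 / 8 * pp) (1 + - 2 * (1 / 8) * pp) (1 + 2 * (1 / 8 * pp))"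
    by simp
  also have "\<dots> \<approx>[3] W * texp (1 / 8 * L) ((1 / 8)\<^sup>2 * M)"
    unfolding W L_def M_def
    by (rule watson_even_value[OF half]) (use cond[of "1 / 8"] cond[of "- 1 / 4"] in simp_all)
  finally have p1: "S0 - 3 / 4 * (pp * S1) + pp\<^sup>2 * (9 / 32 * S11 - 17 / 32 * S2 + T2 / 16)
      \<approx>[3] W * texp (1 / 8 * L) ((1 / 8)\<^sup>2 * M)"
    by (rule pcong_trans[OF pcong_sym[OF watson_plus]])
  have "watson_m
      = hyp_sum half (2 * (- 2 * (- 1 / 8) * pp)) (1 / 2 + - 1 / 8 * pp) (1 + - 2 * (- 1 / 8) * pp) (1 + 2 * (- 1 / 8 * pp))"
    by simp
  also have "\<dots> \<approx>[3] W * texp (- 1 / 8 * L) ((- 1 / 8)\<^sup>2 * M)"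
    unfolding W L_def M_def
    by (rule watson_even_value[OF half]) (use cond[of "- 1 / 8"] cond[of "1 / 4"] in \<open>simp_all add: Zp_uminus Zp_divide\<close>)
  finally have p2: "S0 + 3 / 4 * (pp * S1) + pp\<^sup>2 * (9 / 32 * S11 - 81 / 32 * S2 + T2 / 16)
      \<approx>[3] W * texp (- 1 / 8 * L) ((- 1 / 8)\<^sup>2 * M)"
    by (rule pcong_trans[OF pcong_sym[OF watson_minus]])
  have "hyp_sum (2 * m) 0 (1 / 2) (1 + 0) (1 - 0) = W"
    unfolding W central_binomial_prod
    by (subst whipple_even) (simp_all add: power_divide prod_power_distrib prod_dividef distrib_left del: of_nat_Suc)
  then have p0: "S0 - pp\<^sup>2 * S2 \<approx>[3] W" using pcong_sym[OF whipple_zero] half by simp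
  have p4: "S0 - pp\<^sup>2 * S2 + pp\<^sup>2 * T2 / 4 \<approx>[3] W * texp 0 (o2 / 2 - k / 8)"
    using pcong_trans[OF pcong_sym[OF whipple_half] whipple_even_value[OF half]]
    unfolding W o2_def k_def .
  have "S2 \<approx>[1] - (T2 / 4)" using S2_reflect[OF p3] half by simp
  from pcong_mult_p2[OF this] have p5: "pp\<^sup>2 * S2 \<approx>[3] pp\<^sup>2 * (- (T2 / 4))" .
  have "W * (o2 / 4 - k / 16) \<approx>[1] W * (- (k / 4) / 4 - k / 16)"
    using harm_relation_2[OF half p3] WZ kZ unfolding o2_def k_def
    by (intro pcong_scale pcong_diff pcong_divide pcong_refl) simp_all
  from pcong_mult_p2[OF this] have p6: "pp\<^sup>2 * (W * (o2 / 4 - k / 16)) \<approx>[3] pp\<^sup>2 * (W * (- (k / 4) / 4 - k / 16))" .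
  have S2: "pp\<^sup>2 * S2 \<approx>[3] pp\<^sup>2 * (- (W * k / 8))"
  proof -
    have "pp\<^sup>2 * S2 \<approx>[3] pp\<^sup>2 * (- (T2 / 4))" by (rule p5)
    also have "\<dots> = (S0 - pp\<^sup>2 * S2) - (S0 - pp\<^sup>2 * S2 + pp\<^sup>2 * T2 / 4)" by simp
    also have "\<dots> \<approx>[3] W - W * texp 0 (o2 / 2 - k / 8)" by (rule pcong_diff[OF p0 p4])
    also have "\<dots> = pp\<^sup>2 * (W * (o2 / 4 - k / 16))" by (simp add: texp_def field_simps)
    also note p6
    also have "pp\<^sup>2 * (W * (- (k / 4) / 4 - k / 16)) = pp\<^sup>2 * (- (W * k / 8))" by (simp add: field_simps)
    finally show ?thesis .
  qed
  have L: "pp * L \<approx>[3] pp\<^sup>2 * (- k)"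
  proof -
    have "L = - 2 * (3 * harm 1 half - 2 * harm 1 m)"
      using oddH_split[of 1 m] half by (simp add: L_def algebra_simps)
    also have "\<dots> \<approx>[2] - 2 * (pp * (harm 2 m / 2))"
      by (intro pcong_scale harm_relation_1[OF half p3]) (simp add: Zp_uminus)
    finally have "L \<approx>[2] pp * (- k)" by (simp add: k_def)
    then have "pp ^ 1 * L \<approx>[2 + 1] pp ^ 1 * (pp * (- k))" by (rule pcong_mult_p)
    then show ?thesis by (simp add: power2_eq_square mult.assoc)
  qed
  have S1: "pp * S1 \<approx>[3] 4 / 3 * (pp\<^sup>2 * S2) + W / 6 * (pp\<^sup>2 * k)"
  proof -
    have "3 / 2 * (pp * S1) - 2 * (pp\<^sup>2 * S2)
        = (S0 + 3 / 4 * (pp * S1) + pp\<^sup>2 * (9 / 32 * S11 - 81 / 32 * S2 + T2 / 16))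
        - (S0 - 3 / 4 * (pp * S1) + pp\<^sup>2 * (9 / 32 * S11 - 17 / 32 * S2 + T2 / 16))"
      by (simp add: field_simps)
    also have "\<dots> \<approx>[3] W * texp (- 1 / 8 * L) ((- 1 / 8)\<^sup>2 * M) - W * texp (1 / 8 * L) ((1 / 8)\<^sup>2 * M)"
      by (rule pcong_diff[OF p2 p1])
    also have "\<dots> = - (W / 4) * (pp * L)" by (simp add: texp_def field_simps power2_eq_square)
    also have "\<dots> \<approx>[3] - (W / 4) * (pp\<^sup>2 * (- k))"
      using WZ by (intro pcong_scale L) simp
    finally have "2 / 3 * (3 / 2 * (pp * S1) - 2 * (pp\<^sup>2 * S2)) + 4 / 3 * (pp\<^sup>2 * S2)
        \<approx>[3] 2 / 3 * (- (W / 4) * (pp\<^sup>2 * (- k))) + 4 / 3 * (pp\<^sup>2 * S2)"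
      using u3 by (intro pcong_add pcong_scale pcong_refl) simp
    moreover have "2 / 3 * (3 / 2 * (pp * S1) - 2 * (pp\<^sup>2 * S2)) + 4 / 3 * (pp\<^sup>2 * S2) = pp * S1"
      by (simp add: field_simps)
    moreover have "2 / 3 * (- (W / 4) * (pp\<^sup>2 * (- k))) + 4 / 3 * (pp\<^sup>2 * S2)
        = 4 / 3 * (pp\<^sup>2 * S2) + W / 6 * (pp\<^sup>2 * k)" by (simp add: field_simps)
    ultimately show ?thesis by (simp only:)
  qed
  have u6: "6 \<in> Zunits" using Zunits_mult[of 2 3] u3 by simp
  have "of_nat (apery' half) \<approx>[3] S0 - pp * S1 + pp\<^sup>2 * ((S11 - 3 * S2) / 2)"
    by (rule apery_expand)
  also have "\<dots> = (S0 - pp\<^sup>2 * S2) - pp * S1 + (pp\<^sup>2 * S11 / 2 - 1 / 2 * (pp\<^sup>2 * S2))"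
    by (simp add: field_simps)
  also have "\<dots> \<approx>[3] W - (4 / 3 * (pp\<^sup>2 * S2) + W / 6 * (pp\<^sup>2 * k)) + (pp\<^sup>2 * S11 / 2 - 1 / 2 * (pp\<^sup>2 * S2))"
    by (intro pcong_add pcong_diff p0 S1 pcong_refl)
  also have "\<dots> = (W - W / 6 * (pp\<^sup>2 * k) + pp\<^sup>2 * S11 / 2) - 11 / 6 * (pp\<^sup>2 * S2)"
    by (simp add: field_simps)
  also have "\<dots> \<approx>[3] (W - W / 6 * (pp\<^sup>2 * k) + pp\<^sup>2 * S11 / 2) - 11 / 6 * (pp\<^sup>2 * (- (W * k / 8)))"
    using u6 by (intro pcong_diff pcong_scale S2 pcong_refl) simp
  also have "\<dots> = W * (1 + pp\<^sup>2 * k / 16) + pp\<^sup>2 * S11 / 2"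
    by (simp add: field_simps)
  finally show ?thesis unfolding k_def .
qed

end

section \<open>A quartic Jacobi sum modulo the cube of the prime\<close>

lemma sum_parity: "finite A \<Longrightarrow> (\<And>i. i \<in> A \<Longrightarrow> odd (f i :: int)) \<Longrightarrow> even (sum f A) \<longleftrightarrow> even (card A)"
  by (induction A rule: finite_induct) auto

context odd_prime
begin

lemma coprime_nondvd: "\<not> int p dvd a \<Longrightarrow> coprime a (int p)"
  using prime_imp_coprime[of "int p" a] prime by (simp add: coprime_commute)

lemma cong_cancel_nondvd:
  assumes "[a * b = a * c] (mod int p ^ k)" "\<not> int p dvd a"
  shows "[b = c] (mod int p ^ k)"
  using assms(1) coprime_nondvd[OF assms(2)] by (simp add: cong_mult_lcancel)

lemma fermat_int: assumes "\<not> int p dvd u" shows "[u ^ (p - 1) = 1] (mod int p)"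
proof -
  define a where "a = nat (u mod int p)"
  have a: "int a = u mod int p" using p_gt_2 by (simp add: a_def)
  have "\<not> int p dvd int a" unfolding a using assms by (simp add: dvd_mod_iff)
  then have "\<not> p dvd a" by simp
  then have "[int (a ^ (p - 1)) = int 1] (mod int p)"
    using fermat_theorem[OF prime] by (simp only: cong_int_iff)
  then show ?thesis by (simp add: a cong_def power_mod)
qed

text \<open>A primitive root modulo \<open>p\<close> raised to the power \<open>p^2\<close>; its powers represent the residue classes
  prime to \<open>p\<close>.\<close>

lemma teichmueller_root:
  obtains \<gamma> :: int where "[\<gamma> ^ (p - 1) = 1] (mod int p ^ 3)"
    "\<And>j. int p dvd \<gamma> ^ j - 1 \<longleftrightarrow> p - 1 dvd j"
proof -
  obtain g where g: "residue_primroot p g"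
    using prime_primitive_root_exists[of p] prime p_gt_2 by auto
  then have cop: "coprime p g" and ord: "ord p g = p - 1"
    using prime by (auto simp: residue_primroot_def totient_prime)
  define \<gamma> where "\<gamma> = int (g ^ p\<^sup>2)"
  have "totient (p ^ 3) = p\<^sup>2 * (p - 1)"
    using totient_prime_power[OF prime, of 3] by simp
  then have "[g ^ (p\<^sup>2 * (p - 1)) = 1] (mod p ^ 3)"
    using euler_theorem[of g "p ^ 3"] cop by (simp add: coprime_commute)
  then have "[int (g ^ (p\<^sup>2 * (p - 1))) = int 1] (mod int (p ^ 3))"
    by (simp only: cong_int_iff)
  then have 1: "[\<gamma> ^ (p - 1) = 1] (mod int p ^ 3)"
    by (simp add: \<gamma>_def power_mult)
  have 2: "int p dvd \<gamma> ^ j - 1 \<longleftrightarrow> p - 1 dvd j" for j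
  proof -
    have "int p dvd \<gamma> ^ j - 1 \<longleftrightarrow> [int (g ^ (p\<^sup>2 * j)) = int 1] (mod int p)"
      by (simp add: cong_iff_dvd_diff \<gamma>_def power_mult)
    also have "\<dots> \<longleftrightarrow> p - 1 dvd p\<^sup>2 * j"
      by (simp only: cong_int_iff ord_divides ord)
    also have "\<dots> \<longleftrightarrow> p - 1 dvd j"
    proof -
      have "coprime (p - 1) (p\<^sup>2)"
        using coprime_diff_one_left_nat[of p] p_gt_2 by simp
      then show ?thesis by (simp add: coprime_dvd_mult_right_iff)
    qed
    finally show ?thesis .
  qed
  from 1 2 show ?thesis by (rule that)
qed

lemma geometric_sum_cong:
  fixes \<gamma> :: int
  assumes "[\<gamma> ^ (p - 1) = 1] (mod int p ^ 3)" "\<And>j. int p dvd \<gamma> ^ j - 1 \<longleftrightarrow> p - 1 dvd j"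
  shows "[(\<Sum>i<p-1. \<gamma> ^ (j * i)) = (if p - 1 dvd j then int (p - 1) else 0)] (mod int p ^ 3)"
proof (cases "p - 1 dvd j")
  case True
  then obtain t where t: "j = (p - 1) * t" by blast
  have "[\<gamma> ^ (j * i) = 1] (mod int p ^ 3)" for i
    using cong_pow[OF assms(1), of "t * i"] by (simp add: t power_mult mult.assoc)
  then have "[(\<Sum>i<p-1. \<gamma> ^ (j * i)) = (\<Sum>i<p-1. 1)] (mod int p ^ 3)" by (intro cong_sum)
  then show ?thesis using True by simp
next
  case False
  have "(\<gamma> ^ j - 1) * (\<Sum>i<p-1. \<gamma> ^ (j * i)) = (\<gamma> ^ j) ^ (p - 1) - 1"
    by (simp add: power_mult power_diff_1_eq)
  also have "[(\<gamma> ^ j) ^ (p - 1) - 1 = 1 - 1] (mod int p ^ 3)"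
    using cong_pow[OF assms(1), of j] by (intro cong_diff) (simp_all add: mult.commute flip: power_mult)
  finally have "[(\<gamma> ^ j - 1) * (\<Sum>i<p-1. \<gamma> ^ (j * i)) = (\<gamma> ^ j - 1) * 0] (mod int p ^ 3)" by simp
  moreover have "\<not> int p dvd \<gamma> ^ j - 1" using False assms(2) by blast
  ultimately have "[(\<Sum>i<p-1. \<gamma> ^ (j * i)) = 0] (mod int p ^ 3)" by (rule cong_cancel_nondvd)
  then show ?thesis using False by simp
qed

text \<open>Expanding the power by the binomial theorem leaves, by orthogonality of the powers of \<open>\<gamma>\<close>, only the
  binomial coefficients in one residue class modulo \<open>p - 1\<close>.\<close>

lemma binomial_character_sum:
  fixes \<gamma> :: int
  assumes "[\<gamma> ^ (p - 1) = 1] (mod int p ^ 3)" "\<And>j. int p dvd \<gamma> ^ j - 1 \<longleftrightarrow> p - 1 dvd j"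
  shows "[(\<Sum>i<p-1. \<gamma> ^ (a * i) * (1 - \<gamma> ^ i) ^ N) =
    int (p - 1) * (\<Sum>j | j \<le> N \<and> p - 1 dvd a + j. (- 1) ^ j * int (N choose j))] (mod int p ^ 3)"
proof -
  have "(\<Sum>i<p-1. \<gamma> ^ (a * i) * (1 - \<gamma> ^ i) ^ N)
      = (\<Sum>i<p-1. \<Sum>j\<le>N. (- 1) ^ j * int (N choose j) * \<gamma> ^ ((a + j) * i))"
  proof (rule sum.cong[OF refl])
    fix i
    have "(1 - \<gamma> ^ i) ^ N = (- (\<gamma> ^ i) + 1) ^ N" by (simp add: algebra_simps)
    also have "\<dots> = (\<Sum>j\<le>N. int (N choose j) * (- (\<gamma> ^ i)) ^ j)"
      by (subst binomial_ring) simp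
    also have "\<gamma> ^ (a * i) * \<dots> = (\<Sum>j\<le>N. (- 1) ^ j * int (N choose j) * \<gamma> ^ ((a + j) * i))"
      unfolding sum_distrib_left
    proof (rule sum.cong[OF refl])
      fix j
      have "(- (\<gamma> ^ i)) ^ j = (- 1) ^ j * \<gamma> ^ (j * i)"
        by (subst power_minus) (simp add: mult.commute flip: power_mult)
      then show "\<gamma> ^ (a * i) * (int (N choose j) * (- (\<gamma> ^ i)) ^ j)
          = (- 1) ^ j * int (N choose j) * \<gamma> ^ ((a + j) * i)"
        by (simp add: power_add distrib_right)
    qed
    finally show "\<gamma> ^ (a * i) * (1 - \<gamma> ^ i) ^ N
        = (\<Sum>j\<le>N. (- 1) ^ j * int (N choose j) * \<gamma> ^ ((a + j) * i))" .
  qed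
  also have "\<dots> = (\<Sum>j\<le>N. (- 1) ^ j * int (N choose j) * (\<Sum>i<p-1. \<gamma> ^ ((a + j) * i)))"
    by (subst sum.swap) (simp only: sum_distrib_left)
  also have "[\<dots> = (\<Sum>j\<le>N. (- 1) ^ j * int (N choose j) * (if p - 1 dvd a + j then int (p - 1) else 0))]
      (mod int p ^ 3)"
    by (intro cong_sum cong_mult cong_refl geometric_sum_cong assms)
  also have "(\<Sum>j\<le>N. (- 1) ^ j * int (N choose j) * (if p - 1 dvd a + j then int (p - 1) else 0))
      = (\<Sum>j\<le>N. if p - 1 dvd a + j then int (p - 1) * ((- 1) ^ j * int (N choose j)) else 0)"
    by (intro sum.cong refl) auto
  also have "\<dots> = (\<Sum>j | j \<le> N \<and> p - 1 dvd a + j. int (p - 1) * ((- 1) ^ j * int (N choose j)))"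
    by (simp add: sum.inter_filter[symmetric])
  finally show ?thesis by (simp only: sum_distrib_left)
qed

text \<open>With \<open>y = u^(p-1) \<equiv> 1\<close>, the combination is \<open>8 u^((p-1)/2)\<close> times the expansion
  \<open>(15 - 10 y + 3 y^2) / 8\<close> of \<open>y^(-1/2)\<close> to second order around \<open>1\<close>, which is the Lagrange extrapolation
  of \<open>y^s\<close> from \<open>s = 0, 1, 2\<close> to \<open>s = -1/2\<close>.  So its square is congruent to \<open>64\<close>, and it lifts the quadratic
  character of \<open>u\<close> to a sign modulo \<open>p^3\<close>.  The linear extrapolation \<open>12 - 4 y\<close> is good enough modulo \<open>p^2\<close>.\<close>

lemma interpolated_sign:
  fixes u :: int
  assumes "\<not> int p dvd u" and m: "p - 1 = 4 * m"
  obtains e :: int where "e = 1 \<or> e = - 1"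
    "[15 * u ^ (2 * m) - 10 * u ^ (6 * m) + 3 * u ^ (10 * m) = 8 * e] (mod int p ^ 3)"
    "[15 * u ^ (2 * m) - 10 * u ^ (6 * m) + 3 * u ^ (10 * m)
      = 12 * u ^ (2 * m) - 4 * u ^ (6 * m)] (mod int p ^ 2)"
proof -
  define v where "v = u ^ (2 * m)"
  define y where "y = u ^ (4 * m)"
  have pw: "u ^ (6 * m) = v * y" "u ^ (10 * m) = v * y\<^sup>2" and vy: "v\<^sup>2 = y"
    by (simp_all add: v_def y_def flip: power_add power_mult)
  have "[y = 1] (mod int p)"
    unfolding y_def m[symmetric] by (rule fermat_int[OF assms(1)])
  then have d: "int p dvd y - 1" by (simp add: cong_iff_dvd_diff)
  define D where "D = 15 * u ^ (2 * m) - 10 * u ^ (6 * m) + 3 * u ^ (10 * m)"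
  have D: "D = v * (15 - 10 * y + 3 * y\<^sup>2)" 
    unfolding D_def pw v_def[symmetric] by (simp add: algebra_simps)
  \<comment> \<open>The vanishing to third order at \<open>y = 1\<close> reflects the accuracy of the expansion of \<open>y^(-1/2)\<close>.\<close>
  have "D\<^sup>2 - 64 = y * (15 - 10 * y + 3 * y\<^sup>2)\<^sup>2 - 64" by (simp add: D power_mult_distrib vy)
  also have "\<dots> = (y - 1) ^ 3 * (9 * y\<^sup>2 - 33 * y + 64)"
    by (simp add: algebra_simps power2_eq_square power3_eq_cube)
  finally have "(D - 8) * (D + 8) = (y - 1) ^ 3 * (9 * y\<^sup>2 - 33 * y + 64)"
    by (simp add: algebra_simps power2_eq_square)
  then have dv: "int p ^ 3 dvd (D - 8) * (D + 8)"
    using d by (metis dvd_mult2 dvd_power_same)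
  have "\<not> (int p dvd D - 8 \<and> int p dvd D + 8)"
  proof
    assume "int p dvd D - 8 \<and> int p dvd D + 8"
    then have "int p dvd (D + 8) - (D - 8)" by (metis dvd_diff)
    then have "int p dvd int (2 ^ 4)" by simp
    then show False using not_dvd_power_2[of 4] by (simp only: int_dvd_int_iff)
  qed
  then have "int p ^ 3 dvd D - 8 \<or> int p ^ 3 dvd D + 8"
  proof (cases "int p dvd D - 8")
    case True
    with \<open>\<not> (int p dvd D - 8 \<and> int p dvd D + 8)\<close> have nd: "\<not> int p dvd D + 8" by blast
    have "[(D + 8) * (D - 8) = (D + 8) * 0] (mod int p ^ 3)"
      using dv by (simp add: cong_iff_dvd_diff mult.commute)
    then have "[D - 8 = 0] (mod int p ^ 3)" using nd by (rule cong_cancel_nondvd)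
    then show ?thesis by (simp add: cong_iff_dvd_diff)
  next
    case False
    have "[(D - 8) * (D + 8) = (D - 8) * 0] (mod int p ^ 3)"
      using dv by (simp add: cong_iff_dvd_diff)
    then have "[D + 8 = 0] (mod int p ^ 3)" using False by (rule cong_cancel_nondvd)
    then show ?thesis by (simp add: cong_iff_dvd_diff)
  qed
  then have "[D = 8 * 1] (mod int p ^ 3) \<or> [D = 8 * (- 1)] (mod int p ^ 3)"
    by (auto simp: cong_iff_dvd_diff)
  moreover have "[D = 12 * u ^ (2 * m) - 4 * u ^ (6 * m)] (mod int p ^ 2)"
  proof -
    have "D - (12 * u ^ (2 * m) - 4 * u ^ (6 * m)) = 3 * v * (y - 1)\<^sup>2"
      unfolding D pw v_def[symmetric] by (simp add: algebra_simps power2_eq_square)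
    then show ?thesis using d by (simp add: cong_iff_dvd_diff dvd_power_same)
  qed
  ultimately show ?thesis using that unfolding D_def by blast
qed

lemma sum_even_odd:
  fixes f :: "nat \<Rightarrow> int"
  shows "(\<Sum>i<2*n. f i) = (\<Sum>i<n. f (2 * i)) + (\<Sum>i<n. f (2 * i + 1))"
  by (induction n) simp_all

lemma residue_class_bounded:
  fixes m j r c :: nat
  assumes "0 < m" "4 * m dvd r * m + j" "j \<le> c * m"
  obtains t where "j = (4 * t - r) * m" "r \<le> 4 * t" "4 * t \<le> c + r"
proof -
  obtain t where t: "r * m + j = 4 * m * t" using assms(2) by blast
  then have t': "r * m + j = 4 * t * m" by (simp only: ac_simps)
  then have "4 * t * m \<le> (c + r) * m" "r * m \<le> 4 * t * m"
    using assms(3) unfolding distrib_right by linarith+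
  then have le: "4 * t \<le> c + r" "r \<le> 4 * t" using assms(1) by simp_all
  have "j = (4 * t - r) * m"  using t' by (simp add: diff_mult_distrib)
  with le show ?thesis by (intro that)
qed

text \<open>The exponents \<open>j\<close> that survive in the sums over \<open>\<gamma>^(3mi)\<close> and \<open>\<gamma>^(mi)\<close>, where \<open>p - 1 = 4m\<close>.\<close>

lemma residue_classes:
  fixes m :: nat
  assumes m: "0 < m"
  shows "{j. j \<le> 2 * m \<and> 4 * m dvd 3 * m + j} = {m}"
    "{j. j \<le> 6 * m \<and> 4 * m dvd 3 * m + j} = {m, 5 * m}"
    "{j. j \<le> 10 * m \<and> 4 * m dvd 3 * m + j} = {m, 5 * m, 9 * m}"
    "{j. j \<le> 2 * m \<and> 4 * m dvd m + j} = {}"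
    "{j. j \<le> 6 * m \<and> 4 * m dvd m + j} = {3 * m}"
proof -
  have d: "4 * m dvd 3 * m + m" "4 * m dvd 3 * m + 5 * m" "4 * m dvd 3 * m + 9 * m" "4 * m dvd m + 3 * m"
    by (rule dvdI[of _ _ 1] dvdI[of _ _ 2] dvdI[of _ _ 3], simp)+
  have three: "j = m \<or> (5 \<le> c \<and> j = 5 * m) \<or> (9 \<le> c \<and> j = 9 * m)"
    if h: "j \<le> c * m" "4 * m dvd 3 * m + j" "c \<le> 10" for j c
  proof -
    obtain t where t: "j = (4 * t - 3) * m" "3 \<le> 4 * t" "4 * t \<le> c + 3"
      by (rule residue_class_bounded[OF m h(2,1)])
    then have "t = 1 \<or> t = 2 \<or> t = 3" using h(3) by auto
    then show ?thesis using t by auto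
  qed
  have one: "6 \<le> c \<and> j = 3 * m" if h: "j \<le> c * m" "4 * m dvd 1 * m + j" "c = 2 \<or> c = 6" for j c
  proof -
    obtain t where t: "j = (4 * t - 1) * m" "1 \<le> 4 * t" "4 * t \<le> c + 1"
      by (rule residue_class_bounded[OF m h(2,1)])
    then have "t = 1" using h(3) by auto
    then show ?thesis using t h(3) by auto
  qed
  show "{j. j \<le> 2 * m \<and> 4 * m dvd 3 * m + j} = {m}"
    using three[of _ 2] d by auto
  show "{j. j \<le> 6 * m \<and> 4 * m dvd 3 * m + j} = {m, 5 * m}"
    using three[of _ 6] d by auto
  show "{j. j \<le> 10 * m \<and> 4 * m dvd 3 * m + j} = {m, 5 * m, 9 * m}"
    using three[of _ 10] d by auto
  show "{j. j \<le> 2 * m \<and> 4 * m dvd m + j} = {}"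
    using one[of _ 2] by auto
  show "{j. j \<le> 6 * m \<and> 4 * m dvd m + j} = {3 * m}"
    using one[of _ 6] d by auto
qed

text \<open>The two sums run over the same signs \<open>e i\<close> with the weights \<open>\<iota>^(3i)\<close> and \<open>\<iota>^i\<close>, hence are conjugate.
  The parities come from the numbers of nonzero signs: \<open>X\<close> has \<open>2m - 1\<close> of them, since \<open>e 0 = 0\<close>, and \<open>Y\<close> has
  \<open>2m\<close>.  The same count bounds \<open>X^2 + Y^2\<close> by \<open>8m^2\<close>, which is less than \<open>p^2\<close>.  For the conjugate sum the
  exponent \<open>N = 2m\<close> contributes nothing, which makes it divisible by \<open>p\<close>.\<close>

lemma jacobi_sum:
  assumes p: "p = 4 * m + 1"
  obtains X Y J J' :: int where "odd X" "even Y" "X\<^sup>2 + Y\<^sup>2 < (int p)\<^sup>2" "J + J' = 2 * X"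
    "[J * J' = X\<^sup>2 + Y\<^sup>2] (mod int p ^ 3)"
    "[8 * J = int (p - 1) * ((- 1) ^ m * int (15 * ((2 * m) choose m) + 6 * ((10 * m) choose m) + 3 * ((10 * m) choose (5 * m)))
        - (- 1) ^ m * int (20 * ((6 * m) choose m)))] (mod int p ^ 3)"
    "[8 * J' = int (p - 1) * (- 4 * ((- 1) ^ m * int ((6 * m) choose (3 * m))))] (mod int p ^ 2)"
proof -
  have m: "0 < m" "p - 1 = 4 * m" using p p_gt_2 by auto
  obtain \<gamma> :: int where \<gamma>: "[\<gamma> ^ (p - 1) = 1] (mod int p ^ 3)"
      "\<And>j. int p dvd \<gamma> ^ j - 1 \<longleftrightarrow> p - 1 dvd j"
    using teichmueller_root by blast
  define D where "D i = 15 * (1 - \<gamma> ^ i) ^ (2 * m) - 10 * (1 - \<gamma> ^ i) ^ (6 * m) + 3 * (1 - \<gamma> ^ i) ^ (10 * m)" for i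
  have "\<exists>e. (i = 0 \<longrightarrow> e = 0) \<and> (i \<noteq> 0 \<longrightarrow> e = 1 \<or> e = - 1) \<and> [D i = 8 * e] (mod int p ^ 3) \<and>
      [D i = 12 * (1 - \<gamma> ^ i) ^ (2 * m) - 4 * (1 - \<gamma> ^ i) ^ (6 * m)] (mod int p ^ 2)"
    if "i < 4 * m" for i
  proof (cases "i = 0")
    case True
    then show ?thesis using m(1) by (intro exI[of _ 0]) (simp add: D_def zero_power)
  next
    case False
    then have "\<not> p - 1 dvd i" using that m(2) by (auto dest: dvd_imp_le)
    then have "\<not> int p dvd 1 - \<gamma> ^ i" using \<gamma>(2)[of i] by (simp add: dvd_diff_commute)
    from interpolated_sign[OF this m(2)] False show ?thesis unfolding D_def by metis
  qed
  then obtain e where e: "e 0 = 0" "\<And>i. i < 4 * m \<Longrightarrow> i \<noteq> 0 \<Longrightarrow> e i = 1 \<or> e i = - 1"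
    and De: "\<And>i. i < 4 * m \<Longrightarrow> [D i = 8 * e i] (mod int p ^ 3)"
    and D2: "\<And>i. i < 4 * m \<Longrightarrow> [D i = 12 * (1 - \<gamma> ^ i) ^ (2 * m) - 4 * (1 - \<gamma> ^ i) ^ (6 * m)] (mod int p ^ 2)"
    using m(1) by (metis mult_pos_pos zero_less_numeral)
  define \<iota> where "\<iota> = \<gamma> ^ m"
  have \<iota>: "[\<iota>\<^sup>2 = - 1] (mod int p ^ 3)"
  proof -
    have "(\<iota>\<^sup>2 - 1) * (\<iota>\<^sup>2 - (- 1)) = \<gamma> ^ (p - 1) - 1"
      unfolding \<iota>_def m(2) by (simp add: algebra_simps flip: power_mult power_add)
    also have "[\<gamma> ^ (p - 1) - 1 = 1 - 1] (mod int p ^ 3)" by (intro cong_diff \<gamma> cong_refl)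
    finally have "[(\<iota>\<^sup>2 - 1) * (\<iota>\<^sup>2 - (- 1)) = (\<iota>\<^sup>2 - 1) * 0] (mod int p ^ 3)" by simp
    moreover have "\<not> int p dvd \<iota>\<^sup>2 - 1"
    proof -
      have "\<not> p - 1 dvd m * 2" using m by (auto dest: dvd_imp_le)
      then show ?thesis unfolding \<iota>_def using \<gamma>(2)[of "m * 2"] by (simp add: power_mult)
    qed
    ultimately have "[\<iota>\<^sup>2 - (- 1) = 0] (mod int p ^ 3)" by (rule cong_cancel_nondvd)
    then show ?thesis by (simp only: cong_iff_dvd_diff diff_zero)
  qed
  define X where "X = (\<Sum>i<2*m. (- 1) ^ i * e (2 * i))"
  define Y where "Y = (\<Sum>i<2*m. (- 1) ^ i * e (2 * i + 1))"
  have oe: "odd (e i)" "\<bar>e i\<bar> = 1" if "i < 4 * m" "i \<noteq> 0" for i using e(2)[OF that] by auto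
  have X': "X = (\<Sum>i\<in>{0<..<2*m}. (- 1) ^ i * e (2 * i))"
    unfolding X_def using e(1) by (intro sum.mono_neutral_right) auto
  have "odd X" unfolding X' using m(1) oe by (subst sum_parity) auto
  have "even Y" unfolding Y_def using m(1) oe by (subst sum_parity) auto
  have "\<bar>X\<bar> \<le> (\<Sum>i\<in>{0<..<2*m}. 1)"
    unfolding X' using oe by (intro order.trans[OF sum_abs] sum_mono) (auto simp: abs_mult)
  then have "\<bar>X\<bar> \<le> \<bar>2 * int m\<bar>" using m(1) by simp
  then have "X\<^sup>2 \<le> (2 * int m)\<^sup>2" by (simp only: abs_le_square_iff)
  have "\<bar>Y\<bar> \<le> (\<Sum>i<2*m. 1)"
    unfolding Y_def using oe by (intro order.trans[OF sum_abs] sum_mono) (auto simp: abs_mult)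
  then have "\<bar>Y\<bar> \<le> \<bar>2 * int m\<bar>" using m(1) by simp
  then have "Y\<^sup>2 \<le> (2 * int m)\<^sup>2" by (simp only: abs_le_square_iff)
  have lt: "X\<^sup>2 + Y\<^sup>2 < (int p)\<^sup>2"
  proof -
    have "X\<^sup>2 + Y\<^sup>2 \<le> 2 * (2 * int m)\<^sup>2" using \<open>X\<^sup>2 \<le> _\<close> \<open>Y\<^sup>2 \<le> _\<close> by linarith
    also have "\<dots> < (4 * int m + 1)\<^sup>2" using m(1) by (simp add: power2_eq_square algebra_simps add_pos_nonneg)
    finally show ?thesis by (simp add: p add.commute)
  qed
  define J where "J = X - \<iota> * Y"
  define J' where "J' = X + \<iota> * Y"
  have JJ: "[J * J' = X\<^sup>2 + Y\<^sup>2] (mod int p ^ 3)"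
  proof -
    have "J * J' = X\<^sup>2 - \<iota>\<^sup>2 * Y\<^sup>2" by (simp add: J_def J'_def algebra_simps power2_eq_square)
    also have "[\<dots> = X\<^sup>2 - (- 1) * Y\<^sup>2] (mod int p ^ 3)" by (intro cong_diff cong_mult \<iota> cong_refl)
    finally show ?thesis by simp
  qed
  have \<iota>_even: "[\<iota> ^ (2 * i) = (- 1) ^ i] (mod int p ^ 3)" for i
    using cong_pow[OF \<iota>, of i] by (simp add: power_mult)
  \<comment> \<open>The odd exponent \<open>c = 2b + 1\<close> is \<open>1\<close> or \<open>3\<close> and decides between \<open>J'\<close> and \<open>J\<close>.\<close>
  have char: "[(\<Sum>i<p-1. \<gamma> ^ (c * m * i) * D i) = 8 * (X + s * \<iota> * Y)] (mod int p ^ 3)"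
    if c: "c = 2 * b + 1" "s = (- 1) ^ b" "odd c" for b c and s :: int
  proof -
    have "(\<Sum>i<p-1. \<gamma> ^ (c * m * i) * D i) = (\<Sum>i<2*(2*m). \<iota> ^ (c * i) * D i)"
      unfolding m(2) by (simp add: \<iota>_def mult.assoc mult.left_commute flip: power_mult)
    also have "[\<dots> = (\<Sum>i<2*(2*m). \<iota> ^ (c * i) * (8 * e i))] (mod int p ^ 3)"
      using De by (intro cong_sum cong_mult cong_refl) auto
    also have "(\<Sum>i<2*(2*m). \<iota> ^ (c * i) * (8 * e i)) =
        (\<Sum>i<2*m. \<iota> ^ (2 * (c * i)) * (8 * e (2 * i)))
        + (\<Sum>i<2*m. \<iota> ^ (2 * (c * i)) * \<iota> ^ (2 * b) * \<iota> * (8 * e (2 * i + 1)))"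
      unfolding sum_even_odd by (simp add: c(1) algebra_simps flip: power_add power_Suc)
    also have "[\<dots> = (\<Sum>i<2*m. (- 1) ^ (c * i) * (8 * e (2 * i)))
        + (\<Sum>i<2*m. (- 1) ^ (c * i) * s * \<iota> * (8 * e (2 * i + 1)))] (mod int p ^ 3)"
      unfolding c(2) by (intro cong_add cong_sum cong_mult \<iota>_even cong_refl)
    also have "(\<Sum>i<2*m. (- 1) ^ (c * i) * (8 * e (2 * i)))
        + (\<Sum>i<2*m. (- 1) ^ (c * i) * s * \<iota> * (8 * e (2 * i + 1))) = 8 * (X + s * \<iota> * Y)"
    proof -
      have "(- 1 :: int) ^ (c * i) = (- 1) ^ i" for i using c(3) by (simp add: power_mult)
      then show ?thesis
        by (simp add: X_def Y_def sum_distrib_left distrib_left mult.assoc mult.left_commute)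
    qed
    finally show ?thesis .
  qed
  let ?S = "\<lambda>a N. (\<Sum>i<p-1. \<gamma> ^ (a * i) * (1 - \<gamma> ^ i) ^ N)"
  note bin = binomial_character_sum[OF \<gamma>]
  have sgn: "(- 1 :: int) ^ (5 * m) = (- 1) ^ m" "(- 1 :: int) ^ (9 * m) = (- 1) ^ m"
      "(- 1 :: int) ^ (3 * m) = (- 1) ^ m"
    by (simp_all add: power_mult)
  have sym: "(6 * m) choose (5 * m) = (6 * m) choose m" "(10 * m) choose (9 * m) = (10 * m) choose m"
    using binomial_symmetric[of "5 * m" "6 * m"] binomial_symmetric[of "9 * m" "10 * m"] by simp_all
  have sums: "(\<Sum>j\<in>{m}. (- 1) ^ j * int ((2 * m) choose j)) = (- 1) ^ m * int ((2 * m) choose m)"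
    "(\<Sum>j\<in>{m, 5 * m}. (- 1) ^ j * int ((6 * m) choose j)) = (- 1) ^ m * (2 * int ((6 * m) choose m))"
    "(\<Sum>j\<in>{m, 5 * m, 9 * m}. (- 1) ^ j * int ((10 * m) choose j))
      = (- 1) ^ m * (2 * int ((10 * m) choose m) + int ((10 * m) choose (5 * m)))"
    using m(1) by (simp_all add: sgn sym distrib_left)
  have "[8 * J = (\<Sum>i<p-1. \<gamma> ^ (3 * m * i) * D i)] (mod int p ^ 3)"
    using char[of 3 1 "- 1"] by (simp add: J_def cong_sym)
  also have "(\<Sum>i<p-1. \<gamma> ^ (3 * m * i) * D i) = 15 * ?S (3 * m) (2 * m) - 10 * ?S (3 * m) (6 * m) + 3 * ?S (3 * m) (10 * m)"
    by (simp add: D_def sum_distrib_left sum.distrib sum_subtractf algebra_simps)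
  also have "[\<dots> = 15 * (int (p - 1) * ((- 1) ^ m * int ((2 * m) choose m)))
      - 10 * (int (p - 1) * ((- 1) ^ m * (2 * int ((6 * m) choose m))))
      + 3 * (int (p - 1) * ((- 1) ^ m * (2 * int ((10 * m) choose m) + int ((10 * m) choose (5 * m)))))] (mod int p ^ 3)"
    using bin[of "3 * m" "2 * m"] bin[of "3 * m" "6 * m"] bin[of "3 * m" "10 * m"]
    unfolding m(2) residue_classes[OF m(1)] sums
    by (intro cong_add cong_diff cong_mult[OF cong_refl])
  finally have J8: "[8 * J = int (p - 1) * ((- 1) ^ m * int (15 * ((2 * m) choose m) + 6 * ((10 * m) choose m) + 3 * ((10 * m) choose (5 * m)))
        - (- 1) ^ m * int (20 * ((6 * m) choose m)))] (mod int p ^ 3)"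
    by (simp add: algebra_simps)
  have mono: "[a = b] (mod int p ^ 2)" if "[a = b] (mod int p ^ 3)" for a b
    using that by (rule cong_dvd_modulus) (simp add: le_imp_power_dvd)
  have "[8 * J' = (\<Sum>i<p-1. \<gamma> ^ (m * i) * D i)] (mod int p ^ 2)"
    using char[of 1 0 1] by (intro mono) (simp add: J'_def cong_sym)
  also have "[(\<Sum>i<p-1. \<gamma> ^ (m * i) * D i) = (\<Sum>i<p-1. \<gamma> ^ (m * i) *
      (12 * (1 - \<gamma> ^ i) ^ (2 * m) - 4 * (1 - \<gamma> ^ i) ^ (6 * m)))] (mod int p ^ 2)"
    using D2 m(2) by (intro cong_sum cong_mult cong_refl) auto
  also have "(\<Sum>i<p-1. \<gamma> ^ (m * i) * (12 * (1 - \<gamma> ^ i) ^ (2 * m) - 4 * (1 - \<gamma> ^ i) ^ (6 * m)))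
      = 12 * ?S m (2 * m) - 4 * ?S m (6 * m)"
    by (simp add: sum_distrib_left sum_subtractf algebra_simps)
  also have "[\<dots> = 12 * 0 - 4 * (int (p - 1) * ((- 1) ^ m * int ((6 * m) choose (3 * m))))] (mod int p ^ 2)"
    using bin[of m "2 * m"] bin[of m "6 * m"]
    unfolding m(2) residue_classes[OF m(1)]
    by (intro cong_diff cong_mult[OF cong_refl] mono) (simp_all add: sgn)
  finally have J8': "[8 * J' = int (p - 1) * (- 4 * ((- 1) ^ m * int ((6 * m) choose (3 * m))))] (mod int p ^ 2)"
    by (simp add: algebra_simps)
  show ?thesis
    by (rule that[OF \<open>odd X\<close> \<open>even Y\<close> lt _ JJ J8 J8']) (simp add: J_def J'_def)
qed

end

section \<open>The binomial coefficients in the Jacobi sum\<close>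

locale prime_1_mod_4 = odd_prime +
  fixes m :: nat
  assumes p_eq: "p = 4 * m + 1"
begin

lemma half_m: "half = 2 * m" and m_pos: "0 < m" and p_not_3: "p \<noteq> 3"
  and pp_m: "of_nat m = (pp - 1) / 4" and bounds: "m \<le> half" "m < p" "2 * m < p" "2 * m \<le> half"
  using p_eq p_half p_gt_2 by (auto, arith?)

text \<open>The names stand for the central binomial coefficient, a harmonic number up to \<open>(p - 1) / 2\<close> and the
  second-order harmonic number up to \<open>(p - 1) / 4\<close>.  All other harmonic sums that occur are congruent to
  combinations of \<open>H\<close> and \<open>K\<close>.\<close>

definition C :: rat where "C = of_nat ((2 * m) choose m)"

definition H :: rat where "H = harm 1 half"

definition K :: rat where "K = harm 2 m"

lemma Zp_HK [simp]: "H \<in> Zp" "K \<in> Zp" "C \<in> Zp"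
  using bounds by (simp_all add: H_def K_def C_def)

lemma small_units [simp]:
  "3 * pp - 1 \<in> Zunits" "5 * pp - 1 \<in> Zunits" "5 * pp - 3 \<in> Zunits" "3 \<in> Zunits" "9 \<in> Zunits" "27 \<in> Zunits"
proof -
  show 3: "3 \<in> Zunits" by (rule three_unit[OF p_not_3])
  show "9 \<in> Zunits" using Zunits_mult[OF 3 3] by simp
  then show "27 \<in> Zunits" using Zunits_mult[OF 3, of 9] by simp
  show "3 * pp - 1 \<in> Zunits" by (rule Zunits_pcong[of _ 1 "- 1"], rule pcongI[of 3]) simp_all
  show "5 * pp - 1 \<in> Zunits" by (rule Zunits_pcong[of _ 1 "- 1"], rule pcongI[of 5]) simp_all
  show "5 * pp - 3 \<in> Zunits" by (rule Zunits_pcong[of _ 1 "- 3"], rule pcongI[of 5]) (simp_all add: 3)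
qed

lemma harm_diff_half: "H - harm 1 m \<approx>[2] - H / 2 + pp * (K / 4)"
proof -
  have "H - harm 1 m = (3 * harm 1 half - 2 * harm 1 m) / 2 - H / 2"
    by (simp add: H_def field_simps)
  also have "\<dots> \<approx>[2] (pp * (harm 2 m / 2)) / 2 - H / 2"
    using bounds by (intro pcong_diff pcong_divide harm_relation_1[OF half_m p_not_3]) simp_all
  finally show ?thesis by (simp add: K_def algebra_simps)
qed

text \<open>The product over \<open>m < j \<le> 2m\<close> is the quotient of two products over initial segments; the term
  \<open>p K / 4\<close> in \<open>harm_diff_half\<close> is moved to second order.\<close>

lemma upper_prod:
  assumes a: "a \<in> Zp"
  shows "(\<Prod>i<m. 1 + a * pp / (of_nat (m + i) + 1)) \<approx>[3] texp (- a * H / 2) (- (a\<^sup>2 + a / 2) * K)"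
proof -
  let ?f = "\<lambda>j. 1 + a * pp / (of_nat j + 1)"
  have u: "texp (a * harm 1 m) (a\<^sup>2 * harm 2 m) \<in> Zunits" using a bounds by simp
  have low: "(\<Prod>j<m. ?f j) \<approx>[3] texp (a * harm 1 m) (a\<^sup>2 * harm 2 m)"
    using a bounds by (intro prod_Suc_texp) auto
  have lu: "(\<Prod>j<m. ?f j) \<in> Zunits" by (rule Zunits_pcong[OF low u]) simp
  have "(\<Prod>j<2*m. ?f j) = (\<Prod>j<m. ?f j) * (\<Prod>i<m. ?f (m + i))"
    using prod_lessThan_add[of ?f m m] by (simp add: mult_2)
  then have "(\<Prod>i<m. ?f (m + i)) = (\<Prod>j<2*m. ?f j) / (\<Prod>j<m. ?f j)"
    using Zunits_nonzero[OF lu] by simp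
  also have "\<dots> \<approx>[3] texp (a * harm 1 (2 * m)) (a\<^sup>2 * harm 2 (2 * m)) / texp (a * harm 1 m) (a\<^sup>2 * harm 2 m)"
    using a bounds half_m by (intro pcong_divide[OF _ low _ lu u] prod_Suc_texp) simp_all
  also have "\<dots> \<approx>[3] texp (a * harm 1 (2 * m) - a * harm 1 m) (a\<^sup>2 * harm 2 (2 * m) - a\<^sup>2 * harm 2 m)"
    using a bounds by (intro texp_divide) simp_all
  also have "\<dots> \<approx>[3] texp (a * (- H / 2 + pp * (K / 4))) (a\<^sup>2 * 0 - a\<^sup>2 * K)"
  proof (rule texp_cong)
    show "a * harm 1 (2 * m) - a * harm 1 m \<approx>[2] a * (- H / 2 + pp * (K / 4))"
      using pcong_scale[OF a harm_diff_half] half_m by (simp add: H_def right_diff_distrib)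
    show "a\<^sup>2 * harm 2 (2 * m) - a\<^sup>2 * harm 2 m \<approx>[1] a\<^sup>2 * 0 - a\<^sup>2 * K"
      unfolding K_def using a harm2_half[OF p_not_3] half_m by (intro pcong_diff pcong_scale) simp_all
  qed (use a in simp_all)
  also have "\<dots> = texp (- a * H / 2 + pp * (a * K / 4)) (a\<^sup>2 * 0 - a\<^sup>2 * K)"
    by (simp add: algebra_simps)
  also have "\<dots> \<approx>[3] texp (- a * H / 2) (a\<^sup>2 * 0 - a\<^sup>2 * K - 2 * (a * K / 4))"
    using a by (intro texp_shift) simp_all
  also have "a\<^sup>2 * 0 - a\<^sup>2 * K - 2 * (a * K / 4) = - (a\<^sup>2 + a / 2) * K"
    by (simp add: algebra_simps)
  finally show ?thesis .
qed

lemma binomial_shift_prod: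
  "of_nat ((a * p + 2 * m) choose m) = C * (\<Prod>i<m. 1 + of_nat a * pp / (of_nat (m + i) + 1))"
proof -
  have gen: "of_nat ((N + 2 * m) choose m) = (\<Prod>i<m. of_nat N + of_nat (m + i) + 1) / (\<Prod>i<m. of_nat i + 1 :: rat)" for N
  proof -
    have "(\<Prod>j<m. of_nat (N + 2 * m) - of_nat j :: rat) = (\<Prod>i<m. of_nat N + of_nat (m + i) + 1)"
      by (subst prod.nat_diff_reindex[symmetric]) (auto intro!: prod.cong simp: of_nat_diff)
    then show ?thesis unfolding binomial_prod prod_dividef by simp
  qed
  have *: "(of_nat (a * p) + of_nat (m + i) + 1 :: rat) = (of_nat 0 + of_nat (m + i) + 1) * (1 + of_nat a * pp / (of_nat (m + i) + 1))" for i
    using odd_nonzero(2)[of "m + i"] by (simp add: field_simps)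
  have "of_nat ((a * p + 2 * m) choose m) = of_nat ((0 + 2 * m) choose m) *
      (\<Prod>i<m. 1 + of_nat a * pp / (of_nat (m + i) + 1))"
    unfolding gen * prod.distrib by simp
  then show ?thesis by (simp add: C_def)
qed

text \<open>As \<open>6m = p + 2m - 1\<close>, this coefficient differs from \<open>binom(p + 2m, m)\<close> by a rational factor.  The same
  happens for the two coefficients with upper entry \<open>10m = 2p + 2m - 2\<close>, where \<open>5m = p + m - 1\<close>.\<close>

lemma binomial_6m_m:
  "of_nat ((6 * m) choose m) \<approx>[3] C / 2 * ((5 * pp - 1) / (3 * pp - 1) * texp (- H / 2) (- (3 / 2) * K))"
proof -
  let ?P = "\<Prod>i<m. 1 + of_nat 1 * pp / (of_nat (m + i) + 1)"
  have "((1 * p + 2 * m) - m) * ((1 * p + 2 * m) choose m) = (1 * p + 2 * m) * ((6 * m) choose m)"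
    using binomial_absorb_comp[of "1 * p + 2 * m" m] by (simp add: p_eq)
  then have "of_nat (((1 * p + 2 * m) - m) * ((1 * p + 2 * m) choose m)) = (of_nat ((1 * p + 2 * m) * ((6 * m) choose m)) :: rat)"
    by (simp only:)
  then have eq: "(pp + of_nat m) * (C * ?P) = (pp + 2 * of_nat m) * of_nat ((6 * m) choose m)"
    using binomial_shift_prod[of 1] by (simp add: add.commute)
  have "of_nat ((6 * m) choose m) = C / 2 * ((5 * pp - 1) / (3 * pp - 1) * ?P)"
  proof -
    have "3 * pp - 1 \<noteq> 0" using small_units(1) by blast
    moreover have "(5 * pp - 1) / 4 * (C * ?P) = (3 * pp - 1) / 2 * of_nat ((6 * m) choose m)"
      using eq unfolding pp_m by (simp add: field_simps)
    ultimately show ?thesis by (simp add: field_simps)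
  qed
  also have "\<dots> \<approx>[3] C / 2 * ((5 * pp - 1) / (3 * pp - 1) * texp (- H / 2) (- (3 / 2) * K))"
    using upper_prod[of 1] by (intro pcong_scale) simp_all
  finally show ?thesis .
qed

lemma binomial_10m_m:
  "of_nat ((10 * m) choose m) \<approx>[3] C / 4 * ((9 * pp - 1) * (9 * pp - 5) / ((5 * pp - 1) * (5 * pp - 3)) * texp (- H) (- 5 * K))"
proof -
  let ?P = "\<Prod>i<m. 1 + of_nat 2 * pp / (of_nat (m + i) + 1)"
  have "((2 * p + 2 * m) - m) * ((2 * p + 2 * m) choose m) = (2 * p + 2 * m) * ((10 * m + 1) choose m)"
    using binomial_absorb_comp[of "2 * p + 2 * m" m] by (simp add: p_eq)
  then have "of_nat (((2 * p + 2 * m) - m) * ((2 * p + 2 * m) choose m)) = (of_nat ((2 * p + 2 * m) * ((10 * m + 1) choose m)) :: rat)"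
    by (simp only:)
  then have eq1: "(2 * pp + of_nat m) * (C * ?P) = (2 * pp + 2 * of_nat m) * of_nat ((10 * m + 1) choose m)"
    using binomial_shift_prod[of 2] by (simp add: add.commute)
  have "(9 * m + 1) * ((10 * m + 1) choose m) = (10 * m + 1) * ((10 * m) choose m)"
    using binomial_absorb_comp[of "10 * m + 1" m] by simp
  then have "of_nat ((9 * m + 1) * ((10 * m + 1) choose m)) = (of_nat ((10 * m + 1) * ((10 * m) choose m)) :: rat)"
    by (simp only:)
  then have eq2: "(9 * of_nat m + 1) * of_nat ((10 * m + 1) choose m) = (10 * of_nat m + 1) * (of_nat ((10 * m) choose m) :: rat)"
    by (simp add: algebra_simps)
  have nz: "5 * pp - 1 \<noteq> 0" "5 * pp - 3 \<noteq> 0" using small_units(2,3) by blast+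
  have 1: "of_nat ((10 * m + 1) choose m) = (9 * pp - 1) / (5 * pp - 1) / 2 * (C * ?P)"
  proof -
    have "(9 * pp - 1) / 4 * (C * ?P) = (5 * pp - 1) / 2 * of_nat ((10 * m + 1) choose m)"
      using eq1 unfolding pp_m by (simp add: field_simps)
    then show ?thesis using nz by (simp add: field_simps)
  qed
  have 2: "of_nat ((10 * m) choose m) = (9 * pp - 5) / (5 * pp - 3) / 2 * of_nat ((10 * m + 1) choose m)"
  proof -
    have "(9 * pp - 5) / 4 * of_nat ((10 * m + 1) choose m) = (5 * pp - 3) / 2 * of_nat ((10 * m) choose m)"
      using eq2 unfolding pp_m by (simp add: field_simps)
    then show ?thesis using nz by (simp add: field_simps)
  qed
  have gen: "b / d / 2 * (a / c / 2 * (C * P)) = C / 4 * (a * b / (c * d) * P)" for a b c d P :: rat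
    by (simp add: ac_simps)
  have "of_nat ((10 * m) choose m) = C / 4 * ((9 * pp - 1) * (9 * pp - 5) / ((5 * pp - 1) * (5 * pp - 3)) * ?P)"
    unfolding 2 1 gen ..
  also have "\<dots> \<approx>[3] C / 4 * ((9 * pp - 1) * (9 * pp - 5) / ((5 * pp - 1) * (5 * pp - 3)) * texp (- H) (- 5 * K))"
    using upper_prod[of 2] by (intro pcong_scale) simp_all
  finally show ?thesis .
qed

lemma binomial_2p_p: "of_nat ((2 * p) choose p) \<approx>[3] 2"
proof -
  have "fact (p + p) = fact p * fact p * (\<Prod>j<p. 1 + pp / (of_nat j + 1))"
    by (rule fact_add_prod)
  then have "of_nat ((2 * p) choose p) = (\<Prod>j<p. 1 + pp / (of_nat j + 1))"
    by (subst binomial_fact) (simp_all add: mult_2)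
  also have "\<dots> = (\<Prod>j<Suc (2 * half). 1 + 1 * pp / (of_nat j + 1))"
  proof -
    have "{..<p} = {..<Suc (2 * half)}" using p_half by simp
    then show ?thesis by (simp only: mult_1)
  qed
  also have "\<dots> = 2 * (\<Prod>j<2 * half. 1 + 1 * pp / (of_nat j + 1))"
    using pp_half by simp
  also have "\<dots> \<approx>[3] 2 * texp (1 * harm 1 (2 * half)) (1\<^sup>2 * harm 2 (2 * half))"
    using p_half by (intro pcong_scale prod_Suc_texp) simp_all
  also have "\<dots> \<approx>[3] 2 * texp 0 0"
    using harm_full[OF p_not_3] by (intro pcong_scale texp_cong) simp_all
  finally show ?thesis by (simp add: texp_def)
qed

lemma binomial_10m_5m:
  "of_nat ((10 * m) choose (5 * m)) \<approx>[3] C / 2 * ((5 * pp - 1) / (5 * pp - 3) * texp (- H) (- 3 * K))"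
proof -
  let ?N = "\<Prod>j<2*m. 1 + 2 * pp / (of_nat j + 1)"
  let ?D = "\<Prod>j<m. 1 + 1 * pp / (of_nat j + 1)"
  have u: "texp (1 * harm 1 m) (1\<^sup>2 * harm 2 m) \<in> Zunits" using bounds by simp
  have low: "?D \<approx>[3] texp (1 * harm 1 m) (1\<^sup>2 * harm 2 m)"
    using bounds by (intro prod_Suc_texp) auto
  have lu: "?D \<in> Zunits" by (rule Zunits_pcong[OF low u]) simp
  have f1: "fact (2 * p + 2 * m) = (fact (2 * p) * fact (2 * m) * ?N :: rat)"
    using fact_add_prod[of "2 * p" "2 * m"] by simp
  have f2: "fact (p + m) = (fact p * fact m * ?D :: rat)"
    using fact_add_prod[of p m] by simp
  have "of_nat ((2 * (p + m)) choose (p + m)) = (fact (2 * p + 2 * m) / (fact (p + m) * fact (p + m)) :: rat)"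
    by (subst binomial_fact) (simp_all add: mult_2 algebra_simps)
  also have "\<dots> = (fact (2 * p) / (fact p * fact p)) * (fact (2 * m) / (fact m * fact m)) * (?N / ?D\<^sup>2)"
    unfolding f1 f2 by (simp add: power2_eq_square ac_simps)
  also have "fact (2 * p) / (fact p * fact p) = (of_nat ((2 * p) choose p) :: rat)"
    by (subst binomial_fact) simp_all
  also have "fact (2 * m) / (fact m * fact m) = C"
    unfolding C_def by (subst binomial_fact) simp_all
  finally have big: "of_nat ((2 * (p + m)) choose (p + m)) = of_nat ((2 * p) choose p) * C * (?N / ?D\<^sup>2)" .
  have D2: "?D\<^sup>2 \<approx>[3] texp (harm 1 m + harm 1 m) (harm 2 m + harm 2 m)"
    using pcong_mult[OF low low] texp_mult[of "harm 1 m" "harm 2 m" "harm 1 m" "harm 2 m"] bounds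
    by (auto simp: power2_eq_square intro: pcong_trans)
  have u2: "texp (harm 1 m + harm 1 m) (harm 2 m + harm 2 m) \<in> Zunits" using bounds by simp
  have "?N / ?D\<^sup>2 \<approx>[3] texp (2 * harm 1 (2 * m)) (2\<^sup>2 * harm 2 (2 * m)) / texp (harm 1 m + harm 1 m) (harm 2 m + harm 2 m)"
    using bounds lu u2 by (intro pcong_divide[OF _ D2] prod_Suc_texp) simp_all
  also have "\<dots> \<approx>[3] texp (2 * harm 1 (2 * m) - (harm 1 m + harm 1 m)) (2\<^sup>2 * harm 2 (2 * m) - (harm 2 m + harm 2 m))"
    using bounds by (intro texp_divide) simp_all
  also have "\<dots> \<approx>[3] texp (2 * (- H / 2 + pp * (K / 4))) (2\<^sup>2 * 0 - (K + K))"
  proof (rule texp_cong)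
    show "2 * harm 1 (2 * m) - (harm 1 m + harm 1 m) \<approx>[2] 2 * (- H / 2 + pp * (K / 4))"
      using pcong_scale[OF _ harm_diff_half, of 2] half_m by (simp add: H_def right_diff_distrib)
    show "2\<^sup>2 * harm 2 (2 * m) - (harm 2 m + harm 2 m) \<approx>[1] 2\<^sup>2 * 0 - (K + K)"
      unfolding K_def using harm2_half[OF p_not_3] half_m by (intro pcong_diff pcong_scale) simp_all
  qed simp_all
  also have "\<dots> = texp (- H + pp * (K / 2)) (- (K + K))" by (simp add: algebra_simps)
  also have "\<dots> \<approx>[3] texp (- H) (- (K + K) - 2 * (K / 2))" by (intro texp_shift) simp_all
  also have "\<dots> = texp (- H) (- 3 * K)" by simp
  finally have Q: "?N / ?D\<^sup>2 \<approx>[3] texp (- H) (- 3 * K)" .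
  have "2 * (p + m) = 2 * Suc (5 * m)" "p + m = Suc (5 * m)" using p_eq by simp_all
  then have big': "of_nat ((2 * (p + m)) choose (p + m)) = (of_nat ((2 * Suc (5 * m)) choose Suc (5 * m)) :: rat)"
    by (simp only:)
  have cb: "of_nat ((2 * k) choose k) = 4 ^ k * (\<Prod>j<k. (2 * of_nat j + 1) / (2 * (of_nat j + 1)) :: rat)" for k
    using central_binomial_prod[of k, where 'a = rat] by (simp add: field_simps)
  have gen0: "4 * F * (P * (x / (2 * y))) = F * P * (2 * x / y)" for F P x y :: rat
    by simp
  have "of_nat ((2 * Suc (5 * m)) choose Suc (5 * m)) =
      (of_nat ((2 * (5 * m)) choose (5 * m)) :: rat) * (2 * (2 * (5 * of_nat m) + 1) / (5 * of_nat m + 1))"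
    by (simp only: cb power_Suc prod.lessThan_Suc of_nat_mult of_nat_numeral gen0)
  also have "\<dots> = of_nat ((10 * m) choose (5 * m)) * (4 * (5 * pp - 3) / (5 * pp - 1))"
  proof -
    have e: "5 * of_nat m + 1 = (5 * pp - 1) / 4" "2 * (5 * of_nat m) + 1 = (5 * pp - 3) / (2 :: rat)"
      unfolding pp_m by (simp_all add: field_simps)
    have "2 * (y / 2) / (x / 4) = 4 * y / x" for x y :: rat by simp
    then have "2 * (2 * (5 * of_nat m) + 1) / (5 * of_nat m + 1) = 4 * (5 * pp - 3) / (5 * pp - 1)"
      unfolding e .
    moreover have "2 * (5 * m) = 10 * m" by simp
    ultimately show ?thesis by (simp only:)
  qed
  finally have central: "of_nat ((2 * Suc (5 * m)) choose Suc (5 * m))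
    = of_nat ((10 * m) choose (5 * m)) * (4 * (5 * pp - 3) / (5 * pp - 1))" .
  have gen: "x / y / 4 * (X * C * Y) = C / 4 * (x / y) * (X * Y)" for x y X Y :: rat
    by (simp add: ac_simps)
  have gen2: "C / 4 * x * (2 * y) = C / 2 * (x * y)" for x y :: rat
    by simp
  have gen': "B = x / y / 4 * (B * (4 * y / x))" if "x \<noteq> 0" "y \<noteq> 0" for x y B :: rat
    using that by simp
  have "of_nat ((10 * m) choose (5 * m)) = (5 * pp - 1) / (5 * pp - 3) / 4 * of_nat ((2 * (p + m)) choose (p + m))"
    unfolding big' central by (rule gen'[OF small_units(2,3)[THEN Zunits_nonzero]])
  also have "\<dots> = C / 4 * ((5 * pp - 1) / (5 * pp - 3)) * (of_nat ((2 * p) choose p) * (?N / ?D\<^sup>2))"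
    unfolding big gen ..
  also have "\<dots> \<approx>[3] C / 4 * ((5 * pp - 1) / (5 * pp - 3)) * (2 * texp (- H) (- 3 * K))"
    by (rule pcong_scale[OF Zp_mult[OF Zp_divide[OF Zp_HK(3) Zunits_num(3)]
          Zp_divide[OF Zunits_Zp[OF small_units(2)] small_units(3)]] pcong_mult[OF binomial_2p_p Q]]) simp_all
  also have "\<dots> = C / 2 * ((5 * pp - 1) / (5 * pp - 3) * texp (- H) (- 3 * K))"
    by (rule gen2)
  finally show ?thesis .
qed

text \<open>The coefficients of this expansion and of the next two come from geometric series in \<open>p\<close>.\<close>

lemma rational_A: "(5 * pp - 1) / (3 * pp - 1) \<approx>[3] trunc 1 (- 2) (- 6)"
proof (rule pcong_truncI)
  show "18 \<in> Zp" by simp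
  show "5 * pp - 1 = trunc 1 (- 2) (- 6) * (3 * pp - 1) + pp ^ 3 * 18"
    by (simp add: trunc_def algebra_simps power2_eq_square power3_eq_cube)
qed simp

lemma rational_G: "(5 * pp - 1) / (5 * pp - 3) \<approx>[3] trunc (1 / 3) (- 10 / 9) (- 50 / 27)"
proof (rule pcong_truncI)
  show "250 / 27 \<in> Zp" by (rule Zp_divide) simp_all
  show "5 * pp - 1 = trunc (1 / 3) (- 10 / 9) (- 50 / 27) * (5 * pp - 3) + pp ^ 3 * (250 / 27)"
    by (simp add: trunc_def field_simps power2_eq_square power3_eq_cube)
qed simp

lemma rational_B:
  "(9 * pp - 1) * (9 * pp - 5) / ((5 * pp - 1) * (5 * pp - 3)) \<approx>[3] trunc (5 / 3) (- 62 / 9) (- 886 / 27)"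
proof (rule pcong_truncI)
  show "(22150 * pp - 13070) / 27 \<in> Zp" by (rule Zp_divide) simp_all
  show "(5 * pp - 1) * (5 * pp - 3) \<in> Zunits" by (rule Zunits_mult) simp_all
  show "(9 * pp - 1) * (9 * pp - 5) = trunc (5 / 3) (- 62 / 9) (- 886 / 27) * ((5 * pp - 1) * (5 * pp - 3))
      + pp ^ 3 * ((22150 * pp - 13070) / 27)"
    by (simp add: trunc_def field_simps power2_eq_square power3_eq_cube)
qed

text \<open>The three rational factors and the three products are expanded to second order and recombined;
  the terms in \<open>p\<close> and \<open>p^2\<close> that contain neither \<open>H\<close> nor \<open>K\<close> are cancelled by the factor \<open>p - 1\<close>.\<close>

lemma jacobi_binomials:
  "(pp - 1) * (15 * C - 20 * of_nat ((6 * m) choose m) + 6 * of_nat ((10 * m) choose m)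
      + 3 * of_nat ((10 * m) choose (5 * m))) \<approx>[3] - 8 * (C * texp (H / 4) (K / 8))"
proof -
  let ?A = "(5 * pp - 1) / (3 * pp - 1) * texp (- H / 2) (- (3 / 2) * K)"
  let ?B = "(9 * pp - 1) * (9 * pp - 5) / ((5 * pp - 1) * (5 * pp - 3)) * texp (- H) (- 5 * K)"
  let ?G = "(5 * pp - 1) / (5 * pp - 3) * texp (- H) (- 3 * K)"
  have A: "?A \<approx>[3] trunc 1 (- H / 2 - 2) (H\<^sup>2 / 8 + 3 / 4 * K + H - 6)"
    by (rule pcong_eq_trans[OF trunc_texp[OF rational_A]])
      (simp_all add: field_simps power2_eq_square trunc_eqI)
  have B: "?B \<approx>[3] trunc (5 / 3) (- 5 / 3 * H - 62 / 9) (5 / 6 * (H\<^sup>2 + 5 * K) + 62 / 9 * H - 886 / 27)"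
    by (rule pcong_eq_trans[OF trunc_texp[OF rational_B]])
      (simp_all add: field_simps power2_eq_square trunc_eqI)
  have G: "?G \<approx>[3] trunc (1 / 3) (- 1 / 3 * H - 10 / 9) (1 / 6 * (H\<^sup>2 + 3 * K) + 10 / 9 * H - 50 / 27)"
    by (rule pcong_eq_trans[OF trunc_texp[OF rational_G]])
      (simp_all add: field_simps power2_eq_square trunc_eqI)
  have "(pp - 1) * (15 * C - 20 * of_nat ((6 * m) choose m) + 6 * of_nat ((10 * m) choose m)
      + 3 * of_nat ((10 * m) choose (5 * m)))
    \<approx>[3] (pp - 1) * (15 * C - 20 * (C / 2 * ?A) + 6 * (C / 4 * ?B) + 3 * (C / 2 * ?G))"
    by (intro pcong_scale[of "pp - 1"] pcong_add pcong_diff pcong_refl pcong_scale[of 20] pcong_scale[of 6]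
        pcong_scale[of 3] binomial_6m_m binomial_10m_m binomial_10m_5m) simp_all
  also have "\<dots> = C * ((pp - 1) * (15 - 10 * ?A + 3 / 2 * ?B + 3 / 2 * ?G))"
  proof -
    have "(pp - 1) * (15 * C - 20 * (C / 2 * a) + 6 * (C / 4 * b) + 3 * (C / 2 * g))
        = C * ((pp - 1) * (15 - 10 * a + 3 / 2 * b + 3 / 2 * g))" for a b g
      by (simp add: field_simps)
    then show ?thesis .
  qed
  also have "\<dots> \<approx>[3] C * ((pp - 1) * (15 - 10 * trunc 1 (- H / 2 - 2) (H\<^sup>2 / 8 + 3 / 4 * K + H - 6)
      + 3 / 2 * trunc (5 / 3) (- 5 / 3 * H - 62 / 9) (5 / 6 * (H\<^sup>2 + 5 * K) + 62 / 9 * H - 886 / 27)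
      + 3 / 2 * trunc (1 / 3) (- 1 / 3 * H - 10 / 9) (1 / 6 * (H\<^sup>2 + 3 * K) + 10 / 9 * H - 50 / 27)))"
    by (intro pcong_scale[of C] pcong_scale[of "pp - 1"] pcong_scale[of 10] pcong_scale[of "3 / 2"]
        pcong_add pcong_diff pcong_refl A B G) simp_all
  also have "\<dots> = C * (trunc (- 1) 1 0 * trunc 8 (2 * H + 8) (H\<^sup>2 / 4 - K / 2 + 2 * H + 8))"
    by (simp add: trunc_def field_simps)
  also have "\<dots> \<approx>[3] C * trunc (- 1 * 8) (- 1 * (2 * H + 8) + 1 * 8)
      (- 1 * (H\<^sup>2 / 4 - K / 2 + 2 * H + 8) + 1 * (2 * H + 8) + 0 * 8)"
    by (intro pcong_scale trunc_mult) simp_all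
  also have "\<dots> = - 8 * (C * texp (H / 4) (K / 8))"
    unfolding texp_trunc by (simp add: trunc_def field_simps power2_eq_square)
  finally show ?thesis .
qed

section \<open>The central binomial coefficient and sums of two squares\<close>

lemma C_unit [simp]: "C \<in> Zunits"
proof -
  have "C = 4 ^ m * (\<Prod>j<m. (2 * of_nat j + 1) / (2 * (of_nat j + 1)))"
    using central_binomial_prod[of m, where 'a = rat] by (simp add: C_def field_simps)
  also have "\<dots> \<in> Zunits"
    using bounds m_pos half_m
    by (intro Zunits_mult Zunits_power Zunits_prod Zunits_divide odd_unit Suc_unit Zunits_num) auto
  finally show ?thesis .
qed

text \<open>Writing \<open>binom(4m, 2m)\<close> both as a product of \<open>(p - 1 - j) / (j + 1)\<close> and as \<open>16^m\<close> times a product of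
  \<open>(2j + 1) / (2j + 2)\<close> expresses \<open>16^m = 2^(p-1)\<close> exactly by factors close to one.\<close>

lemma power16: "16 ^ m \<approx>[3] texp (- H / 2) 0"
proof -
  let ?V = "\<lambda>a. \<Prod>j<2*m. 1 + a * pp / (of_nat j + 1)"
  have hV: "?V a \<approx>[3] texp (a * H) (a\<^sup>2 * 0)" if "a \<in> Zp" for a
  proof -
    have "?V a \<approx>[3] texp (a * harm 1 (2 * m)) (a\<^sup>2 * harm 2 (2 * m))"
      using bounds that by (intro prod_Suc_texp) simp_all
    also have "\<dots> \<approx>[3] texp (a * H) (a\<^sup>2 * 0)"
      unfolding H_def using harm2_half[OF p_not_3] half_m that bounds
      by (intro texp_cong pcong_scale) simp_all
    finally show ?thesis .
  qed
  have 1: "of_nat ((2 * (2 * m)) choose (2 * m)) = ?V (- 1)"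
  proof -
    have "(of_nat (2 * (2 * m)) - of_nat j) / (of_nat j + 1) = - (1 + - 1 * pp / (of_nat j + 1))" for j
      unfolding p_eq using odd_nonzero(2)[of j] by (simp add: field_simps)
    then have "of_nat ((2 * (2 * m)) choose (2 * m)) = (\<Prod>j<2*m. - (1 + - 1 * pp / (of_nat j + 1)))"
      unfolding binomial_prod by (simp only:)
    also have "\<dots> = (- 1) ^ (2 * m) * ?V (- 1)" by (simp only: prod_uminus card_lessThan)
    finally show ?thesis by simp
  qed
  have 2: "of_nat ((2 * (2 * m)) choose (2 * m)) / 4 ^ (2 * m) = ?V (- 1 / 2)"
  proof -
    have "(\<Prod>j<2*m. 2 * of_nat j + 1 :: rat) = (\<Prod>j<2*m. 2 * of_nat (2 * m - Suc j) + 1)"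
      by (rule prod.nat_diff_reindex[symmetric])
    also have "\<dots> = (\<Prod>j<2*m. - (2 * (of_nat j + 1)) * (1 + - 1 / 2 * pp / (of_nat j + 1)))"
    proof (rule prod.cong[OF refl])
      fix j assume "j \<in> {..<2*m}"
      then have "of_nat (2 * m - Suc j) = 2 * of_nat m - of_nat j - (1 :: rat)" by (simp add: of_nat_diff)
      then show "2 * of_nat (2 * m - Suc j) + 1 = - (2 * (of_nat j + 1)) * (1 + - 1 / 2 * pp / (of_nat j + 1))"
        unfolding p_eq using odd_nonzero(2)[of j] by (simp add: field_simps)
    qed
    also have "\<dots> = (- 1) ^ (2 * m) * (\<Prod>j<2*m. 2 * (of_nat j + 1)) * ?V (- 1 / 2)"
      unfolding prod.distrib prod_uminus card_lessThan by simp
    finally have "(\<Prod>j<2*m. 2 * of_nat j + 1 :: rat) = (\<Prod>j<2*m. 2 * (of_nat j + 1)) * ?V (- 1 / 2)" by simp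
    moreover have "(\<Prod>j<2*m. 2 * (of_nat j + 1) :: rat) \<noteq> 0"
      using odd_nonzero(2) by (simp only: prod_zero_iff finite_lessThan mult_eq_0_iff) auto
    ultimately show ?thesis unfolding central_binomial_prod prod_dividef by simp
  qed
  have u: "texp (- 1 / 2 * H) ((- 1 / 2)\<^sup>2 * 0) \<in> Zunits" by (intro texp_unit) simp_all
  have Vu: "?V (- 1 / 2) \<in> Zunits" by (rule Zunits_pcong[OF hV u]) simp_all
  have "(4::rat) ^ (2 * m) = 16 ^ m" by (simp add: power_mult)
  then have "?V (- 1) = 16 ^ m * ?V (- 1 / 2)" using 1 2 by (simp add: field_simps)
  then have "16 ^ m = ?V (- 1) / ?V (- 1 / 2)" using Zunits_nonzero[OF Vu] by simp
  also have "\<dots> \<approx>[3] texp (- 1 * H) ((- 1)\<^sup>2 * 0) / texp (- 1 / 2 * H) ((- 1 / 2)\<^sup>2 * 0)"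
    by (intro pcong_divide hV Vu u) simp_all
  also have "\<dots> \<approx>[3] texp (- 1 * H - - 1 / 2 * H) ((- 1)\<^sup>2 * 0 - (- 1 / 2)\<^sup>2 * 0)"
    by (intro texp_divide) simp_all
  finally show ?thesis by simp
qed

text \<open>The numerator \<open>(6m)!\<close> contains the factor \<open>p\<close> once and \<open>(3m)!\<close> does not contain it.  Comparing the
  factorials of \<open>3m\<close> and \<open>2m\<close> with that of \<open>4m = p - 1\<close> shows that the product with \<open>binom(2m, m)\<close> is
  \<open>p / (p + 2m)\<close> modulo \<open>p^2\<close>, where \<open>2m \<equiv> -1/2 (mod p)\<close>.\<close>

lemma binomial_6m_3m:
  obtains c where "c \<in> Zp" "of_nat ((6 * m) choose (3 * m)) = pp * c" "C * c \<approx>[1] - 2"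
proof -
  let ?V = "\<lambda>a k. \<Prod>j<k. 1 + a * pp / (of_nat j + 1)"
  have V1: "?V a k \<approx>[1] 1" if "a \<in> Zp" "k < p" for a k
    using pcong_trans[OF pcong_weaken[OF prod_Suc_texp[OF that(2,1)], of 1] texp_cong1] that by simp
  have falling: "of_nat ((4 * m) choose k) = (- 1) ^ k * ?V (- 1) k" for k
  proof -
    have "(of_nat (4 * m) - of_nat j) / (of_nat j + 1) = - (1 + - 1 * pp / (of_nat j + 1))" for j
      unfolding p_eq using odd_nonzero(2)[of j] by (simp add: field_simps)
    then have "of_nat ((4 * m) choose k) = (\<Prod>j<k. - (1 + - 1 * pp / (of_nat j + 1)))"
      unfolding binomial_prod by (simp only:)
    also have "\<dots> = (- 1) ^ k * ?V (- 1) k" by (simp only: prod_uminus card_lessThan)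
    finally show ?thesis .
  qed
  define T U V where "T = ?V 1 (2 * m)" and "U = ?V (- 1) m" and "V = ?V (- 1) (2 * m)"
  have TUV: "T \<approx>[1] 1" "U \<approx>[1] 1" "V \<approx>[1] 1"
    using V1[of 1 "2 * m"] V1[of "- 1" m] V1[of "- 1" "2 * m"] bounds by (simp_all add: T_def U_def V_def)
  then have uV: "V \<in> Zunits" using Zunits_pcong[OF TUV(3)] by simp
  have a: "fact (p + 2 * m) = (fact p * fact (2 * m) * T :: rat)"
    using fact_add_prod[of p "2 * m"] by (simp add: T_def)
  have "p + 2 * m = Suc (6 * m)" "p = Suc (4 * m)" using p_eq by simp_all
  then have b: "fact (p + 2 * m) = (pp + 2 * of_nat m) * (fact (6 * m) :: rat)" "fact p = pp * (fact (4 * m) :: rat)"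
    by (metis fact_Suc of_nat_add of_nat_mult of_nat_numeral, metis fact_Suc)
  have c: "fact (4 * m) = (- 1) ^ m * U * (fact m * fact (3 * m) :: rat)"
    using falling[of m] by (simp add: binomial_fact U_def field_simps)
  have d: "fact (4 * m) = V * (fact (2 * m) * fact (2 * m) :: rat)"
    using falling[of "2 * m"] by (simp add: binomial_fact V_def field_simps)
  have e: "C = fact (2 * m) / (fact m * fact m)"
    unfolding C_def by (subst binomial_fact) simp_all
  have h: "pp + 2 * of_nat m = (3 * pp - 1) / 2" unfolding pp_m by (simp add: field_simps)
  have hu: "(3 * pp - 1) / 2 \<in> Zunits" by (intro Zunits_divide) simp_all
  define r where "r = T * U\<^sup>2 / ((3 * pp - 1) / 2 * V)"
  have rZ: "r \<in> Zp" unfolding r_def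
    using pcong_Zp[OF TUV(1)] pcong_Zp[OF TUV(2)] uV hu by (intro Zp_divide Zp_mult Zp_power Zunits_mult) simp_all
  have "of_nat ((6 * m) choose (3 * m)) = (fact (6 * m) / (fact (3 * m) * fact (3 * m)) :: rat)"
    by (subst binomial_fact) simp_all
  also have "\<dots> = pp * (r / C)"
  proof -
    define f1 f2 f3 f4 f6 :: rat where "f1 = fact m" and "f2 = fact (2 * m)" and "f3 = fact (3 * m)"
      and "f4 = fact (4 * m)" and "f6 = fact (6 * m)"
    define q where "q = (3 * pp - 1) / 2"
    have nz: "f1 \<noteq> 0" "f2 \<noteq> 0" "f3 \<noteq> 0" "f4 \<noteq> 0" "V \<noteq> 0" "q \<noteq> 0"
      using Zunits_nonzero[OF uV] Zunits_nonzero[OF hu] by (simp_all add: q_def f1_def f2_def f3_def f4_def)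
    define s :: rat where "s = (- 1) ^ m"
    have s: "s * s = 1" by (simp add: s_def flip: power_mult_distrib)
    have 1: "q * f6 = pp * f4 * f2 * T"
      using a b h by (simp add: q_def f6_def f4_def f2_def)
    have 2: "f4 = s * U * (f1 * f3)" "f4 = V * (f2 * f2)"
      using c d by (simp_all add: f1_def f2_def f3_def f4_def s_def)
    have "f4 * f4 = (s * s) * (U\<^sup>2 * (f1\<^sup>2 * (f3 * f3)))"
      by (subst (1 2) 2(1)) (simp add: power2_eq_square ac_simps)
    then have 3: "f4 * f4 = U\<^sup>2 * (f1\<^sup>2 * (f3 * f3))" by (simp only: s mult_1)
    have "f6 / (f3 * f3) * (q * V * f2 * (f4 * f4)) =
        (q * f6) * V * f2 * (f4 * f4) / (f3 * f3)" by (simp add: ac_simps)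
    also have "\<dots> = pp * f4 * f2 * T * V * f2 * (U\<^sup>2 * f1\<^sup>2)"
      unfolding 1 unfolding 3 using nz by simp
    also have "\<dots> = pp * T * U\<^sup>2 * f1\<^sup>2 * f4 * (V * (f2 * f2))" by (simp add: ac_simps)
    also have "\<dots> = pp * T * U\<^sup>2 * f1\<^sup>2 * (f4 * f4)" by (simp only: 2(2)[symmetric] mult.assoc)
    finally have "f6 / (f3 * f3) * (q * V * f2) * (f4 * f4) = pp * T * U\<^sup>2 * f1\<^sup>2 * (f4 * f4)"
      by (simp only: mult.assoc)
    then have "f6 / (f3 * f3) * (q * V * f2) = pp * T * U\<^sup>2 * f1\<^sup>2"
      using nz by (simp only: mult_right_cancel mult_eq_0_iff simp_thms)
    then have "f6 / (f3 * f3) = pp * T * U\<^sup>2 * f1\<^sup>2 / (q * V * f2)"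
      using nz by (simp only: nonzero_eq_divide_eq mult_eq_0_iff simp_thms)
    also have "\<dots> = pp * (r / (f2 / (f1 * f1)))"
      unfolding r_def q_def[symmetric] by (simp add: power2_eq_square ac_simps)
    finally show ?thesis by (simp add: e f1_def f2_def f3_def f6_def)
  qed
  finally have 1: "of_nat ((6 * m) choose (3 * m)) = pp * (r / C)" .
  have "r \<approx>[1] 1 * 1\<^sup>2 / (- 1 / 2 * 1)" unfolding r_def
  proof (rule pcong_divide)
    show "T * U\<^sup>2 \<approx>[1] 1 * 1\<^sup>2" using TUV by (intro pcong_mult pcong_power) simp_all
    have "(3 * pp - 1) / 2 \<approx>[1] - 1 / 2" by (rule pcongI[of "3 / 2"]) (simp_all add: field_simps)
    then show "(3 * pp - 1) / 2 * V \<approx>[1] - 1 / 2 * 1" using TUV by (intro pcong_mult) simp_all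
    show "- 1 / 2 * 1 \<in> Zunits" by simp
    show "(3 * pp - 1) / 2 * V \<in> Zunits" by (intro Zunits_mult hu uV)
  qed simp_all
  then have "C * (r / C) \<approx>[1] - 2" using Zunits_nonzero[OF C_unit] by simp
  with 1 rZ show ?thesis by (intro that[of "r / C"]) simp_all
qed

definition W :: rat where "W = (C / 4 ^ m)\<^sup>2"

lemma W_Zp [simp]: "W \<in> Zp" by (simp add: W_def)

text \<open>Here the unit \<open>j\<close> and the multiple \<open>j'\<close> of \<open>p\<close> are the two roots of \<open>T^2 - 2 X T + p\<close> modulo \<open>p^3\<close>, so \<open>j^2\<close> is
  determined by \<open>X\<close>; on the other side, \<open>j\<close> is the combination of binomial coefficients computed before.\<close>

lemma quartic_representation:
  obtains X Y :: int where "odd X" "even Y" "X\<^sup>2 + Y\<^sup>2 = int p"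
    "W * (1 - pp\<^sup>2 * K / 8) \<approx>[3] 4 * (of_int X)\<^sup>2 - 2 * pp - pp\<^sup>2 / (4 * (of_int X)\<^sup>2)"
    "W \<approx>[1] 4 * (of_int X)\<^sup>2"
proof -
  obtain X Y J J' :: int where X: "odd X" and Y: "even Y" and lt: "X\<^sup>2 + Y\<^sup>2 < (int p)\<^sup>2"
    and sum: "J + J' = 2 * X" and JJ: "[J * J' = X\<^sup>2 + Y\<^sup>2] (mod int p ^ 3)"
    and J: "[8 * J = int (p - 1) * ((- 1) ^ m * int (15 * ((2 * m) choose m) + 6 * ((10 * m) choose m) + 3 * ((10 * m) choose (5 * m)))
        - (- 1) ^ m * int (20 * ((6 * m) choose m)))] (mod int p ^ 3)"
    and J': "[8 * J' = int (p - 1) * (- 4 * ((- 1) ^ m * int ((6 * m) choose (3 * m))))] (mod int p ^ 2)"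
    by (rule jacobi_sum[OF p_eq])
  define j j' x :: rat where "j = of_int J" and "j' = of_int J'" and "x = of_int X"
  define s :: rat where "s = (- 1) ^ m"
  have s: "s * s = 1" "s \<in> Zp" by (simp_all add: s_def flip: power_mult_distrib)
  have p1: "of_nat (p - Suc 0) = pp - 1" using p_gt_2 by (simp add: of_nat_diff)
  have "8 * j \<approx>[3] (pp - 1) * (s * of_nat (15 * ((2 * m) choose m) + 6 * ((10 * m) choose m) + 3 * ((10 * m) choose (5 * m)))
      - s * of_nat (20 * ((6 * m) choose m)))"
    using J[unfolded pcong_of_int_iff[symmetric]]
    by (simp add: p1 j_def s_def)
  also have "\<dots> = s * ((pp - 1) * (15 * C - 20 * of_nat ((6 * m) choose m) + 6 * of_nat ((10 * m) choose m)
      + 3 * of_nat ((10 * m) choose (5 * m))))"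
    by (simp add: C_def algebra_simps)
  also have "\<dots> \<approx>[3] s * (- 8 * (C * texp (H / 4) (K / 8)))"
    by (intro pcong_scale jacobi_binomials s)
  also have "\<dots> = 8 * (- s * (C * texp (H / 4) (K / 8)))" by simp
  finally have j3: "j \<approx>[3] - s * (C * texp (H / 4) (K / 8))" by (rule pcong_cancel_unit) simp
  have E1: "texp (H / 4) (K / 8) \<approx>[1] 1" by (intro texp_cong1) simp_all
  have j1: "j \<approx>[1] - s * C"
  proof -
    have "j \<approx>[1] - s * (C * texp (H / 4) (K / 8))" by (rule pcong_weaken[OF j3]) simp
    also have "\<dots> \<approx>[1] - s * (C * 1)" using s by (intro pcong_scale E1) simp_all
    finally show ?thesis by simp
  qed
  have su: "s \<in> Zunits" unfolding s_def by simp
  have ju: "j \<in> Zunits" by (rule Zunits_pcong[OF j1]) (use su in simp_all)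
  obtain c where c: "c \<in> Zp" "of_nat ((6 * m) choose (3 * m)) = pp * c" "C * c \<approx>[1] - 2"
    by (rule binomial_6m_3m)
  have j'2: "8 * j' \<approx>[2] pp * (4 * (1 - pp) * s * c)"
  proof -
    have "8 * j' \<approx>[2] (pp - 1) * (- 4 * (s * of_nat ((6 * m) choose (3 * m))))"
      using J'[unfolded pcong_of_int_iff[symmetric]]
      by (simp add: p1 j'_def s_def)
    also have "\<dots> = pp * (4 * (1 - pp) * s * c)" unfolding c(2) by (simp add: algebra_simps)
    finally show ?thesis .
  qed
  have jj': "j * j' \<approx>[2] pp"
  proof -
    have "8 * (j * j') = j * (8 * j')" by simp
    also have "\<dots> \<approx>[2] j * (pp * (4 * (1 - pp) * s * c))" using ju by (intro pcong_scale j'2) simp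
    also have "\<dots> = pp * (j * (4 * (1 - pp) * s * c))" by simp
    also have "\<dots> \<approx>[2] pp * 8"
    proof (rule pcong_mult_p1)
      have "j * (4 * (1 - pp) * s * c) \<approx>[1] - s * C * (4 * (1 - 0) * s * c)"
      proof (intro pcong_mult j1 pcong_diff pcong_refl)
        show "pp \<approx>[1] 0" by (rule pcongI[of 1]) simp_all
      qed (use s c in simp_all)
      also have "\<dots> = - 4 * (s * s) * (C * c)" by (simp add: ac_simps)
      also have "\<dots> = - 4 * (C * c)" unfolding s by simp
      also have "\<dots> \<approx>[1] - 4 * - 2" by (intro pcong_scale c) simp
      finally show "j * (4 * (1 - pp) * s * c) \<approx>[1] 8" by simp
    qed
    also have "pp * 8 = 8 * pp" by simp
    finally show ?thesis by (rule pcong_cancel_unit) simp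
  qed
  have "[X\<^sup>2 + Y\<^sup>2 = J * J'] (mod int p ^ 2)"
    by (rule cong_sym, rule cong_dvd_modulus[OF JJ], simp add: le_imp_power_dvd)
  also have "[J * J' = int p] (mod int p ^ 2)"
    using jj' unfolding j_def j'_def by (simp flip: pcong_of_int_iff)
  finally have "[X\<^sup>2 + Y\<^sup>2 = int p] (mod int p ^ 2)" .
  moreover have "int p < (int p)\<^sup>2" using p_gt_2 by (simp add: power2_eq_square)
  ultimately have XY: "X\<^sup>2 + Y\<^sup>2 = int p"
    using lt by (intro cong_less_imp_eq_int[of _ "(int p)\<^sup>2"]) simp_all
  have jj3: "j * j' \<approx>[3] pp"
    using JJ unfolding XY j_def j'_def by (simp flip: pcong_of_int_iff)
  have j'eq: "j' = 2 * x - j"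
  proof -
    have "(of_int (J + J') :: rat) = of_int (2 * X)" by (simp only: sum)
    then show ?thesis by (simp add: j_def j'_def x_def)
  qed
  have j'3: "j' \<approx>[3] pp / j"
    using pcong_divide[OF jj3 pcong_refl[of j 3]] ju Zunits_nonzero[OF ju] by simp
  have "2 * x \<approx>[1] j"
  proof -
    have "j' \<approx>[1] pp / j" by (rule pcong_weaken[OF j'3]) simp
    also have "\<dots> \<approx>[1] 0" using ju by (intro pcongI[of "1 / j"]) simp_all
    finally have "j' + j \<approx>[1] 0 + j" by (intro pcong_add) simp_all
    then show ?thesis by (simp add: j'eq)
  qed
  then have x1: "(2 * x)\<^sup>2 \<approx>[1] j\<^sup>2" using ju by (intro pcong_power) simp_all
  have xu: "(2 * x)\<^sup>2 \<in> Zunits" by (rule Zunits_pcong[OF x1]) (use ju in simp_all)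
  \<comment> \<open>In \<open>j^2 = (j + j')^2 - 2 j j' - j'^2\<close> the last square is \<open>p^2 / j^2\<close>, where \<open>j^2\<close> is needed only modulo \<open>p\<close>.\<close>
  have sq: "j\<^sup>2 \<approx>[3] 4 * x\<^sup>2 - 2 * pp - pp\<^sup>2 / (4 * x\<^sup>2)"
  proof -
    have "j\<^sup>2 = (2 * x)\<^sup>2 - 2 * (j * j') - j'\<^sup>2"
      unfolding j'eq by (simp add: power2_eq_square algebra_simps)
    also have "\<dots> \<approx>[3] (2 * x)\<^sup>2 - 2 * pp - (pp / j)\<^sup>2"
      using ju by (intro pcong_diff pcong_refl pcong_scale jj3 pcong_power j'3) simp_all
    also have "\<dots> = (2 * x)\<^sup>2 - 2 * pp - pp\<^sup>2 * (1 / j\<^sup>2)" by (simp add: power_divide)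
    also have "\<dots> \<approx>[3] (2 * x)\<^sup>2 - 2 * pp - pp\<^sup>2 * (1 / (2 * x)\<^sup>2)"
      using ju xu by (intro pcong_diff pcong_refl pcong_mult_p2 pcong_divide pcong_sym[OF x1]) simp_all
    finally show ?thesis by (simp add: power_mult_distrib)
  qed
  have CE: "C\<^sup>2 \<approx>[3] W * texp (- H / 2) 0"
  proof -
    have "(4 ^ m)\<^sup>2 = (16 :: rat) ^ m" by (simp add: power2_eq_square flip: power_mult_distrib)
    then have "C\<^sup>2 = W * 16 ^ m" by (simp add: W_def power_divide)
    also have "\<dots> \<approx>[3] W * texp (- H / 2) 0" by (intro pcong_scale power16) simp
    finally show ?thesis .
  qed
  have jW: "j\<^sup>2 \<approx>[3] W * (1 - pp\<^sup>2 * K / 8)"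
  proof -
    have "j\<^sup>2 \<approx>[3] (- s * (C * texp (H / 4) (K / 8)))\<^sup>2" using s by (intro pcong_power j3) simp_all
    also have "\<dots> = (s * s) * (C\<^sup>2 * (texp (H / 4) (K / 8) * texp (H / 4) (K / 8)))"
      by (simp add: power2_eq_square ac_simps)
    also have "\<dots> = C\<^sup>2 * (texp (H / 4) (K / 8) * texp (H / 4) (K / 8))" unfolding s by simp
    also have "\<dots> \<approx>[3] (W * texp (- H / 2) 0) * texp (H / 4 + H / 4) (K / 8 + K / 8)"
      by (intro pcong_mult[OF CE texp_mult]) simp_all
    also have "\<dots> = W * (texp (- H / 2) 0 * texp (H / 4 + H / 4) (K / 8 + K / 8))" by simp
    also have "\<dots> \<approx>[3] W * texp (- H / 2 + (H / 4 + H / 4)) (0 + (K / 8 + K / 8))"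
      by (intro pcong_scale texp_mult) simp_all
    also have "\<dots> = W * (1 - pp\<^sup>2 * K / 8)" by (simp add: texp_def)
    finally show ?thesis .
  qed
  have "W \<approx>[1] 4 * x\<^sup>2"
  proof -
    have "W = W * (1 - pp\<^sup>2 * K / 8) + pp ^ 1 * (pp * W * K / 8)" by (simp add: power2_eq_square field_simps)
    then have "W \<approx>[1] W * (1 - pp\<^sup>2 * K / 8)" by (intro pcongI[of "pp * W * K / 8"]) simp_all
    also have "\<dots> \<approx>[1] j\<^sup>2" by (rule pcong_weaken[OF pcong_sym[OF jW]]) simp
    also have "\<dots> \<approx>[1] (2 * x)\<^sup>2" by (rule pcong_sym[OF x1])
    finally show ?thesis by (simp add: power_mult_distrib)
  qed
  then show ?thesis using that[OF X Y XY] pcong_trans[OF pcong_sym[OF jW] sq] unfolding x_def by blast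
qed

end

section \<open>Euler numbers modulo a prime\<close>

lemma euler_number_eq_0: "odd n \<Longrightarrow> euler_number n = 0"
  by (subst euler_number.simps) (auto intro: odd_pos)

text \<open>The recurrence for the Euler numbers without the restriction to even indices, in the form
  that says that their exponential generating function is the inverse of \<open>cosh\<close>.\<close>

lemma euler_number_convolution:
  "(\<Sum>i\<le>n. int (n choose i) * euler_number i * (1 + (- 1) ^ (n - i))) = (if n = 0 then 2 else 0)"
proof (cases "even n")
  case False
  have "int (n choose i) * euler_number i * (1 + (- 1) ^ (n - i)) = 0" if "i \<le> n" for i
  proof (cases "even i")
    case True
    then have "odd (n - i)" using False that by simp
    then show ?thesis by simp
  next
    case odd: False
    then have "euler_number i = 0" by (simp add: euler_number_eq_0)
    then show ?thesis by simp
  qed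
  then show ?thesis using False by (auto intro!: sum.neutral)
next
  case True
  then obtain N where n: "n = 2 * N" by blast
  have "(\<Sum>i\<le>n. int (n choose i) * euler_number i * (1 + (- 1) ^ (n - i)))
      = (\<Sum>i\<in>(\<lambda>k. 2 * N - 2 * k) ` {..N}. int (n choose i) * euler_number i * (1 + (- 1) ^ (n - i)))"
  proof (rule sum.mono_neutral_right)
    show "\<forall>i\<in>{..n} - (\<lambda>k. 2 * N - 2 * k) ` {..N}. int (n choose i) * euler_number i * (1 + (- 1) ^ (n - i)) = 0"
    proof
      fix i assume i: "i \<in> {..n} - (\<lambda>k. 2 * N - 2 * k) ` {..N}"
      have "odd i"
      proof
        assume "even i"
        then obtain j where "i = 2 * j" by blast
        with i n have "i = 2 * N - 2 * (N - j)" "N - j \<in> {..N}" by auto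
        with i show False by blast
      qed
      then have "euler_number i = 0" by (simp add: euler_number_eq_0)
      then show "int (n choose i) * euler_number i * (1 + (- 1) ^ (n - i)) = 0" by simp
    qed
  qed (auto simp: n)
  also have "\<dots> = (\<Sum>k\<le>N. 2 * (int (2 * N choose (2 * k)) * euler_number (2 * N - 2 * k)))"
  proof (subst sum.reindex)
    show "inj_on (\<lambda>k. 2 * N - 2 * k) {..N}" by (auto simp: inj_on_def)
    show "sum ((\<lambda>i. int (n choose i) * euler_number i * (1 + (- 1) ^ (n - i))) \<circ> (\<lambda>k. 2 * N - 2 * k)) {..N}
        = (\<Sum>k\<le>N. 2 * (int (2 * N choose (2 * k)) * euler_number (2 * N - 2 * k)))"
    proof (rule sum.cong[OF refl])
      fix k assume "k \<in> {..N}"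
      then have "(2 * N) choose (2 * N - 2 * k) = (2 * N) choose (2 * k)" "n - (2 * N - 2 * k) = 2 * k"
        using binomial_symmetric[of "2 * k" "2 * N"] n by simp_all
      then show "((\<lambda>i. int (n choose i) * euler_number i * (1 + (- 1) ^ (n - i))) \<circ> (\<lambda>k. 2 * N - 2 * k)) k
          = 2 * (int (2 * N choose (2 * k)) * euler_number (2 * N - 2 * k))"
        using n by simp
    qed
  qed
  also have "\<dots> = 2 * (\<Sum>k\<in>insert 0 {1..N}. int (2 * N choose (2 * k)) * euler_number (2 * N - 2 * k))"
  proof -
    have "{..N} = insert 0 {1..N}" by auto
    then show ?thesis by (simp only: sum_distrib_left)
  qed
  also have "\<dots> = (if n = 0 then 2 else 0)"
  proof (cases "N = 0")
    case True
    then show ?thesis using n by (simp add: euler_number_0)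
  next
    case False
    then show ?thesis using euler_number_even[of N] n by simp
  qed
  finally show ?thesis .
qed

definition euler_fps :: "rat fps" where
  "euler_fps = Abs_fps (\<lambda>n. of_int (euler_number n) / fact n)"

lemma euler_fps_mult: "euler_fps * (fps_exp 1 + fps_exp (- 1)) = 2"
proof (rule fps_ext)
  fix n
  have "fps_nth (euler_fps * (fps_exp 1 + fps_exp (- 1))) n
      = (\<Sum>i\<le>n. of_int (euler_number i) / fact i * ((1 + (- 1) ^ (n - i)) / fact (n - i)))"
    by (simp add: fps_mult_nth euler_fps_def atMost_atLeast0 add_divide_distrib)
  also have "\<dots> = (\<Sum>i\<le>n. of_int (int (n choose i) * euler_number i * (1 + (- 1) ^ (n - i))) / fact n)"
  proof (rule sum.cong[OF refl])
    fix i assume "i \<in> {..n}"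
    then have "(of_nat (n choose i) :: rat) = fact n / (fact i * fact (n - i))"
      by (simp add: binomial_fact)
    then show "of_int (euler_number i) / fact i * ((1 + (- 1) ^ (n - i)) / fact (n - i)) =
        (of_int (int (n choose i) * euler_number i * (1 + (- 1) ^ (n - i))) / fact n :: rat)"
      by simp
  qed
  also have "\<dots> = of_int (\<Sum>i\<le>n. int (n choose i) * euler_number i * (1 + (- 1) ^ (n - i))) / fact n"
    by (simp add: sum_divide_distrib)
  also have "\<dots> = fps_nth 2 n"
    unfolding euler_number_convolution by (simp add: fps_numeral_nth)
  finally show "fps_nth (euler_fps * (fps_exp 1 + fps_exp (- 1))) n = fps_nth 2 n" .
qed

text \<open>The Appell polynomials of the Euler numbers; up to scaling and shifting of the argument these are
  the Euler polynomials.\<close>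

definition euler_sum :: "nat \<Rightarrow> rat \<Rightarrow> rat" where
  "euler_sum r x = (\<Sum>i\<le>r. of_nat (r choose i) * of_int (euler_number i) * x ^ (r - i))"

lemma euler_sum_fps: "euler_sum r x = fact r * fps_nth (euler_fps * fps_exp x) r"
proof -
  have "fps_nth (euler_fps * fps_exp x) r = (\<Sum>i\<le>r. of_int (euler_number i) / fact i * (x ^ (r - i) / fact (r - i)))"
    by (simp add: fps_mult_nth euler_fps_def atMost_atLeast0)
  then have "fact r * fps_nth (euler_fps * fps_exp x) r
      = (\<Sum>i\<le>r. fact r * (of_int (euler_number i) / fact i * (x ^ (r - i) / fact (r - i))))"
    by (simp only: sum_distrib_left)
  also have "\<dots> = euler_sum r x" unfolding euler_sum_def
  proof (rule sum.cong[OF refl])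
    fix i assume "i \<in> {..r}"
    then have "(of_nat (r choose i) :: rat) = fact r / (fact i * fact (r - i))"
      by (simp add: binomial_fact)
    then show "fact r * (of_int (euler_number i) / fact i * (x ^ (r - i) / fact (r - i)))
        = of_nat (r choose i) * of_int (euler_number i) * x ^ (r - i)"
      by simp
  qed
  finally show ?thesis ..
qed

lemma euler_sum_step: "euler_sum r (x + 1) + euler_sum r (x - 1) = 2 * x ^ r"
proof -
  have e: "fps_exp (x + 1) + fps_exp (x - 1) = (fps_exp 1 + fps_exp (- 1)) * fps_exp x"
    using fps_exp_add_mult[of 1 x] fps_exp_add_mult[of "- 1" x] by (simp add: add.commute distrib_right)
  have "euler_fps * fps_exp (x + 1) + euler_fps * fps_exp (x - 1) = 2 * fps_exp x"
    unfolding distrib_left[symmetric] e unfolding mult.assoc[symmetric] euler_fps_mult ..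
  then have "fps_nth (euler_fps * fps_exp (x + 1) + euler_fps * fps_exp (x - 1)) r = fps_nth (2 * fps_exp x) r"
    by (simp only:)
  then have c: "fps_nth (euler_fps * fps_exp (x + 1)) r + fps_nth (euler_fps * fps_exp (x - 1)) r = 2 * (x ^ r / fact r)"
    by (simp add: numeral_fps_const)
  show ?thesis unfolding euler_sum_fps distrib_left[symmetric] c by simp
qed

text \<open>For even \<open>r\<close> the polynomial is even, and the functional equation at \<open>0\<close> gives twice the value at \<open>1\<close>.\<close>

lemma euler_sum_one: assumes "even r" "0 < r" shows "euler_sum r 1 = 0"
proof -
  have "euler_sum r (- 1) = euler_sum r 1" unfolding euler_sum_def
  proof (rule sum.cong[OF refl])
    fix i assume i: "i \<in> {..r}"
    show "of_nat (r choose i) * of_int (euler_number i) * (- 1) ^ (r - i)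
        = of_nat (r choose i) * of_int (euler_number i) * (1 :: rat) ^ (r - i)"
    proof (cases "even i")
      case True
      then show ?thesis using i assms by simp
    next
      case False
      then show ?thesis by (simp add: euler_number_eq_0)
    qed
  qed
  moreover have "euler_sum r (0 + 1) + euler_sum r (0 - 1) = 2 * 0 ^ r" by (rule euler_sum_step)
  ultimately show ?thesis using assms by (simp add: zero_power)
qed

text \<open>The functional equation is used at the even points \<open>2, 4, \<dots>, 2N\<close>, so that the sum ends at
  \<open>2N + 1\<close>, which is \<open>p\<close> for \<open>N = (p - 1) / 2\<close>.\<close>

lemma euler_sum_telescope:
  "(\<Sum>j<N. (- 1) ^ (j + 1) * (2 * (2 * (of_nat j + 1)) ^ r)) = (- 1) ^ N * euler_sum r (2 * of_nat N + 1) - euler_sum r 1"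
proof (induction N)
  case (Suc N)
  have step: "2 * (2 * (of_nat N + 1)) ^ r = euler_sum r (2 * of_nat (Suc N) + 1) + euler_sum r (2 * of_nat N + 1)"
    using euler_sum_step[of r "2 * (of_nat N + 1)"] by (simp add: algebra_simps)
  show ?case unfolding sum.lessThan_Suc Suc.IH step by (simp add: distrib_left)
qed simp

context prime_1_mod_4
begin

text \<open>Modulo \<open>p\<close> only the constant term \<open>E_(p-3)\<close> of the polynomial remains at \<open>p\<close>, and Fermat's theorem turns
  the powers with exponent \<open>p - 3\<close> into inverse squares.\<close>

lemma euler_number_pcong: "of_int (euler_number (p - 3)) \<approx>[1] K / 4"
proof -
  define r where "r = p - 3"
  have r: "even r" "0 < r" "r + 2 = p - 1" using p_eq m_pos by (auto simp: r_def)
  have p0: "pp \<approx>[1] 0" by (rule pcongI[of 1]) simp_all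
  have "euler_sum r pp \<approx>[1] euler_sum r 0"
    unfolding euler_sum_def by (intro pcong_sum pcong_scale pcong_power p0) simp_all
  also have "euler_sum r 0 = (\<Sum>i\<le>r. if i = r then of_int (euler_number r) else 0)"
    unfolding euler_sum_def by (intro sum.cong refl) (auto simp: zero_power)
  also have "\<dots> = of_int (euler_number r)" by simp
  finally have "of_int (euler_number r) \<approx>[1] euler_sum r pp" by (rule pcong_sym)
  also have "euler_sum r pp = (\<Sum>j<half. (- 1) ^ (j + 1) * (2 * (2 * (of_nat j + 1)) ^ r))"
    unfolding euler_sum_telescope euler_sum_one[OF r(1,2)] using half_m pp_half by simp
  also have "\<dots> \<approx>[1] (\<Sum>j<half. (- 1) ^ (j + 1) * (2 * (1 / (2 * (of_nat j + 1))\<^sup>2)))"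
  proof (intro pcong_sum pcong_scale)
    fix j assume j: "j \<in> {..<half}"
    let ?a = "2 * (of_nat j + 1) :: rat"
    have u: "?a\<^sup>2 \<in> Zunits" using j p_half by (intro Zunits_power Zunits_mult Suc_unit) auto
    have "\<not> p dvd 2 * (j + 1)" using j p_half by (auto dest: dvd_imp_le)
    then have "?a ^ (p - 1) \<approx>[1] 1" using fermat_pcong[of "2 * (j + 1)"] by (simp add: add.commute)
    moreover have "?a ^ (p - 1) = ?a\<^sup>2 * ?a ^ r"
      unfolding r(3)[symmetric] power_add by (rule mult.commute)
    moreover have "?a\<^sup>2 * (1 / ?a\<^sup>2) = 1" using Zunits_nonzero[OF u] by simp
    ultimately have "?a\<^sup>2 * ?a ^ r \<approx>[1] ?a\<^sup>2 * (1 / ?a\<^sup>2)" by (simp only:)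
    then show "?a ^ r \<approx>[1] 1 / ?a\<^sup>2" using u by (rule pcong_cancel_unit)
  qed simp_all
  also have "\<dots> = (\<Sum>j<2*m. (- 1) ^ (j + 1) / (of_nat j + 1)\<^sup>2) / 2"
  proof -
    have "s * (2 * (1 / (2 * a)\<^sup>2)) = s / a\<^sup>2 / 2" for s a :: rat
      by (simp add: power2_eq_square)
    then show ?thesis by (simp only: half_m sum_divide_distrib)
  qed
  also have "(\<Sum>j<2*k. (- 1) ^ (j + 1) / (of_nat j + 1)\<^sup>2) = harm 2 k / 4 - oddH 2 k" for k
  proof (induction k)
    case (Suc k)
    have "(2 * of_nat k + 1 + 1 :: rat)\<^sup>2 = 4 * (of_nat k + 1)\<^sup>2"
      by (simp add: algebra_simps power2_eq_square)
    then show ?case using Suc.IH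
      by (simp add: harm_def oddH_def add_divide_distrib)
  qed (simp add: harm_def oddH_def)
  also have "(harm 2 m / 4 - oddH 2 m) / 2 \<approx>[1] (K / 4 - - (K / 4)) / 2"
    unfolding K_def using harm_relation_2[OF half_m p_not_3] bounds
    by (intro pcong_divide pcong_diff pcong_refl) simp_all
  finally show ?thesis by (simp add: r_def)
qed

section \<open>The congruences for the Apery numbers\<close>

lemma S11_eq:
  "S11 = (\<Sum>k=1..(p - 1) div 2. of_nat ((2 * k) choose k) ^ 3 / 64 ^ k * (\<Sum>i=1..k. 1 / of_nat (2 * i - 1))\<^sup>2)"
proof -
  have "oddH 1 k = (\<Sum>i=1..k. 1 / of_nat (2 * i - 1))" for k
  proof -
    have "(\<Sum>i=1..k. 1 / of_nat (2 * i - 1) :: rat) = (\<Sum>j<k. 1 / of_nat (2 * Suc j - 1))"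
      by (simp only: One_nat_def sum.atLeast1_atMost_eq)
    also have "\<dots> = (\<Sum>j<k. 1 / (2 * of_nat j + 1) ^ 1)"
      by (intro sum.cong refl) (simp add: add.commute)
    finally show ?thesis by (simp add: oddH_def)
  qed
  moreover have "{..half} = insert 0 {1..(p - 1) div 2}" by (auto simp: half_def)
  ultimately show ?thesis by (simp add: S11_def \<beta>_def)
qed

lemma apery_1_mod_4:
  obtains X Y :: int where "odd X" "even Y" "X\<^sup>2 + Y\<^sup>2 = int p"
    "of_nat (apery' half) \<approx>[3] 4 * (of_int X)\<^sup>2 - 2 * pp - pp\<^sup>2 / (4 * (of_int X)\<^sup>2)
      + 3 * pp\<^sup>2 * (of_int X)\<^sup>2 * of_int (euler_number (p - 3)) + pp\<^sup>2 / 2 * S11"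
proof -
  obtain X Y :: int where X: "odd X" "even Y" "X\<^sup>2 + Y\<^sup>2 = int p"
    and W3: "W * (1 - pp\<^sup>2 * K / 8) \<approx>[3] 4 * (of_int X)\<^sup>2 - 2 * pp - pp\<^sup>2 / (4 * (of_int X)\<^sup>2)"
    and W1: "W \<approx>[1] 4 * (of_int X)\<^sup>2"
    by (rule quartic_representation)
  define x E :: rat where "x = of_int X" and "E = of_int (euler_number (p - 3))"
  have xE: "x \<in> Zp" "E \<in> Zp" by (simp_all add: x_def E_def)
  have "of_nat (apery' half) \<approx>[3] W * (1 + pp\<^sup>2 * K / 16) + pp\<^sup>2 * S11 / 2"
    unfolding K_def by (rule apery_eq_binomial_even[OF half_m p_not_3]) (simp add: W_def C_def)
  also have "\<dots> = W * (1 - pp\<^sup>2 * K / 8) + pp\<^sup>2 * (3 / 4 * (W * (K / 4))) + pp\<^sup>2 / 2 * S11"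
    by (simp add: field_simps)
  also have "\<dots> \<approx>[3] (4 * x\<^sup>2 - 2 * pp - pp\<^sup>2 / (4 * x\<^sup>2)) + pp\<^sup>2 * (3 / 4 * (4 * x\<^sup>2 * E)) + pp\<^sup>2 / 2 * S11"
  proof (intro pcong_add pcong_refl pcong_mult_p2)
    show "W * (1 - pp\<^sup>2 * K / 8) \<approx>[3] 4 * x\<^sup>2 - 2 * pp - pp\<^sup>2 / (4 * x\<^sup>2)"
      using W3 by (simp add: x_def)
    have "W * (K / 4) \<approx>[1] 4 * x\<^sup>2 * E"
      using W1 pcong_sym[OF euler_number_pcong] xE unfolding x_def E_def by (intro pcong_mult) simp_all
    then show "3 / 4 * (W * (K / 4)) \<approx>[1] 3 / 4 * (4 * x\<^sup>2 * E)" by (intro pcong_scale) simp_all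
  qed
  also have "\<dots> = 4 * x\<^sup>2 - 2 * pp - pp\<^sup>2 / (4 * x\<^sup>2) + 3 * pp\<^sup>2 * x\<^sup>2 * E + pp\<^sup>2 / 2 * S11"
    by simp
  finally show ?thesis unfolding x_def E_def by (rule that[OF X])
qed

end

text \<open>With \<open>P = X z - x Y\<close> and \<open>Q = X z + x Y\<close> one has \<open>P Q = p (X^2 - x^2)\<close>, so \<open>p\<close> divides \<open>P\<close> or \<open>Q\<close>.
  Brahmagupta's identity bounds both by \<open>p\<close> in absolute value, strictly because the other square in
  it is odd, so that one of them is \<open>0\<close>.\<close>

lemma two_squares_unique:
  fixes X Y x z :: int and p :: nat
  assumes p: "prime p" and XY: "X\<^sup>2 + Y\<^sup>2 = int p" and xz: "x\<^sup>2 + z\<^sup>2 = int p"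
    and par: "odd X" "even Y" "odd x" "even z"
  shows "X\<^sup>2 = x\<^sup>2"
proof -
  have p0: "int p > 0" using p prime_gt_0_nat by simp
  have zero: "a * z = b * Y \<longrightarrow> a\<^sup>2 = b\<^sup>2"
    if "a\<^sup>2 = X\<^sup>2" "b\<^sup>2 = x\<^sup>2" for a b
  proof
    assume "a * z = b * Y"
    then have "(a * z)\<^sup>2 = (b * Y)\<^sup>2" by simp
    then have "X\<^sup>2 * z\<^sup>2 = x\<^sup>2 * Y\<^sup>2" by (simp add: power_mult_distrib that)
    moreover have "z\<^sup>2 = int p - x\<^sup>2" "Y\<^sup>2 = int p - X\<^sup>2" using XY xz by linarith+
    ultimately have "int p * X\<^sup>2 = int p * x\<^sup>2" by (simp add: algebra_simps)
    then show "a\<^sup>2 = b\<^sup>2" using p0 that by simp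
  qed
  have main: "X\<^sup>2 = x\<^sup>2" if s: "s = 1 \<or> s = - 1" and d: "int p dvd X * z - s * x * Y" for s
  proof -
    have s2: "s * s = 1" using s by auto
    have "(X * z - s * x * Y)\<^sup>2 + (s * X * x + z * Y)\<^sup>2
        = (X * z)\<^sup>2 + (s * s) * (x * Y)\<^sup>2 + (s * s) * (X * x)\<^sup>2 + (z * Y)\<^sup>2"
      by (simp add: power2_eq_square algebra_simps)
    also have "\<dots> = (X\<^sup>2 + Y\<^sup>2) * (x\<^sup>2 + z\<^sup>2)"
      unfolding s2 by (simp add: power2_eq_square algebra_simps)
    finally have sq: "(X * z - s * x * Y)\<^sup>2 + (s * X * x + z * Y)\<^sup>2 = int p * int p"
      unfolding XY xz .
    have "odd (s * X * x + z * Y)" using par s by auto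
    then have "s * X * x + z * Y \<noteq> 0" by (metis dvd_0_right)
    then have "(s * X * x + z * Y)\<^sup>2 > 0" by (rule zero_less_power2[THEN iffD2])
    then have "\<bar>X * z - s * x * Y\<bar>\<^sup>2 < (int p)\<^sup>2" using sq unfolding power2_abs power2_eq_square[of "int p"] by linarith
    then have "\<bar>X * z - s * x * Y\<bar> < int p" by (rule power2_less_imp_less) simp
    then have "X * z - s * x * Y = 0" using d dvd_imp_le_int[of "X * z - s * x * Y" "int p"] by fastforce
    then have "X * z = (s * x) * Y" by simp
    moreover have "(s * x)\<^sup>2 = x\<^sup>2" using s2 by (simp add: power2_eq_square ac_simps)
    ultimately show ?thesis using zero[of X "s * x"] by simp
  qed
  have "(X * z - x * Y) * (X * z + x * Y) = X\<^sup>2 * z\<^sup>2 - x\<^sup>2 * Y\<^sup>2"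
    by (simp add: power2_eq_square algebra_simps)
  also have "\<dots> = int p * (X\<^sup>2 - x\<^sup>2)"
  proof -
    have zY: "z\<^sup>2 = int p - x\<^sup>2" "Y\<^sup>2 = int p - X\<^sup>2" using XY xz by linarith+
    show ?thesis unfolding zY by (simp add: algebra_simps)
  qed
  finally have "int p dvd (X * z - x * Y) * (X * z + x * Y)" by simp
  then have "int p dvd X * z - x * Y \<or> int p dvd X * z + x * Y"
    using p by (simp add: prime_dvd_mult_iff)
  then show ?thesis using main[of 1] main[of "- 1"] by auto
qed

theorem theorem2p1:
  fixes p :: nat
  assumes "prime p" and "odd p"
  shows
    "([p = 3] (mod 4) \<longrightarrow>
        rat_cong (of_nat (apery' ((p - 1) div 2)))
          ((of_nat p)\<^sup>2 / 3 * (of_nat (((p - 3) div 2) choose ((p - 3) div 4))) powi (- 2))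
          p 3) \<and>
     ([p = 1] (mod 4) \<longrightarrow>
        (\<exists>x y :: int. int p = x\<^sup>2 + 4 * y\<^sup>2) \<and>
        (\<forall>x y :: int. int p = x\<^sup>2 + 4 * y\<^sup>2 \<longrightarrow>
           rat_cong (of_nat (apery' ((p - 1) div 2)))
             (4 * (of_int x)\<^sup>2 - 2 * of_nat p - (of_nat p)\<^sup>2 / (4 * (of_int x)\<^sup>2)
              + 3 * (of_nat p)\<^sup>2 * (of_int x)\<^sup>2 * of_int (euler_number (p - 3))
              + (of_nat p)\<^sup>2 / 2 *
                (\<Sum>k=1..(p - 1) div 2.
                   of_nat ((2 * k) choose k) ^ 3 / 64 ^ k *
                   (\<Sum>i=1..k. 1 / of_nat (2 * i - 1))\<^sup>2))
             p 3))"
proof (intro conjI[of "_ \<longrightarrow> _"] impI)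
  interpret odd_prime p using assms by unfold_locales
  assume "[p = 3] (mod 4)"
  then have "p mod 4 = 3" by (simp add: cong_def)
  then obtain m where p: "p = 4 * m + 3" by (metis mult_div_mod_eq)
  show "rat_cong (of_nat (apery' ((p - 1) div 2)))
          ((of_nat p)\<^sup>2 / 3 * (of_nat (((p - 3) div 2) choose ((p - 3) div 4))) powi (- 2)) p 3"
  proof (cases "p = 3")
    case True
    have "apery' 1 = 3" by (simp add: apery'_def atLeast0AtMost)
    moreover have "rat_cong 3 3 p 3" using pcong_refl[of 3 3] unfolding pcong_def .
    ultimately show ?thesis using True by simp
  next
    case False
    have half: "half = 2 * m + 1" "(p - 1) div 2 = half" and m: "(p - 3) div 2 = 2 * m" "(p - 3) div 4 = m"
      unfolding half_def using p by simp_all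
    have "pp\<^sup>2 / 3 / (of_nat ((2 * m) choose m))\<^sup>2 = pp\<^sup>2 / 3 * (of_nat ((2 * m) choose m)) powi (- 2)"
      by (simp only: power_int_minus power_int_numeral divide_inverse)
    then show ?thesis
      using apery_3_mod_4[OF half(1) False] unfolding half(2) m pcong_def by (simp only:)
  qed
next
  let ?Q = "\<lambda>x :: int. rat_cong (of_nat (apery' ((p - 1) div 2)))
               (4 * (of_int x)\<^sup>2 - 2 * of_nat p - (of_nat p)\<^sup>2 / (4 * (of_int x)\<^sup>2)
                + 3 * (of_nat p)\<^sup>2 * (of_int x)\<^sup>2 * of_int (euler_number (p - 3))
                + (of_nat p)\<^sup>2 / 2 *
                  (\<Sum>k=1..(p - 1) div 2.
                     of_nat ((2 * k) choose k) ^ 3 / 64 ^ k *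
                     (\<Sum>i=1..k. 1 / of_nat (2 * i - 1))\<^sup>2))
               p 3"
  assume "[p = 1] (mod 4)"
  then have "p mod 4 = 1" by (simp add: cong_def)
  then obtain m where p: "p = 4 * m + 1" by (metis mult_div_mod_eq)
  interpret prime_1_mod_4 p m using assms p by unfold_locales
  have half: "(p - 1) div 2 = half" by (simp add: half_def)
  obtain X Y :: int where X: "odd X" "even Y" "X\<^sup>2 + Y\<^sup>2 = int p"
    and A: "of_nat (apery' half) \<approx>[3] 4 * (of_int X)\<^sup>2 - 2 * pp - pp\<^sup>2 / (4 * (of_int X)\<^sup>2)
      + 3 * pp\<^sup>2 * (of_int X)\<^sup>2 * of_int (euler_number (p - 3)) + pp\<^sup>2 / 2 * S11"
    by (rule apery_1_mod_4)
  obtain Y' where "Y = 2 * Y'" using X(2) by blast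
  then have "int p = X\<^sup>2 + 4 * Y'\<^sup>2" using X(3) by (simp add: power_mult_distrib)
  moreover have "?Q x" if xy: "int p = x\<^sup>2 + 4 * y\<^sup>2" for x y :: int
  proof -
    have "odd (int p)" using assms(2) by simp
    then have "odd x" unfolding xy by simp
    moreover have "x\<^sup>2 + (2 * y)\<^sup>2 = int p" using xy by (simp add: power_mult_distrib)
    moreover have "even (2 * y)" by simp
    ultimately have "X\<^sup>2 = x\<^sup>2" using two_squares_unique[OF assms(1) X(3) _ X(1,2), of x "2 * y"] by blast
    then have "(of_int X :: rat)\<^sup>2 = (of_int x)\<^sup>2" by (simp flip: of_int_power)
    then show ?thesis using A unfolding pcong_def half S11_eq by simp
  qed
  ultimately show "(\<exists>x y :: int. int p = x\<^sup>2 + 4 * y\<^sup>2) \<and>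
        (\<forall>x y :: int. int p = x\<^sup>2 + 4 * y\<^sup>2 \<longrightarrow>
           ?Q x)" by blast
qed

end
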